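(* Let $\mathbb F$ be an algebraically closed field of characteristic not $2$. Each pair $(A,B)$ of skew-symmetric matrices of the same size over $\mathbb F$ is congruent to a direct sum of pairs of the form \[ \mathcal J_n(\lambda)\ (\lambda\in\mathbb F),\quad \mathcal K_n,\quad \mathcal L_n,\qquad n\in\{1,2,\dots\}. \] This sum is uniquely determined by $(A,B)$, up to permutations of summands.
   Context: Two pairs $(A,B)$ and $(A',B')$ of square matrices of the same size over $\mathbb F$ are congruent if there exists a nonsingular matrix $S$ over $\mathbb F$ such that $(SAS^T,SBS^T)=(A',B')$. The direct sum of pairs is \[ (A,B)\oplus(A',B'):=\left(\begin{bmatrix}A&0\\0&A'\end{bmatrix},\begin{bmatrix}B&0\\0&B'\end{bmatrix}\right). \] For $\lambda\in\mathbb F$ and $n=1,2,\dots$, $J_n(\lambda)$ is the $n\times n$ Jordan block \[ J_n(\lambda):=\begin{bmatrix}\lambda&&&0\\1&\lambda\\&\ddots&\ddots\\0&&1&\lambda\end{bmatrix}, \] and $L_n$, $R_n$ are the $(n-1)\times n$ matrices \[ L_n:=\begin{bmatrix}1&0&&0\\&\ddots&\ddots\\0&&1&0\end{bmatrix},\qquad R_n:=\begin{bmatrix}0&1&&0\\&\ddots&\ddots\\0&&0&1\end{bmatrix}, \] i.e. $L_n=[I_{n-1}\;\,0]$ and $R_n=[0\;\,I_{n-1}]$. Define \[ \mathcal J_n(\lambda):=\left(\begin{bmatrix}0&I_n\\-I_n&0\end{bmatrix},\begin{bmatrix}0&J_n(\lambda)\\-J_n(\lambda)^T&0\end{bmatrix}\right),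 \] \[ \mathcal K_n:=\left(\begin{bmatrix}0&J_n(0)\\-J_n(0)^T&0\end{bmatrix},\begin{bmatrix}0&I_n\\-I_n&0\end{bmatrix}\right), \] \[ \mathcal L_n:=\left(\begin{bmatrix}0&L_n\\-L_n^T&0\end{bmatrix},\begin{bmatrix}0&R_n\\-R_n^T&0\end{bmatrix}\right). \] The matrices of $\mathcal J_n(\lambda)$ and $\mathcal K_n$ are $2n\times 2n$, and those of $\mathcal L_n$ are $(2n-1)\times(2n-1)$; in particular, $\mathcal L_1=([0],[0])$. *)

theory Defs
  imports
    "Jordan_Normal_Form.Jordan_Normal_Form"
    "HOL-Library.Multiset"
begin

definition skew_symmetric_mat :: "'a :: field mat \<Rightarrow> bool" where
  "skew_symmetric_mat A \<longleftrightarrow> square_mat A \<and> transpose_mat A = - A"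

fun congruent_pairs :: "'a :: field mat \<times> 'a mat \<Rightarrow> 'a mat \<times> 'a mat \<Rightarrow> bool" where
  "congruent_pairs (A, B) (A', B') \<longleftrightarrow>
    (\<exists>n S. {A, B, A', B', S} \<subseteq> carrier_mat n n \<and> invertible_mat S \<and>
      S * A * transpose_mat S = A' \<and> S * B * transpose_mat S = B')"

text \<open>The empty direct sum is the pair of matrices of size zero.\<close>

definition direct_sum_pairs :: "('a :: field mat \<times> 'a mat) list \<Rightarrow> 'a mat \<times> 'a mat" where
  "direct_sum_pairs ps = (diag_block_mat (map fst ps), diag_block_mat (map snd ps))"

text \<open>The library's Jordan block has its ones above the diagonal; here they are below it.\<close>

definition lower_jordan_block :: "nat \<Rightarrow> 'a :: field \<Rightarrow> 'a mat" where
  "lower_jordan_block n c = transpose_mat (jordan_block n c)"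

text \<open>For \<open>n = 1\<close> the following two matrices have no rows and one column.\<close>

definition L_mat :: "nat \<Rightarrow> 'a :: field mat" where
  "L_mat n = mat (n - 1) n (\<lambda>(i, j). if j = i then 1 else 0)"

definition R_mat :: "nat \<Rightarrow> 'a :: field mat" where
  "R_mat n = mat (n - 1) n (\<lambda>(i, j). if j = Suc i then 1 else 0)"

text \<open>The block matrix with rows \<open>(0, M)\<close> and \<open>(-M\<^sup>T, 0)\<close>, for \<open>M\<close> not necessarily square.\<close>

definition skew_block :: "'a :: field mat \<Rightarrow> 'a mat" where
  "skew_block M =
    four_block_mat (0\<^sub>m (dim_row M) (dim_row M)) M (- transpose_mat M) (0\<^sub>m (dim_col M) (dim_col M))"

definition J_pair :: "nat \<Rightarrow> 'a :: field \<Rightarrow> 'a mat \<times> 'a mat" where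
  "J_pair n c = (skew_block (1\<^sub>m n), skew_block (lower_jordan_block n c))"

definition K_pair :: "nat \<Rightarrow> 'a :: field mat \<times> 'a mat" where
  "K_pair n = (skew_block (lower_jordan_block n 0), skew_block (1\<^sub>m n))"

definition L_pair :: "nat \<Rightarrow> 'a :: field mat \<times> 'a mat" where
  "L_pair n = (skew_block (L_mat n), skew_block (R_mat n))"

definition canonical_pairs :: "('a :: field mat \<times> 'a mat) set" where
  "canonical_pairs =
    {J_pair n c | n c. 1 \<le> n} \<union> {K_pair n | n. 1 \<le> n} \<union> {L_pair n | n. 1 \<le> n}"

lemma L_pair_1: "L_pair 1 = (0\<^sub>m 1 1, 0\<^sub>m 1 1)"
  by (auto simp: L_pair_def skew_block_def L_mat_def R_mat_def intro!: eq_matI)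

end

theory Submission
  imports Defs "HOL-Library.Function_Algebras"
begin

text \<open>
  Existence. Since the characteristic is not 2, skew-symmetric matrices \<open>A\<close> and \<open>B\<close> are the Gram matrices of
  alternating forms \<open>a\<close> and \<open>b\<close> on the coordinate space, and a basis adapted to both forms is wanted.
  Let \<open>K\<close> be the radical of \<open>a\<close> on \<open>V\<close>. If \<open>b\<close> does not vanish on \<open>K\<close>, two vectors of \<open>K\<close> split off a summand
  \<open>K_pair 1\<close>; if a nonzero vector of \<open>K\<close> is in the radical of \<open>b\<close>, it splits off a summand \<open>L_pair 1\<close>.
  Otherwise let \<open>V1\<close> be a complement of \<open>K\<close>, and let \<open>U\<close> be the orthogonal of \<open>K\<close> for \<open>b\<close> in \<open>V1\<close>. It is
  smaller than \<open>V\<close>, and by induction it is an orthogonal sum of a space on which \<open>a\<close> is nondegenerate and of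
  spaces with bases (chains) of type \<open>K_pair n\<close> or \<open>L_pair n\<close>. The radical of \<open>a\<close> on \<open>U\<close> is spanned by the
  ends of chains that \<open>a\<close> leaves unmatched. As \<open>a\<close> is nondegenerate on \<open>V1\<close>, there are vectors
  \<open>c r\<close> in \<open>V1\<close> dual to these ends \<open>r\<close>, and hyperbolic pairs that fill up the rest of \<open>V1\<close>; and \<open>b\<close> is a
  perfect pairing between the span of all these new vectors and \<open>K\<close>. So every free end \<open>r\<close> is prolonged by \<open>c r\<close> and by
  the vector of \<open>K\<close> dual to \<open>c r\<close>, and every hyperbolic pair, with two vectors of \<open>K\<close>, becomes a
  \<open>K_pair 2\<close>. This is \<open>decomposition_extend\<close>; with it, \<open>decomposition_exists\<close> reduces the problem to
  a nondegenerate form \<open>a\<close>. In that case, \<open>nondeg_canonical_basis\<close> applies the same result to the pair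
  \<open>(b - l a, a)\<close> for an eigenvalue \<open>l\<close>: chains of type \<open>K_pair n\<close> of that pair are chains of type
  \<open>J_pair n l\<close> for \<open>(a, b)\<close>, and the rest is smaller.

  Uniqueness. For two linear combinations \<open>C\<close> and \<open>D\<close> of \<open>A\<close> and \<open>B\<close>, the dimension of the space of sequences
  \<open>z 0, \<dots>, z (k - 1)\<close> with \<open>C (z 0) = 0\<close> and \<open>C (z i) = D (z (i - 1))\<close> is invariant under congruence
  (\<open>pencil_nullity_congruent\<close>) and additive on direct sums (\<open>pencil_nullity_direct_sum\<close>). For
  \<open>(C, D) = (B - l A, A)\<close> it is \<open>2 min n k\<close> for \<open>J_pair n l\<close>, \<open>k\<close> for \<open>L_pair n\<close>, and \<open>0\<close> for the other canonical pairs.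
  For \<open>(C, D) = (A, B)\<close> it is \<open>2 min n k\<close> for \<open>K_pair n\<close>, \<open>k\<close> for \<open>L_pair n\<close>, and \<open>0\<close> for \<open>J_pair n l\<close>;
  with the additional condition \<open>B (z (k - 1)) = 0\<close> it is \<open>k - (n - 1)\<close>, truncated at \<open>0\<close>, for \<open>L_pair n\<close> and \<open>0\<close> for
  the other pairs. The second differences of these functions of \<open>k\<close> are the multiplicities of the
  summands (\<open>multiplicity_J\<close>, \<open>multiplicity_K\<close>, \<open>multiplicity_L\<close>).
\<close>

section \<open>Subspaces of finite dimension\<close>

text \<open>The locale \<^locale>\<open>vector_space\<close> once more; being a locale of its own, it does not pass the definitions
  made in it on to the interpretation of \<^locale>\<open>vector_space\<close> for real vector spaces. Subspaces of a vector space of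
  arbitrary dimension are used throughout, and \<^const>\<open>vector_space.dim\<close> is \<open>0\<close> on subspaces of
  infinite dimension, so finiteness is carried by a predicate of its own.\<close>

locale lin_space = vector_space scale
  for scale :: "'a :: field \<Rightarrow> 'b :: ab_group_add \<Rightarrow> 'b" (infixr \<open>*s\<close> 75)
begin

text \<open>A subspace of finite dimension.\<close>

definition fin_dim :: "'b set \<Rightarrow> bool" where
  "fin_dim V \<longleftrightarrow> subspace V \<and> (\<exists>S. finite S \<and> V \<subseteq> span S)"

lemma fin_dim_subspace: "fin_dim V \<Longrightarrow> subspace V"
  by (simp add: fin_dim_def)

lemma fin_dim_basis:
  assumes "fin_dim V"
  obtains B where "finite B" "B \<subseteq> V" "independent B" "span B = V" "card B = dim V"
proof -
  obtain S where S: "subspace V" "finite S" "V \<subseteq> span S" using assms by (auto simp: fin_dim_def)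
  obtain B where B: "B \<subseteq> V" "independent B" "V \<subseteq> span B" "card B = dim V" by (rule basis_exists)
  have "finite B" using independent_span_bound[OF S(2) B(2)] B(1) S(3) by blast
  moreover have "span B = V" using B S(1) by (simp add: span_minimal subset_antisym)
  ultimately show ?thesis using B that by blast
qed

lemma fin_dim_span: "finite S \<Longrightarrow> fin_dim (span S)"
  by (auto simp: fin_dim_def)

lemma fin_dim_subset: "fin_dim V \<Longrightarrow> subspace W \<Longrightarrow> W \<subseteq> V \<Longrightarrow> fin_dim W"
  by (auto simp: fin_dim_def)

lemma independent_card_le:
  assumes "fin_dim V" "independent S" "S \<subseteq> V"
  shows "finite S" "card S \<le> dim V"
proof -
  obtain B where B: "finite B" "B \<subseteq> V" "independent B" "span B = V" "card B = dim V"
    using fin_dim_basis[OF assms(1)] .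
  show "finite S" "card S \<le> dim V"
    using independent_span_bound[OF B(1) assms(2)] assms(3) B by auto
qed

lemma fin_dim_extend_basis:
  assumes "fin_dim V" "independent S" "S \<subseteq> V"
  obtains B where "S \<subseteq> B" "finite B" "B \<subseteq> V" "independent B" "span B = V" "card B = dim V"
proof -
  obtain B where B: "S \<subseteq> B" "B \<subseteq> V" "independent B" "V \<subseteq> span B"
    using maximal_independent_subset_extend[OF assms(3,2)] .
  have "span B = V" using B fin_dim_subspace[OF assms(1)] by (simp add: span_minimal subset_antisym)
  then show ?thesis using that[OF B(1) _ B(2,3)] B independent_card_le[OF assms(1) B(3,2)]
      basis_card_eq_dim by blast
qed

lemma dim_le_of_subset:
  assumes "fin_dim V" "W \<subseteq> V" "subspace W" shows "dim W \<le> dim V"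
proof -
  obtain B where B: "finite B" "B \<subseteq> W" "independent B" "span B = W" "card B = dim W"
    using fin_dim_basis[OF fin_dim_subset[OF assms(1,3,2)]] .
  then show ?thesis using independent_card_le[OF assms(1), of B] assms by auto
qed

lemma subspace_eq_of_dim:
  assumes "fin_dim V" "W \<subseteq> V" "subspace W" "dim V \<le> dim W" shows "W = V"
proof -
  obtain B where B: "finite B" "B \<subseteq> W" "independent B" "span B = W" "card B = dim W"
    using fin_dim_basis[OF fin_dim_subset[OF assms(1,3,2)]] .
  obtain B' where B': "B \<subseteq> B'" "finite B'" "B' \<subseteq> V" "independent B'" "span B' = V" "card B' = dim V"
    using fin_dim_extend_basis[OF assms(1) B(3)] B(2) assms(2) by blast
  have "B = B'" using B' B assms(4) by (metis card_seteq)
  then show ?thesis using B B' by simp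
qed

lemma dim_eq_0_iff:
  assumes "fin_dim V" shows "dim V = 0 \<longleftrightarrow> V = {0}"
proof -
  obtain B where B: "finite B" "B \<subseteq> V" "independent B" "span B = V" "card B = dim V"
    using fin_dim_basis[OF assms] .
  show ?thesis
  proof
    assume "dim V = 0" then have "B = {}" using B by simp
    then show "V = {0}" using B by auto
  next
    assume "V = {0}"
    then have "V \<subseteq> span {}" by simp
    then show "dim V = 0" using dim_le_card[of V "{}"] by simp
  qed
qed

text \<open>A spanning set that is no larger than the dimension is a basis. This is how independence is
  obtained below: the constructions only keep track of spans and of numbers of vectors.\<close>

lemma spanning_card_dim_independent:
  assumes "finite S" "card S \<le> dim (span S)"
  shows "independent S" "card S = dim (span S)"
proof -
  obtain B where B: "B \<subseteq> S" "independent B" "S \<subseteq> span B"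
    using maximal_independent_subset[of S] .
  have "span B = span S" using B by (metis span_mono span_subspace span_superset subspace_span subset_trans)
  then have "card B = dim (span S)" using dim_eq_card[of B S] B(2) by simp
  then have "B = S" using assms B(1) by (metis card_seteq)
  then show "independent S" "card S = dim (span S)" using B \<open>card B = _\<close> by auto
qed

lemma exists_complement:
  assumes "fin_dim V" "subspace W" "W \<subseteq> V"
  obtains W' where "subspace W'" "W' \<subseteq> V" "W \<inter> W' = {0}" "\<forall>v\<in>V. \<exists>w\<in>W. \<exists>w'\<in>W'. v = w + w'"
    "dim V = dim W + dim W'"
proof -
  obtain B where B: "finite B" "B \<subseteq> W" "independent B" "span B = W" "card B = dim W"
    using fin_dim_basis[OF fin_dim_subset[OF assms(1,2,3)]] .
  obtain B' where B': "B \<subseteq> B'" "finite B'" "B' \<subseteq> V" "independent B'" "span B' = V" "card B' = dim V"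
    using fin_dim_extend_basis[OF assms(1) B(3)] B(2) assms(3) by blast
  define W' where "W' = span (B' - B)"
  have 1: "W' \<subseteq> V" unfolding W'_def using B' by (metis Diff_subset span_mono)
  have 2: "\<exists>w\<in>W. \<exists>w'\<in>W'. v = w + w'" if "v \<in> V" for v
  proof -
    have "v \<in> span (B \<union> (B' - B))" using that B' by (simp add: Un_absorb1)
    then show ?thesis unfolding span_Un W'_def using B(4) by auto
  qed
  have ind: "independent (B' - B)" using B'(4) by (meson Diff_subset independent_mono)
  have 3: "dim W' = card (B' - B)" unfolding W'_def using dim_span_eq_card_independent[OF ind] .
  have 4: "dim V = dim W + dim W'" using 3 B B' by (metis card_Diff_subset card_mono le_add_diff_inverse)
  have 5: "W \<inter> W' = {0}"
  proof -
    have "x = 0" if x: "x \<in> span B" "x \<in> span (B' - B)" for x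
    proof -
      obtain u where u: "x = (\<Sum>v\<in>B. u v *s v)" using x(1) B(1) by (auto simp: span_finite)
      obtain w where w: "x = (\<Sum>v\<in>B'-B. w v *s v)" using x(2) B'(2) by (auto simp: span_finite)
      let ?c = "\<lambda>v. if v \<in> B then u v else - w v"
      have "(\<Sum>v\<in>B'. ?c v *s v) = (\<Sum>v\<in>B. ?c v *s v) + (\<Sum>v\<in>B'-B. ?c v *s v)"
        using sum.subset_diff[OF B'(1) B'(2), of "\<lambda>v. ?c v *s v"] by (simp add: add.commute)
      also have "\<dots> = x - x" using u w by (simp add: sum_negf)
      finally have "(\<Sum>v\<in>B'. ?c v *s v) = 0" by simp
      then have "\<forall>v\<in>B'. ?c v = 0" using independentD[OF B'(4) B'(2) subset_refl, of ?c] by blast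
      then have "u v = 0" if "v \<in> B" for v using B'(1) that by (metis subsetD)
      then show "x = 0" using u by simp
    qed
    then show ?thesis using B(4) W'_def by (auto simp: span_zero subspace_0 fin_dim_subspace assms)
  qed
  show ?thesis using that[of W'] 1 2 4 5 by (simp add: W'_def)
qed

lemma dim_direct_sum:
  assumes "fin_dim V" "subspace W" "W \<subseteq> V" "subspace U" "U \<subseteq> V" "W \<inter> U = {0}"
    "\<And>v. v \<in> V \<Longrightarrow> \<exists>w\<in>W. \<exists>u\<in>U. v = w + u"
  shows "dim V = dim W + dim U"
proof -
  obtain B where B: "finite B" "B \<subseteq> W" "independent B" "span B = W" "card B = dim W"
    using fin_dim_basis[OF fin_dim_subset[OF assms(1,2,3)]] .
  obtain C where C: "finite C" "C \<subseteq> U" "independent C" "span C = U" "card C = dim U"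
    using fin_dim_basis[OF fin_dim_subset[OF assms(1,4,5)]] .
  have disj: "B \<inter> C = {}"
  proof -
    have "x = 0" if "x \<in> B \<inter> C" for x
      using that B(2) C(2) assms(6) by (metis IntD1 IntD2 IntI empty_iff insert_iff subsetD)
    moreover have "0 \<notin> B" using B(3) dependent_zero by metis
    ultimately show ?thesis by (metis IntD1 ex_in_conv)
  qed
  have ind: "independent (B \<union> C)"
  proof (rule independent_if_scalars_zero)
    show "finite (B \<union> C)" using B C by simp
    fix f x assume s: "(\<Sum>x\<in>B \<union> C. f x *s x) = 0" and x: "x \<in> B \<union> C"
    let ?p = "\<Sum>x\<in>B. f x *s x" and ?q = "\<Sum>x\<in>C. f x *s x"
    have pq: "?p + ?q = 0" using s disj B(1) C(1) by (simp add: sum.union_disjoint)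
    have p: "?p \<in> W" unfolding B(4)[symmetric] by (intro span_sum span_scale span_base)
    have q: "?q \<in> U" unfolding C(4)[symmetric] by (intro span_sum span_scale span_base)
    have "?p = - ?q" using pq by (simp add: eq_neg_iff_add_eq_0)
    then have "?p \<in> U" using q assms(4) by (metis subspace_neg)
    then have "?p = 0" using p assms(6) by blast
    moreover from this have "?q = 0" using pq by simp
    ultimately show "f x = 0" using x independentD[OF B(3,1) subset_refl, of f] independentD[OF C(3,1) subset_refl, of f]
      by blast
  qed
  have "V = span (B \<union> C)"
  proof
    show "V \<subseteq> span (B \<union> C)" using assms(7) B(4) C(4) unfolding span_Un by fastforce
    show "span (B \<union> C) \<subseteq> V" using B(2) C(2) assms(3,5) fin_dim_subspace[OF assms(1)] by (intro span_minimal) auto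
  qed
  then have "dim V = card (B \<union> C)" using dim_span_eq_card_independent[OF ind] by simp
  then show ?thesis using disj B C by (simp add: card_Un_disjoint)
qed

text \<open>A linear form on the whole space.\<close>

definition functional :: "('b \<Rightarrow> 'a) \<Rightarrow> bool" where
  "functional g \<longleftrightarrow> (\<forall>x y. g (x + y) = g x + g y) \<and> (\<forall>c x. g (c *s x) = c * g x)"

lemma functional_sum: "functional g \<Longrightarrow> g (\<Sum>i\<in>I. f i) = (\<Sum>i\<in>I. g (f i))"
proof (induction I rule: infinite_finite_induct)
  case (infinite A) then have "g (0 *s 0) = 0" unfolding functional_def by (metis mult_zero_left)
  then show ?case using infinite by simp
next
  case empty then have "g (0 *s 0) = 0" unfolding functional_def by (metis mult_zero_left)
  then show ?case by simp
next
  case (insert x F) then show ?case by (simp add: functional_def)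
qed

lemma functional_0: "functional g \<Longrightarrow> g 0 = 0"
  using functional_sum[of g "\<lambda>_. 0" "{}"] by simp

lemma functional_diff: "functional g \<Longrightarrow> g (x - y) = g x - g y"
  by (metis add_diff_cancel add_diff_cancel_left' diff_add_cancel functional_def)

lemma functional_neg: "functional g \<Longrightarrow> g (- x) = - g x"
  using functional_diff[of g 0 x] functional_0[of g] by simp

lemma subspace_zeros:
  assumes "subspace V" "\<And>i. i \<in> I \<Longrightarrow> functional (g i)"
  shows "subspace {v\<in>V. \<forall>i\<in>I. g i v = 0}"
  unfolding subspace_def using assms functional_0[of "g _"]
  by (auto simp: subspace_0 subspace_add subspace_scale functional_def)

lemma dim_zeros_single:
  assumes "fin_dim V" "functional g"
  shows "dim V \<le> dim {v\<in>V. g v = 0} + 1"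
proof -
  let ?W = "{v\<in>V. g v = 0}"
  have W: "subspace ?W" using subspace_zeros[of V "{()}" "\<lambda>_. g"] assms fin_dim_subspace by simp
  have sub: "?W \<subseteq> V" by auto
  obtain W' where W': "subspace W'" "W' \<subseteq> V" "?W \<inter> W' = {0}" "dim V = dim ?W + dim W'"
    by (rule exists_complement[OF assms(1) W sub], rule that; assumption)
  have fdW': "fin_dim W'" using fin_dim_subset[OF assms(1) W'(1,2)] .
  have "dim W' \<le> 1"
  proof (cases "W' = {0}")
    case True then show ?thesis using dim_eq_0_iff[OF fdW'] by simp
  next
    case False
    then obtain x where x: "x \<in> W'" "x \<noteq> 0" using subspace_0[OF W'(1)] by auto
    have gx: "g x \<noteq> 0" using x W'(2,3) by auto
    have "y \<in> span {x}" if y: "y \<in> W'" for y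
    proof -
      let ?z = "y - (g y / g x) *s x"
      have "?z \<in> W'" using x y W'(1) by (simp add: subspace_diff subspace_scale)
      moreover have "g ?z = 0" using gx assms(2) by (simp add: functional_diff) (simp add: functional_def)
      ultimately have "?z \<in> ?W \<inter> W'" using W'(2) by blast
      then have "?z = 0" unfolding W'(3) by simp
      then have "y = (g y / g x) *s x" by simp
      then show ?thesis by (metis insertI1 span_base span_scale)
    qed
    then have "dim W' \<le> card {x}" by (intro dim_le_card) auto
    then show ?thesis by simp
  qed
  then show ?thesis using W'(4) by simp
qed

text \<open>Each linear condition lowers the dimension by at most one.\<close>

lemma dim_zeros:
  assumes "fin_dim V" "finite I" "\<And>i. i \<in> I \<Longrightarrow> functional (g i)"
  shows "dim V \<le> dim {v\<in>V. \<forall>i\<in>I. g i v = 0} + card I"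
  using assms(2,3)
proof (induction I)
  case empty then show ?case by simp
next
  case (insert i I)
  let ?W = "{v\<in>V. \<forall>i\<in>I. g i v = 0}"
  have "fin_dim ?W" using fin_dim_subset[OF assms(1)] subspace_zeros[OF fin_dim_subspace[OF assms(1)], of I g] insert by auto
  then have "dim ?W \<le> dim {v\<in>?W. g i v = 0} + 1" using dim_zeros_single insert by blast
  moreover have "{v\<in>?W. g i v = 0} = {v\<in>V. \<forall>i\<in>insert i I. g i v = 0}" by auto
  ultimately show ?case using insert by simp
qed

text \<open>Linear forms that separate the points of \<open>X\<close> and are not more numerous than \<open>dim X\<close> have a dual
  family of vectors in \<open>X\<close>: the common zeros of all the forms but one have positive dimension.\<close>

lemma dual_family:
  assumes "fin_dim X" "finite I" "\<And>i. i \<in> I \<Longrightarrow> functional (g i)" "card I \<le> dim X"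
    "\<And>x. x \<in> X \<Longrightarrow> (\<And>i. i \<in> I \<Longrightarrow> g i x = 0) \<Longrightarrow> x = 0"
  shows "\<exists>d. \<forall>r\<in>I. d r \<in> X \<and> (\<forall>i\<in>I. g i (d r) = (if i = r then 1 else 0))"
proof -
  have "\<exists>x\<in>X. \<forall>i\<in>I. g i x = (if i = r then 1 else 0)" if r: "r \<in> I" for r
  proof -
    define W where "W = {v\<in>X. \<forall>i\<in>I-{r}. g i v = 0}"
    have sW: "subspace W" "W \<subseteq> X"
      unfolding W_def using subspace_zeros[OF fin_dim_subspace[OF assms(1)], of "I-{r}" g] assms by auto
    have "dim X \<le> dim W + card (I - {r})"
      unfolding W_def using dim_zeros[OF assms(1), of "I-{r}" g] assms by auto
    moreover have "card (I - {r}) < card I" using r assms(2) by (meson card_Diff1_less)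
    ultimately have "dim W \<noteq> 0" using assms(4) by linarith
    then have "W \<noteq> {0}" using dim_eq_0_iff[OF fin_dim_subset[OF assms(1) sW]] by simp
    then obtain x where x: "x \<in> W" "x \<noteq> 0" using subspace_0[OF sW(1)] by blast
    then have x': "x \<in> X" "\<And>i. i \<in> I \<Longrightarrow> i \<noteq> r \<Longrightarrow> g i x = 0" by (auto simp: W_def)
    have gx: "g r x \<noteq> 0"
    proof
      assume "g r x = 0"
      then have "g i x = 0" if "i \<in> I" for i using x'(2)[OF that] by (cases "i = r") auto
      then show False using assms(5)[OF x'(1)] x(2) by blast
    qed
    have "(1 / g r x) *s x \<in> X" using x' fin_dim_subspace[OF assms(1)] by (simp add: subspace_scale)
    moreover have "\<forall>i\<in>I. g i ((1 / g r x) *s x) = (if i = r then 1 else 0)"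
      using x'(2) gx assms(3) r by (auto simp: functional_def)
    ultimately show ?thesis by blast
  qed
  then have "\<forall>r\<in>I. \<exists>x. x \<in> X \<and> (\<forall>i\<in>I. g i x = (if i = r then 1 else 0))" by blast
  then show ?thesis by (rule bchoice)
qed

end

section \<open>Alternating forms\<close>

context lin_space
begin

text \<open>A bilinear form, in curried notation, that vanishes on the diagonal.\<close>

definition alternating :: "('b \<Rightarrow> 'b \<Rightarrow> 'a) \<Rightarrow> bool" where
  "alternating f \<longleftrightarrow> (\<forall>x. functional (f x)) \<and> (\<forall>y. functional (\<lambda>x. f x y)) \<and> (\<forall>x. f x x = 0)"

text \<open>The restriction of \<open>f\<close> to \<open>V\<close> has zero radical.\<close>

definition nondeg :: "('b \<Rightarrow> 'b \<Rightarrow> 'a) \<Rightarrow> 'b set \<Rightarrow> bool" where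
  "nondeg f V \<longleftrightarrow> (\<forall>x\<in>V. (\<forall>y\<in>V. f x y = 0) \<longrightarrow> x = 0)"

lemma nondegD: "nondeg f V \<Longrightarrow> x \<in> V \<Longrightarrow> (\<And>y. y \<in> V \<Longrightarrow> f x y = 0) \<Longrightarrow> x = 0"
  by (auto simp: nondeg_def)

text \<open>The orthogonal of \<open>U\<close> inside \<open>V\<close>; the radical of \<open>f\<close> on \<open>V\<close> is \<open>perp f V V\<close>.\<close>

definition perp :: "('b \<Rightarrow> 'b \<Rightarrow> 'a) \<Rightarrow> 'b set \<Rightarrow> 'b set \<Rightarrow> 'b set" where
  "perp f V U = {v \<in> V. \<forall>u\<in>U. f v u = 0}"

lemma alternating_functional:
  "alternating f \<Longrightarrow> functional (f x)" "alternating f \<Longrightarrow> functional (\<lambda>x. f x y)"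
  by (auto simp: alternating_def)

lemma alternating_simps:
  assumes "alternating f"
  shows "f (x + y) z = f x z + f y z" "f z (x + y) = f z x + f z y"
    "f (k *s x) z = k * f x z" "f z (k *s x) = k * f z x"
    "f (x - y) z = f x z - f y z" "f z (x - y) = f z x - f z y"
    "f (- x) z = - f x z" "f z (- x) = - f z x"
    "f 0 z = 0" "f z 0 = 0" "f x x = 0"
    "f (\<Sum>i\<in>I. h i) z = (\<Sum>i\<in>I. f (h i) z)" "f z (\<Sum>i\<in>I. h i) = (\<Sum>i\<in>I. f z (h i))"
proof -
  note L = alternating_functional(2)[OF assms, of z] and R = alternating_functional(1)[OF assms, of z]
  show "f (x + y) z = f x z + f y z" "f (k *s x) z = k * f x z" using L by (auto simp: functional_def)
  show "f z (x + y) = f z x + f z y" "f z (k *s x) = k * f z x" using R by (auto simp: functional_def)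
  show "f (x - y) z = f x z - f y z" "f (- x) z = - f x z" "f 0 z = 0"
    "f (\<Sum>i\<in>I. h i) z = (\<Sum>i\<in>I. f (h i) z)"
    by (rule functional_diff[OF L] functional_neg[OF L] functional_0[OF L] functional_sum[OF L])+
  show "f z (x - y) = f z x - f z y" "f z (- x) = - f z x" "f z 0 = 0"
    "f z (\<Sum>i\<in>I. h i) = (\<Sum>i\<in>I. f z (h i))"
    by (rule functional_diff[OF R] functional_neg[OF R] functional_0[OF R] functional_sum[OF R])+
  show "f x x = 0" using assms by (simp add: alternating_def)
qed

lemma alternating_skew:
  assumes "alternating f" shows "f y x = - f x y"
proof -
  have "f (x + y) (x + y) = f x x + f y x + (f x y + f y y)"
    by (simp only: alternating_simps(1,2)[OF assms])
  then have "f y x + f x y = 0" by (simp add: alternating_simps(11)[OF assms])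
  then show ?thesis by (simp add: eq_neg_iff_add_eq_0)
qed

lemma alternating_zero_sym: "alternating f \<Longrightarrow> f x y = 0 \<Longrightarrow> f y x = 0"
  using alternating_skew[of f y x] by simp

lemma subspace_functional_zeros: "functional g \<Longrightarrow> subspace {x. g x = 0}"
  using subspace_zeros[of UNIV "{()}" "\<lambda>_. g"] by simp

lemma alternating_span_zero:
  assumes "alternating f" "x \<in> span S" "\<And>s. s \<in> S \<Longrightarrow> f y s = 0" shows "f y x = 0"
  using span_minimal[of S "{x. f y x = 0}"] subspace_functional_zeros[OF alternating_functional(1)[OF assms(1)]]
    assms(2,3) by blast

lemma perp_subspace:
  assumes "alternating f" "subspace V" shows "subspace (perp f V U)"
  unfolding perp_def using subspace_zeros[OF assms(2), of U "\<lambda>u x. f x u"] alternating_functional[OF assms(1)] by simp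

lemma perp_subset: "perp f V U \<subseteq> V" by (auto simp: perp_def)

lemma nondeg_dual_basis:
  assumes "alternating f" "fin_dim V" "nondeg f V" "finite B" "independent B" "span B = V"
  obtains d where "\<And>r. r \<in> B \<Longrightarrow> d r \<in> V" "\<And>r s. r \<in> B \<Longrightarrow> s \<in> B \<Longrightarrow> f (d r) s = (if s = r then 1 else 0)"
proof -
  have "\<exists>d. \<forall>r\<in>B. d r \<in> V \<and> (\<forall>s\<in>B. f (d r) s = (if s = r then 1 else 0))"
  proof (rule dual_family[OF assms(2,4)])
    show "card B \<le> dim V" using dim_span_eq_card_independent[OF assms(5)] assms(6) by simp
    show "functional (\<lambda>x. f x i)" for i using alternating_functional[OF assms(1)] by simp
    fix x assume x: "x \<in> V" "\<And>i. i \<in> B \<Longrightarrow> f x i = 0"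
    then show "x = 0" using assms(6) alternating_span_zero[OF assms(1), of _ B x] nondegD[OF assms(3) x(1)] by auto
  qed
  then obtain d where d: "\<forall>r\<in>B. d r \<in> V \<and> (\<forall>s\<in>B. f (d r) s = (if s = r then 1 else 0))" by (rule exE)
  show ?thesis by (rule that[of d]) (use d in auto)
qed

lemma nondeg_project:
  assumes "alternating f" "fin_dim U" "nondeg f U"
  shows "\<exists>u\<in>U. \<forall>y\<in>U. f (v - u) y = 0"
proof -
  obtain B where B: "finite B" "B \<subseteq> U" "independent B" "span B = U" "card B = dim U"
    using fin_dim_basis[OF assms(2)] .
  obtain d where d: "\<And>r. r \<in> B \<Longrightarrow> d r \<in> U" "\<And>r s. r \<in> B \<Longrightarrow> s \<in> B \<Longrightarrow> f (d r) s = (if s = r then 1 else 0)"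
    using nondeg_dual_basis[OF assms B(1,3,4)] by blast
  define u where "u = (\<Sum>r\<in>B. f v r *s d r)"
  have "u \<in> U" unfolding u_def using d(1) fin_dim_subspace[OF assms(2)] by (intro subspace_sum subspace_scale) auto
  moreover have "f (v - u) s = 0" if s: "s \<in> B" for s
  proof -
    have "f u s = (\<Sum>r\<in>B. f v r * f (d r) s)" by (simp add: u_def alternating_simps[OF assms(1)])
    also have "\<dots> = (\<Sum>r\<in>B. if r = s then f v r else 0)" using d(2) s by (intro sum.cong) auto
    also have "\<dots> = f v s" using s B(1) by simp
    finally show ?thesis by (simp add: alternating_simps[OF assms(1)])
  qed
  ultimately show ?thesis using B(4) alternating_span_zero[OF assms(1), of _ B "v - u"] by blast
qed

lemma perp_decomposition:
  assumes "alternating f" "fin_dim V" "subspace U" "U \<subseteq> V" "nondeg f U"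
  shows "dim V = dim U + dim (perp f V U)"
    and "\<And>v. v \<in> V \<Longrightarrow> \<exists>u\<in>U. \<exists>w\<in>perp f V U. v = u + w"
    and "nondeg f V \<Longrightarrow> nondeg f (perp f V U)"
proof -
  have V: "subspace V" using fin_dim_subspace[OF assms(2)] .
  have fdU: "fin_dim U" using fin_dim_subset[OF assms(2,3,4)] .
  show *: "\<exists>u\<in>U. \<exists>w\<in>perp f V U. v = u + w" if v: "v \<in> V" for v
  proof -
    obtain u where u: "u \<in> U" "\<forall>y\<in>U. f (v - u) y = 0" using nondeg_project[OF assms(1) fdU assms(5)] by blast
    have "v - u \<in> perp f V U" using u v V assms(4) by (auto simp: perp_def subspace_diff)
    then show ?thesis using u(1) by (intro bexI[of _ u] bexI[of _ "v - u"]) auto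
  qed
  have P: "subspace (perp f V U)" using perp_subspace[OF assms(1) V] .
  have "U \<inter> perp f V U = {0}"
  proof -
    have "x = 0" if "x \<in> U" "x \<in> perp f V U" for x
      using nondegD[OF assms(5) that(1)] that(2) by (simp add: perp_def)
    then show ?thesis using subspace_0[OF P] subspace_0[OF assms(3)] by blast
  qed
  then show "dim V = dim U + dim (perp f V U)"
    using dim_direct_sum[OF assms(2-4) P perp_subset] * by simp
  assume nd: "nondeg f V"
  show "nondeg f (perp f V U)"
    unfolding nondeg_def
  proof (intro ballI impI)
    fix x assume x: "x \<in> perp f V U" "\<forall>y\<in>perp f V U. f x y = 0"
    have "f x v = 0" if v: "v \<in> V" for v
    proof -
      obtain u w where uw: "u \<in> U" "w \<in> perp f V U" "v = u + w" using *[OF v] by blast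
      then show ?thesis using x by (simp add: alternating_simps[OF assms(1)] perp_def)
    qed
    then show "x = 0" using nondegD[OF nd] x(1) by (simp add: perp_def)
  qed
qed

lemma hyperbolic_plane:
  assumes "alternating f" "f x y = 1"
  shows "nondeg f (span {x, y})" "dim (span {x, y}) = 2"
proof -
  have yx: "f y x = - 1" using alternating_skew[OF assms(1), of y x] assms(2) by simp
  have sp: "\<exists>s t. v = s *s x + t *s y" if "v \<in> span {x, y}" for v
  proof -
    obtain s where "v - s *s x \<in> span {y}" using \<open>v \<in> span {x, y}\<close> span_breakdown_eq[of v x "{y}"] by blast
    then obtain t where "v - s *s x = t *s y" by (auto simp: span_singleton)
    then show ?thesis by (metis add.commute diff_add_cancel)
  qed
  have x: "x \<in> span {x, y}" and y: "y \<in> span {x, y}" by (simp_all add: span_base)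
  show nd: "nondeg f (span {x, y})"
    unfolding nondeg_def
  proof (intro ballI impI)
    fix v assume v: "v \<in> span {x, y}" "\<forall>z\<in>span {x, y}. f v z = 0"
    obtain s t where st: "v = s *s x + t *s y" using sp[OF v(1)] by blast
    have "f v x = 0" "f v y = 0" using v(2) x y by auto
    then have "t = 0" "s = 0" using assms(2) yx by (simp_all add: st alternating_simps[OF assms(1)])
    then show "v = 0" using st by simp
  qed
  have neq: "x \<noteq> y" using assms alternating_simps(11)[OF assms(1), of x] by auto
  have "independent {x, y}"
  proof -
    have "x \<notin> span {y}"
    proof
      assume "x \<in> span {y}" then obtain t where "x = t *s y" by (auto simp: span_singleton)
      then show False using assms by (simp add: alternating_simps[OF assms(1)])
    qed
    moreover have "y \<noteq> 0" using assms by (auto simp: alternating_simps[OF assms(1)])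
    ultimately show ?thesis by (simp add: independent_insertI)
  qed
  then show "dim (span {x, y}) = 2" using dim_span_eq_card_independent[of "{x, y}"] neq by simp
qed

lemma hyperbolic_split:
  assumes "alternating f" "fin_dim V" "x \<in> V" "y \<in> V" "f x y = 1"
  defines "V' \<equiv> perp f V (span {x, y})"
  shows "fin_dim V'" "dim V = dim V' + 2" "V' \<subseteq> V" "V \<subseteq> span ({x, y} \<union> V')"
    "\<And>v. v \<in> V' \<longleftrightarrow> v \<in> V \<and> f v x = 0 \<and> f v y = 0" "nondeg f V \<Longrightarrow> nondeg f V'"
proof -
  have U: "subspace (span {x, y})" "span {x, y} \<subseteq> V" using assms(3,4) fin_dim_subspace[OF assms(2)]
    by (simp_all add: span_minimal)
  note H = hyperbolic_plane[OF assms(1,5)]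
  note P = perp_decomposition[OF assms(1,2) U H(1), folded V'_def]
  show "V' \<subseteq> V" unfolding V'_def by (rule perp_subset)
  then show "fin_dim V'" using fin_dim_subset[OF assms(2)] perp_subspace[OF assms(1) fin_dim_subspace[OF assms(2)]] V'_def by blast
  show "dim V = dim V' + 2" using P(1) H(2) by simp
  show "V \<subseteq> span ({x, y} \<union> V')"
  proof
    fix v assume "v \<in> V"
    then obtain u w where uw: "u \<in> span {x, y}" "w \<in> V'" "v = u + w" using P(2) by blast
    have "u \<in> span ({x, y} \<union> V')" using uw(1) span_mono[of "{x, y}" "{x, y} \<union> V'"] by blast
    moreover have "w \<in> span ({x, y} \<union> V')" using uw(2) by (intro span_base) simp
    ultimately show "v \<in> span ({x, y} \<union> V')" using uw(3) span_add by simp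
  qed
  show "v \<in> V' \<longleftrightarrow> v \<in> V \<and> f v x = 0 \<and> f v y = 0" for v
    unfolding V'_def perp_def using alternating_span_zero[OF assms(1), of _ "{x, y}" v]
    by (auto simp: span_base)
  show "nondeg f V \<Longrightarrow> nondeg f V'" using P(3) .
qed

text \<open>All vectors of the first pair are orthogonal to all vectors of the second one.\<close>

definition ortho_pairs :: "('b \<Rightarrow> 'b \<Rightarrow> 'a) \<Rightarrow> 'b \<times> 'b \<Rightarrow> 'b \<times> 'b \<Rightarrow> bool" where
  "ortho_pairs f p q \<longleftrightarrow> (\<forall>u\<in>{fst p, snd p}. \<forall>v\<in>{fst q, snd q}. f u v = 0)"

text \<open>A completion of the isotropic set \<open>R\<close> to a symplectic basis of \<open>V\<close>: the vectors \<open>c r\<close> are dual to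
  the vectors \<open>r\<close> of \<open>R\<close>, and \<open>ps\<close> lists hyperbolic pairs orthogonal to everything else.
  By the last line the spanning family, counted with repetitions, has \<open>dim V\<close> members.\<close>

definition symplectic_completion where
  "symplectic_completion f V R c ps \<longleftrightarrow>
    (\<forall>r\<in>R. c r \<in> V \<and> (\<forall>s\<in>R. f (c r) s = (if r = s then 1 else 0) \<and> f (c r) (c s) = 0)) \<and>
    (\<forall>p\<in>set ps. fst p \<in> V \<and> snd p \<in> V \<and> f (fst p) (snd p) = 1 \<and>
      (\<forall>u\<in>{fst p, snd p}. \<forall>r\<in>R. f u r = 0 \<and> f u (c r) = 0)) \<and>
    sorted_wrt (ortho_pairs f) ps \<and>
    V \<subseteq> span (R \<union> c ` R \<union> fst ` set ps \<union> snd ` set ps) \<and>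
    2 * card R + 2 * length ps = dim V"

lemma symplectic_completion_exists:
  assumes "alternating f" "fin_dim V" "nondeg f V" "finite R" "R \<subseteq> V" "independent R"
    "\<And>r s. r \<in> R \<Longrightarrow> s \<in> R \<Longrightarrow> f r s = 0"
  shows "\<exists>c ps. symplectic_completion f V R c ps"
  using assms(2-)
proof (induction "dim V" arbitrary: V R rule: less_induct)
  case less
  note alt = assms(1)
  show ?case
  proof (cases "R = {}")
    case True
    show ?thesis
    proof (cases "V = {0}")
      case True2: True
      have "symplectic_completion f V R c []" for c
        using True True2 dim_eq_0_iff[OF less.prems(1)] by (simp add: symplectic_completion_def)
      then show ?thesis by blast
    next
      case False
      then obtain x where x: "x \<in> V" "x \<noteq> 0" using subspace_0[OF fin_dim_subspace[OF less.prems(1)]] by blast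
      then obtain y where y: "y \<in> V" "f x y \<noteq> 0" using less.prems(2) by (auto simp: nondeg_def)
      define z where "z = (1 / f x y) *s y"
      have z: "z \<in> V" "f x z = 1" using y fin_dim_subspace[OF less.prems(1)]
        by (simp_all add: z_def subspace_scale alternating_simps[OF alt])
      define V' where "V' = perp f V (span {x, z})"
      note H = hyperbolic_split[OF alt less.prems(1) x(1) z, folded V'_def]
      have "\<exists>c ps. symplectic_completion f V' {} c ps"
        using H(2) less.hyps[OF _ H(1) H(6)[OF less.prems(2)], of "{}"]
        by (simp add: independent_empty)
      then obtain c ps where ps: "symplectic_completion f V' {} c ps" by blast
      have "V \<subseteq> span (fst ` set ((x, z) # ps) \<union> snd ` set ((x, z) # ps))" (is "_ \<subseteq> span ?S")
      proof -
        have "V' \<subseteq> span ?S" using ps span_mono[of "fst ` set ps \<union> snd ` set ps" ?S]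
          by (auto simp: symplectic_completion_def)
        then have "{x, z} \<union> V' \<subseteq> span ?S" by (auto intro: span_base)
        then have "span ({x, z} \<union> V') \<subseteq> span ?S" by (rule span_minimal) simp
        then show ?thesis using H(4) by blast
      qed
      moreover have "\<forall>p\<in>set ps. ortho_pairs f (x, z) p"
      proof
        fix p assume "p \<in> set ps"
        then have "fst p \<in> V'" "snd p \<in> V'" using ps by (auto simp: symplectic_completion_def)
        then show "ortho_pairs f (x, z) p"
          using alternating_zero_sym[OF alt] unfolding ortho_pairs_def by (auto simp: H(5))
      qed
      ultimately have "symplectic_completion f V R c ((x, z) # ps)"
        using ps True x z H(2,3) unfolding symplectic_completion_def by auto
      then show ?thesis by blast
    qed
  next
    case False
    then obtain r where r: "r \<in> R" by blast
    obtain B where B: "R \<subseteq> B" "finite B" "B \<subseteq> V" "independent B" "span B = V" "card B = dim V"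
      using fin_dim_extend_basis[OF less.prems(1,5,4)] .
    obtain d where d: "\<And>r. r \<in> B \<Longrightarrow> d r \<in> V" "\<And>r s. r \<in> B \<Longrightarrow> s \<in> B \<Longrightarrow> f (d r) s = (if s = r then 1 else 0)"
      using nondeg_dual_basis[OF alt less.prems(1,2) B(2,4,5)] by blast
    define e where "e = d r"
    have rB: "r \<in> B" using r B(1) by blast
    have e: "e \<in> V" "\<And>s. s \<in> R \<Longrightarrow> f e s = (if s = r then 1 else 0)"
      unfolding e_def using d(1)[OF rB] d(2)[OF rB] B(1) by auto
    have rV: "r \<in> V" using r less.prems(4) by blast
    define V' where "V' = perp f V (span {e, r})"
    note H = hyperbolic_split[OF alt less.prems(1) e(1) rV, folded V'_def]
    have er: "f e r = 1" using e(2)[OF r] by simp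
    note H = H[OF er]
    define R' where "R' = R - {r}"
    have "R' \<subseteq> V'"
    proof
      fix s assume "s \<in> R'"
      then have s: "s \<in> R" "s \<noteq> r" by (auto simp: R'_def)
      then show "s \<in> V'" using e(2)[OF s(1)] less.prems(4,6) r alternating_zero_sym[OF alt, of e s] by (auto simp: H(5))
    qed
    moreover have "independent R'" using independent_mono[OF less.prems(5), of R'] by (auto simp: R'_def)
    ultimately have "\<exists>c ps. symplectic_completion f V' R' c ps"
      using H(2) less.hyps[OF _ H(1) H(6)[OF less.prems(2)], of R'] less.prems(3,6)
      by (auto simp: R'_def)
    then obtain c ps where ps: "symplectic_completion f V' R' c ps" by blast
    define c' where "c' = c(r := e)"
    have Rr: "R = insert r R'" "r \<notin> R'" using r by (auto simp: R'_def)
    have cR: "c' ` R = insert e (c ` R')" using Rr by (auto simp: c'_def)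
    have mem: "\<And>s. s \<in> R' \<Longrightarrow> c s \<in> V'" "\<And>p. p \<in> set ps \<Longrightarrow> fst p \<in> V' \<and> snd p \<in> V'"
      using ps by (auto simp: symplectic_completion_def)
    have ez: "f v e = 0" "f v r = 0" "f e v = 0" "f r v = 0" if "v \<in> V'" for v
      using that H(5)[of v] alternating_zero_sym[OF alt] by auto
    have "V \<subseteq> span (R \<union> c' ` R \<union> fst ` set ps \<union> snd ` set ps)" (is "_ \<subseteq> span ?S")
    proof -
      have "V' \<subseteq> span ?S"
        using ps span_mono[of "R' \<union> c ` R' \<union> fst ` set ps \<union> snd ` set ps" ?S] Rr(1) cR
        unfolding symplectic_completion_def by blast
      moreover have "e \<in> ?S" "r \<in> ?S" using cR Rr by auto
      ultimately have "{e, r} \<union> V' \<subseteq> span ?S" by (auto intro: span_base)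
      then have "span ({e, r} \<union> V') \<subseteq> span ?S" by (rule span_minimal) simp
      then show ?thesis using H(4) by blast
    qed
    moreover have "2 * card R + 2 * length ps = dim V"
      using ps H(2) Rr less.prems(3) by (simp add: symplectic_completion_def)
    moreover have "c' s \<in> V \<and> (\<forall>t\<in>R. f (c' s) t = (if s = t then 1 else 0) \<and> f (c' s) (c' t) = 0)" if s: "s \<in> R" for s
    proof (cases "s = r")
      case True then show ?thesis
        using e er Rr mem(1) ez alternating_simps(11)[OF alt] by (auto simp: c'_def)
    next
      case False
      then have s': "s \<in> R'" using s Rr by auto
      then show ?thesis using ps False H(3) ez[OF mem(1)[OF s']] Rr
        by (auto simp: c'_def symplectic_completion_def)
    qed
    moreover have "\<forall>p\<in>set ps. fst p \<in> V \<and> snd p \<in> V \<and> f (fst p) (snd p) = 1 \<and>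
      (\<forall>u\<in>{fst p, snd p}. \<forall>s\<in>R. f u s = 0 \<and> f u (c' s) = 0)"
    proof
      fix p assume p: "p \<in> set ps"
      show "fst p \<in> V \<and> snd p \<in> V \<and> f (fst p) (snd p) = 1 \<and>
        (\<forall>u\<in>{fst p, snd p}. \<forall>s\<in>R. f u s = 0 \<and> f u (c' s) = 0)"
        using ps p mem(2)[OF p] H(3) Rr ez[of "fst p"] ez[of "snd p"] unfolding c'_def symplectic_completion_def
        by auto
    qed
    moreover have "sorted_wrt (ortho_pairs f) ps" using ps by (simp add: symplectic_completion_def)
    ultimately have "symplectic_completion f V R c' ps" unfolding symplectic_completion_def by blast
    then show ?thesis by blast
  qed
qed

end

section \<open>Chains and decompositions for two alternating forms\<close>

locale two_forms = lin_space scale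
  for scale :: "'a :: field \<Rightarrow> 'b :: ab_group_add \<Rightarrow> 'b" (infixr \<open>*s\<close> 75) +
  fixes a b :: "'b \<Rightarrow> 'b \<Rightarrow> 'a"
  assumes alt_a: "alternating a" and alt_b: "alternating b" and two_nonzero: "(2 :: 'a) \<noteq> 0"
begin

text \<open>A chain is a pair \<open>(es, fs)\<close> of lists of vectors, each of them isotropic for both forms. It stands for
  the basis \<open>es @ fs\<close> of a space on which both forms have a matrix of the shape \<^const>\<open>skew_block\<close>.\<close>

definition vecs :: "'b list \<times> 'b list \<Rightarrow> 'b list" where
  "vecs p = fst p @ snd p"

text \<open>The form \<open>f\<close> has the matrix \<open>skew_block M\<close> in the basis \<open>es @ fs\<close>.\<close>

definition chain_gram :: "('b \<Rightarrow> 'b \<Rightarrow> 'a) \<Rightarrow> (nat \<Rightarrow> nat \<Rightarrow> 'a) \<Rightarrow> 'b list \<times> 'b list \<Rightarrow> bool" where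
  "chain_gram f M p \<longleftrightarrow>
    (\<forall>i<length (fst p). \<forall>j<length (fst p). f (fst p ! i) (fst p ! j) = 0) \<and>
    (\<forall>i<length (snd p). \<forall>j<length (snd p). f (snd p ! i) (snd p ! j) = 0) \<and>
    (\<forall>i<length (fst p). \<forall>j<length (snd p). f (fst p ! i) (snd p ! j) = M i j)"

text \<open>The bases of \<open>K_pair n\<close> and \<open>L_pair n\<close>. Joining two basis vectors that are not orthogonal turns such a
  basis into a path, whose edges belong alternately to \<open>a\<close> and to \<open>b\<close>. A chain of the first kind
  is a path \<open>e\<^sub>0 f\<^sub>0 e\<^sub>1 f\<^sub>1 \<dots>\<close> that begins and ends with an edge of \<open>b\<close>; a chain of the second kind
  is a path \<open>f\<^sub>0 e\<^sub>0 f\<^sub>1 e\<^sub>1 \<dots>\<close> that begins with an edge of \<open>a\<close> and ends with an edge of \<open>b\<close>, or a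
  single vector. The two kinds are distinguished by the lengths of the lists.\<close>

definition K_chain :: "'b list \<times> 'b list \<Rightarrow> bool" where
  "K_chain p \<longleftrightarrow> length (fst p) = length (snd p) \<and> fst p \<noteq> [] \<and>
    chain_gram a (\<lambda>i j. if i = Suc j then 1 else 0) p \<and> chain_gram b (\<lambda>i j. if i = j then 1 else 0) p"

definition L_chain :: "'b list \<times> 'b list \<Rightarrow> bool" where
  "L_chain p \<longleftrightarrow> length (snd p) = Suc (length (fst p)) \<and>
    chain_gram a (\<lambda>i j. if i = j then 1 else 0) p \<and> chain_gram b (\<lambda>i j. if j = Suc i then 1 else 0) p"

text \<open>The vectors of a chain that lie on no edge of \<open>a\<close>: both ends of the path for the first kind, its
  last vector for the second kind.\<close>

definition ends :: "'b list \<times> 'b list \<Rightarrow> 'b list" where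
  "ends p = (if length (fst p) = length (snd p) then [hd (fst p), last (snd p)] else [last (snd p)])"

definition ortho :: "'b set \<Rightarrow> 'b set \<Rightarrow> bool" where
  "ortho X Y \<longleftrightarrow> (\<forall>u\<in>X. \<forall>v\<in>Y. a u v = 0 \<and> b u v = 0)"

definition ortho_chains :: "'b list \<times> 'b list \<Rightarrow> 'b list \<times> 'b list \<Rightarrow> bool" where
  "ortho_chains p q \<longleftrightarrow> ortho (set (vecs p)) (set (vecs q))"

definition all_vecs :: "('b list \<times> 'b list) list \<Rightarrow> 'b list" where
  "all_vecs ps = concat (map vecs ps)"

lemma set_all_vecs: "set (all_vecs ps) = (\<Union>p\<in>set ps. set (vecs p))"
  by (auto simp: all_vecs_def)

text \<open>An orthogonal decomposition, for both forms, of \<open>V\<close> into a subspace \<open>W\<close> on which \<open>a\<close> is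
  nondegenerate and spaces spanned by chains. For \<open>V\<close> of finite dimension, the last two conditions
  together make the sum direct and the vectors of all chains independent.\<close>

definition decomposition :: "'b set \<Rightarrow> 'b set \<Rightarrow> ('b list \<times> 'b list) list \<Rightarrow> bool" where
  "decomposition V W ps \<longleftrightarrow>
    subspace W \<and> W \<subseteq> V \<and> nondeg a W \<and> (\<forall>p\<in>set ps. K_chain p \<or> L_chain p) \<and>
    sorted_wrt ortho_chains ps \<and> set (all_vecs ps) \<subseteq> V \<and> ortho W (set (all_vecs ps)) \<and>
    V \<subseteq> span (W \<union> set (all_vecs ps)) \<and> dim W + length (all_vecs ps) \<le> dim V"

lemmas a_simps = alternating_simps[OF alt_a] and b_simps = alternating_simps[OF alt_b]

lemma ortho_sym: "ortho X Y \<Longrightarrow> ortho Y X"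
  unfolding ortho_def using alternating_zero_sym[OF alt_a] alternating_zero_sym[OF alt_b] by blast

lemma decomposition_distinct:
  assumes "fin_dim V" "decomposition V W ps"
  shows "distinct (all_vecs ps)" "independent (set (all_vecs ps))"
    "dim W + card (set (all_vecs ps)) = dim V"
proof -
  have W: "subspace W" "W \<subseteq> V" using assms(2) by (auto simp: decomposition_def)
  obtain B where B: "finite B" "B \<subseteq> W" "independent B" "span B = W" "card B = dim W"
    using fin_dim_basis[OF fin_dim_subset[OF assms(1) W]] .
  let ?S = "set (all_vecs ps)"
  have "V = span (B \<union> ?S)"
  proof
    have "span (W \<union> ?S) \<subseteq> span (B \<union> ?S)"
    proof (rule span_minimal)
      show "W \<union> ?S \<subseteq> span (B \<union> ?S)"
        using B(4) span_mono[of B "B \<union> ?S"] by (auto intro: span_base)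
    qed simp
    then show "V \<subseteq> span (B \<union> ?S)" using assms(2) by (auto simp: decomposition_def)
    show "span (B \<union> ?S) \<subseteq> V"
      using assms(2) B(2) fin_dim_subspace[OF assms(1)] by (intro span_minimal) (auto simp: decomposition_def)
  qed
  moreover have le: "card (B \<union> ?S) \<le> card B + card ?S" "card ?S \<le> length (all_vecs ps)"
    by (auto intro: card_Un_le card_length)
  moreover have *: "card B + length (all_vecs ps) \<le> dim V" using assms(2) B(5) by (simp add: decomposition_def)
  ultimately have "independent (B \<union> ?S)" "card (B \<union> ?S) = dim V"
    using spanning_card_dim_independent[of "B \<union> ?S"] B(1) by auto
  then show "independent ?S" by (meson independent_mono sup_ge2)
  have "card ?S = length (all_vecs ps)" using le * \<open>card (B \<union> ?S) = dim V\<close> by linarith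
  then show "distinct (all_vecs ps)" by (rule card_distinct)
  show "dim W + card ?S = dim V" using le * \<open>card (B \<union> ?S) = dim V\<close> B(5) by linarith
qed

lemma decomposition_ortho:
  assumes "decomposition V W ps" "p \<in> set ps" "q \<in> set ps" "p \<noteq> q"
  shows "ortho (set (vecs p)) (set (vecs q))"
proof -
  obtain i j where ij: "i < length ps" "j < length ps" "p = ps ! i" "q = ps ! j"
    using assms(2,3) by (metis in_set_conv_nth)
  then have "i < j \<or> j < i" using assms(4) by (metis nat_neq_iff)
  then show ?thesis
    using ij assms(1) ortho_sym unfolding decomposition_def sorted_wrt_iff_nth_less ortho_chains_def by blast
qed

lemma chain_ends:
  assumes "K_chain p \<or> L_chain p" "r \<in> set (ends p)"
  shows "r \<in> set (vecs p)" "\<And>v. v \<in> set (vecs p) \<Longrightarrow> a r v = 0"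
proof -
  obtain es fs where p: "p = (es, fs)" by (cases p)
  have fs: "fs \<noteq> []" using assms(1) by (auto simp: p K_chain_def L_chain_def)
  have lastfs: "last fs = fs ! (length fs - 1)" using fs by (simp add: last_conv_nth)
  have *: "r \<in> set (vecs p) \<and> (\<forall>v\<in>set (vecs p). a r v = 0)"
  proof (cases "length es = length fs")
    case True
    then have K: "K_chain p" using assms(1) by (auto simp: p L_chain_def)
    have es: "es \<noteq> []" using K by (simp add: p K_chain_def)
    have hdes: "hd es = es ! 0" using es by (simp add: hd_conv_nth)
    have pos: "0 < length fs" using fs by simp
    have r: "r = hd es \<or> r = last fs" using assms(2) True by (auto simp: ends_def p)
    have "a (hd es) v = 0" if "v \<in> set es \<union> set fs" for v
      using that K pos True unfolding hdes K_chain_def chain_gram_def p by (auto simp: in_set_conv_nth)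
    moreover have "a v (last fs) = 0" if "v \<in> set es \<union> set fs" for v
      using that K fs True unfolding lastfs K_chain_def chain_gram_def p by (auto simp: in_set_conv_nth)
    ultimately show ?thesis using r es fs alternating_zero_sym[OF alt_a] by (auto simp: vecs_def p)
  next
    case False
    then have L: "L_chain p" using assms(1) by (auto simp: p K_chain_def)
    have r: "r = last fs" using assms(2) False by (auto simp: ends_def p)
    have "a v (last fs) = 0" if "v \<in> set es \<union> set fs" for v
      using that L fs unfolding lastfs L_chain_def chain_gram_def p by (auto simp: in_set_conv_nth)
    then show ?thesis using r fs alternating_zero_sym[OF alt_a] by (auto simp: vecs_def p)
  qed
  then show "r \<in> set (vecs p)" "\<And>v. v \<in> set (vecs p) \<Longrightarrow> a r v = 0" by auto
qed

lemma chain_partner: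
  assumes "K_chain p \<or> L_chain p" "v \<in> set (vecs p)" "v \<notin> set (ends p)"
  shows "\<exists>w\<in>set (vecs p). a v w \<noteq> 0 \<and> (\<forall>u\<in>set (vecs p). u \<noteq> v \<longrightarrow> a u w = 0)"
proof -
  obtain es fs where p: "p = (es, fs)" by (cases p)
  have fs: "fs \<noteq> []" using assms(1) by (auto simp: p K_chain_def L_chain_def)
  have lastfs: "last fs = fs ! (length fs - 1)" using fs by (simp add: last_conv_nth)
  obtain d where a_es: "\<And>i j. i < length es \<Longrightarrow> j < length es \<Longrightarrow> a (es ! i) (es ! j) = 0"
    and a_fs: "\<And>i j. i < length fs \<Longrightarrow> j < length fs \<Longrightarrow> a (fs ! i) (fs ! j) = 0"
    and a_ef: "\<And>i j. i < length es \<Longrightarrow> j < length fs \<Longrightarrow> a (es ! i) (fs ! j) = (if i = j + d then 1 else 0)"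
    and d: "(d = 1 \<and> length es = length fs) \<or> (d = 0 \<and> length fs = Suc (length es))"
    using assms(1)
  proof
    assume "K_chain p" then show thesis using that[of 1] by (simp add: p K_chain_def chain_gram_def)
  next
    assume "L_chain p" then show thesis using that[of 0] by (simp add: p L_chain_def chain_gram_def)
  qed
  have a_fe: "a (fs ! j) (es ! i) = (if i = j + d then - 1 else 0)" if "i < length es" "j < length fs" for i j
    using a_ef[OF that] alternating_skew[OF alt_a, of "fs ! j" "es ! i"] by auto
  consider i where "i < length es" "v = es ! i" | j where "j < length fs" "v = fs ! j"
    using assms(2) by (auto simp: vecs_def p in_set_conv_nth)
  then show ?thesis
  proof cases
    case 1
    have "d \<le> i"
    proof (rule ccontr)
      assume "\<not> d \<le> i" then have "d = 1" "i = 0" "length es = length fs" using d by auto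
      then have "v = hd es" using 1 by (cases es) auto
      then show False using assms(3) \<open>length es = length fs\<close> by (simp add: ends_def p)
    qed
    then have j: "i - d < length fs" "i = (i - d) + d" using 1 d by auto
    show ?thesis
    proof (intro bexI[of _ "fs ! (i - d)"] conjI ballI impI)
      show "fs ! (i - d) \<in> set (vecs p)" using j by (simp add: vecs_def p)
      show "a v (fs ! (i - d)) \<noteq> 0" using a_ef[OF 1(1) j(1)] j 1(2) by simp
      fix u assume u: "u \<in> set (vecs p)" "u \<noteq> v"
      then consider k where "k < length es" "u = es ! k" "k \<noteq> i" | k where "k < length fs" "u = fs ! k"
        using 1 by (auto simp: vecs_def p in_set_conv_nth)
      then show "a u (fs ! (i - d)) = 0" using a_ef[OF _ j(1)] a_fs[OF _ j(1)] j(2) by cases auto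
    qed
  next
    case 2
    have "j + d < length es"
    proof (rule ccontr)
      assume "\<not> j + d < length es" then have "j = length fs - 1" using d 2 by auto
      then have "v = last fs" using 2 lastfs by simp
      then show False using assms(3) by (cases "length es = length fs") (auto simp: ends_def p)
    qed
    note j = this
    show ?thesis
    proof (intro bexI[of _ "es ! (j + d)"] conjI ballI impI)
      show "es ! (j + d) \<in> set (vecs p)" using j by (simp add: vecs_def p)
      show "a v (es ! (j + d)) \<noteq> 0" using a_fe[OF j 2(1)] 2(2) by simp
      fix u assume u: "u \<in> set (vecs p)" "u \<noteq> v"
      then consider k where "k < length fs" "u = fs ! k" "k \<noteq> j" | k where "k < length es" "u = es ! k"
        using 2 by (auto simp: vecs_def p in_set_conv_nth)
      then show "a u (es ! (j + d)) = 0" using a_fe[OF j] a_es[OF _ j] by cases auto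
    qed
  qed
qed

text \<open>The ends of all chains; they span the radical of \<open>a\<close> on the space that is decomposed.\<close>

definition free_ends :: "('b list \<times> 'b list) list \<Rightarrow> 'b set" where
  "free_ends ps = (\<Union>p\<in>set ps. set (ends p))"

lemma decomposition_free_ends:
  assumes "decomposition V W ps"
  defines "B \<equiv> set (all_vecs ps)" and "R \<equiv> free_ends ps"
  shows "R \<subseteq> B" "\<And>r v. r \<in> R \<Longrightarrow> v \<in> B \<Longrightarrow> a r v = 0" "\<And>r v. r \<in> R \<Longrightarrow> v \<in> W \<Longrightarrow> a r v = 0"
    "\<And>v. v \<in> B - R \<Longrightarrow> \<exists>w\<in>B - R. a v w \<noteq> 0 \<and> (\<forall>u\<in>B. u \<noteq> v \<longrightarrow> a u w = 0)"
proof -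
  have ch: "\<And>p. p \<in> set ps \<Longrightarrow> K_chain p \<or> L_chain p" using assms(1) by (auto simp: decomposition_def)
  show RB: "R \<subseteq> B" unfolding R_def B_def free_ends_def set_all_vecs using chain_ends(1)[OF ch] by blast
  show RBz: "a r v = 0" if r: "r \<in> R" and v: "v \<in> B" for r v
  proof -
    obtain p q where p: "p \<in> set ps" "r \<in> set (ends p)" and q: "q \<in> set ps" "v \<in> set (vecs q)"
      using r v by (auto simp: R_def B_def free_ends_def set_all_vecs)
    show ?thesis
    proof (cases "p = q")
      case True then show ?thesis using chain_ends(2)[OF ch[OF p(1)] p(2)] q by blast
    next
      case False
      then show ?thesis using decomposition_ortho[OF assms(1) p(1) q(1)] chain_ends(1)[OF ch[OF p(1)] p(2)] q
        by (auto simp: ortho_def)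
    qed
  qed
  have oW: "ortho W B" using assms(1) by (simp add: decomposition_def B_def)
  show "a r v = 0" if "r \<in> R" "v \<in> W" for r v
    using ortho_sym[OF oW] that RB by (auto simp: ortho_def)
  show "\<exists>w\<in>B - R. a v w \<noteq> 0 \<and> (\<forall>u\<in>B. u \<noteq> v \<longrightarrow> a u w = 0)" if v: "v \<in> B - R" for v
  proof -
    obtain p where p: "p \<in> set ps" "v \<in> set (vecs p)" using v by (auto simp: B_def set_all_vecs)
    have "v \<notin> set (ends p)" using v p by (auto simp: R_def free_ends_def)
    then obtain w where w: "w \<in> set (vecs p)" "a v w \<noteq> 0" "\<forall>u\<in>set (vecs p). u \<noteq> v \<longrightarrow> a u w = 0"
      using chain_partner[OF ch[OF p(1)] p(2)] by blast
    have "a u w = 0" if u: "u \<in> B" "u \<noteq> v" for u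
    proof -
      obtain q where q: "q \<in> set ps" "u \<in> set (vecs q)" using u by (auto simp: B_def set_all_vecs)
      show ?thesis
      proof (cases "q = p")
        case True then show ?thesis using w q u by blast
      next
        case False
        then show ?thesis using decomposition_ortho[OF assms(1) q(1) p(1)] q w(1) by (auto simp: ortho_def)
      qed
    qed
    moreover have "w \<in> B" using w p by (auto simp: B_def set_all_vecs)
    moreover have "w \<notin> R"
    proof
      assume "w \<in> R"
      then have "a w v = 0" using RBz v by blast
      then show False using w(2) alternating_zero_sym[OF alt_a] by blast
    qed
    ultimately show ?thesis using w(2) by blast
  qed
qed

text \<open>The space spanned by \<open>W\<close> and the vectors of the chains other than the free ends is nondegenerate
  for \<open>a\<close>, since \<open>a\<close> matches these vectors in pairs.\<close>

lemma decomposition_nondeg_part: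
  assumes "decomposition V W ps"
  defines "B \<equiv> set (all_vecs ps)" and "R \<equiv> free_ends ps"
  shows "nondeg a (span (W \<union> (B - R)))"
  unfolding nondeg_def
proof (intro ballI impI)
  fix x assume x: "x \<in> span (W \<union> (B - R))" "\<forall>y\<in>span (W \<union> (B - R)). a x y = 0"
  note D = decomposition_free_ends[OF assms(1), folded B_def R_def]
  have W: "subspace W" "nondeg a W" "ortho W B" using assms(1) by (auto simp: decomposition_def B_def)
  have fin: "finite (B - R)" by (simp add: B_def)
  have sW: "span W = W" using W(1) by (simp add: span_eq_iff)
  have "\<exists>w y. x = w + y \<and> w \<in> W \<and> y \<in> span (B - R)" using x(1) unfolding span_Un sW by blast
  then obtain w y where wy: "x = w + y" "w \<in> W" "y \<in> span (B - R)" by blast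
  then obtain q where q: "y = (\<Sum>v\<in>B-R. q v *s v)" using fin by (auto simp: span_finite)
  have "q v = 0" if v: "v \<in> B - R" for v
  proof -
    obtain v' where v': "v' \<in> B - R" "a v v' \<noteq> 0" "\<forall>u\<in>B. u \<noteq> v \<longrightarrow> a u v' = 0" using D(4)[OF v] by blast
    have "a x v' = 0" using x(2) v' by (blast intro: span_base)
    moreover have "a w v' = 0" using W(3) wy(2) v' by (auto simp: ortho_def)
    ultimately have "a y v' = 0" by (simp add: wy(1) a_simps)
    moreover have "a y v' = (\<Sum>u\<in>B-R. q u * a u v')" by (simp add: q a_simps)
    moreover have "\<dots> = (\<Sum>u\<in>B-R. if u = v then q v * a v v' else 0)" using v' by (intro sum.cong) auto
    ultimately have "q v * a v v' = 0" using fin v by simp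
    then show ?thesis using v'(2) by simp
  qed
  then have "y = 0" unfolding q by (intro sum.neutral) auto
  then have xw: "x = w" using wy by simp
  show "x = 0" using nondegD[OF W(2), of x] wy(2) xw x(2) span_base[of _ "W \<union> (B - R)"] by blast
qed

end

section \<open>Prolonging chains by the radical\<close>

text \<open>The situation of the inductive step: \<open>K\<close> lies in the radical of \<open>a\<close> on \<open>V\<close> and is isotropic for \<open>b\<close>,
  the subspace \<open>U\<close> is orthogonal to \<open>K\<close> for \<open>b\<close>, and \<open>C\<close> is a finite set with a family \<open>k\<close> in \<open>K\<close> that
  is dual to \<open>C\<close> with respect to \<open>b\<close>.\<close>

locale kernel_extension = two_forms scale a b
  for scale :: "'a :: field \<Rightarrow> 'b :: ab_group_add \<Rightarrow> 'b" (infixr \<open>*s\<close> 75) and a b :: "'b \<Rightarrow> 'b \<Rightarrow> 'a" +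
  fixes V K U C :: "'b set" and k :: "'b \<Rightarrow> 'b"
  assumes finite_C: "finite C" and subspace_K: "subspace K"
    and K_V: "K \<subseteq> V" and U_V: "U \<subseteq> V" and C_V: "C \<subseteq> V"
    and k_K: "\<And>c. c \<in> C \<Longrightarrow> k c \<in> K"
    and a_K: "\<And>x y. x \<in> K \<Longrightarrow> y \<in> V \<Longrightarrow> a x y = 0"
    and b_KK: "\<And>x y. x \<in> K \<Longrightarrow> y \<in> K \<Longrightarrow> b x y = 0"
    and b_UK: "\<And>x y. x \<in> U \<Longrightarrow> y \<in> K \<Longrightarrow> b x y = 0"
    and b_dual: "\<And>c d. c \<in> C \<Longrightarrow> d \<in> C \<Longrightarrow> b c (k d) = (if c = d then 1 else 0)"
begin

text \<open>Moving a vector by an element of \<open>K\<close> does not change \<open>a\<close>. The shift \<open>shift 1\<close> makes \<open>U\<close> orthogonal to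
  \<open>C\<close> for \<open>b\<close>, and \<open>shift (1/2)\<close> makes \<open>C\<close> isotropic for \<open>b\<close>; with the factor \<open>1/2\<close> each of the two
  vectors in \<open>b c d\<close> contributes one half of the correction.\<close>

definition corr :: "'a \<Rightarrow> 'b \<Rightarrow> 'b" where
  "corr h x = (\<Sum>c\<in>C. (h * b c x) *s k c)"

definition shift :: "'a \<Rightarrow> 'b \<Rightarrow> 'b" where
  "shift h x = x - corr h x"

lemma corr_K: "corr h x \<in> K"
  unfolding corr_def using k_K subspace_K by (intro subspace_sum subspace_scale) auto

lemma a_K': "x \<in> V \<Longrightarrow> y \<in> K \<Longrightarrow> a x y = 0"
  using a_K alternating_zero_sym[OF alt_a] by blast

lemma b_KU: "x \<in> K \<Longrightarrow> y \<in> U \<Longrightarrow> b x y = 0"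
  using b_UK alternating_zero_sym[OF alt_b] by blast

lemma b_corr: assumes "d \<in> C" shows "b d (corr h x) = h * b d x"
proof -
  have "b d (corr h x) = (\<Sum>c\<in>C. h * b c x * b d (k c))" by (simp add: corr_def b_simps)
  also have "\<dots> = (\<Sum>c\<in>C. if c = d then h * b d x else 0)" using b_dual assms by (intro sum.cong) auto
  finally show ?thesis using assms finite_C by simp
qed

lemma b_corr': "d \<in> C \<Longrightarrow> b (corr h x) d = - (h * b d x)"
  using b_corr alternating_skew[OF alt_b, of "corr h x" d] by simp

lemma shift_V: "subspace V \<Longrightarrow> x \<in> V \<Longrightarrow> shift h x \<in> V"
  unfolding shift_def using corr_K K_V by (intro subspace_diff) auto

lemma shift_linear:
  "shift h (x + y) = shift h x + shift h y" "shift h (r *s x) = r *s shift h x"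
proof -
  have "corr h (x + y) = corr h x + corr h y"
    by (simp add: corr_def b_simps sum.distrib[symmetric] algebra_simps scale_left_distrib)
  then show "shift h (x + y) = shift h x + shift h y" by (simp add: shift_def)
  have "corr h (r *s x) = r *s corr h x"
    by (simp add: corr_def b_simps scale_sum_right mult.left_commute)
  then show "shift h (r *s x) = r *s shift h x" by (simp add: shift_def scale_right_diff_distrib)
qed

lemma a_shift: "x \<in> V \<Longrightarrow> y \<in> V \<Longrightarrow> a (shift h x) (shift g y) = a x y"
  using a_K[OF corr_K] a_K'[OF _ corr_K] corr_K K_V by (simp add: shift_def a_simps subset_iff)

lemma a_k:
  assumes "c \<in> C"
  shows "x \<in> V \<Longrightarrow> a (k c) (shift h x) = 0" "x \<in> V \<Longrightarrow> a (shift h x) (k c) = 0" "d \<in> C \<Longrightarrow> a (k c) (k d) = 0"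
proof -
  have *: "a (k c) (shift h x) = 0" if "x \<in> V"
    using that a_K[OF k_K[OF assms]] corr_K K_V by (simp add: shift_def a_simps subset_iff)
  then show "x \<in> V \<Longrightarrow> a (k c) (shift h x) = 0" .
  show "x \<in> V \<Longrightarrow> a (shift h x) (k c) = 0" using * alternating_zero_sym[OF alt_a] by blast
  show "d \<in> C \<Longrightarrow> a (k c) (k d) = 0" using a_K[OF k_K[OF assms]] k_K K_V by blast
qed

lemma b_k:
  assumes "c \<in> C"
  shows "u \<in> U \<Longrightarrow> b (shift h u) (k c) = 0" "u \<in> U \<Longrightarrow> b (k c) (shift h u) = 0" "d \<in> C \<Longrightarrow> b (k c) (k d) = 0"
    "d \<in> C \<Longrightarrow> b (shift h d) (k c) = (if d = c then 1 else 0)"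
    "d \<in> C \<Longrightarrow> b (k c) (shift h d) = (if d = c then - 1 else 0)"
proof -
  show *: "u \<in> U \<Longrightarrow> b (shift h u) (k c) = 0"
    using b_KK[OF corr_K k_K[OF assms]] b_UK[OF _ k_K[OF assms]] by (simp add: shift_def b_simps)
  then show "u \<in> U \<Longrightarrow> b (k c) (shift h u) = 0" using alternating_zero_sym[OF alt_b] by blast
  show "d \<in> C \<Longrightarrow> b (k c) (k d) = 0" using b_KK k_K assms by blast
  show **: "d \<in> C \<Longrightarrow> b (shift h d) (k c) = (if d = c then 1 else 0)"
    using b_KK[OF corr_K k_K[OF assms]] b_dual[OF _ assms] by (simp add: shift_def b_simps)
  then show "d \<in> C \<Longrightarrow> b (k c) (shift h d) = (if d = c then - 1 else 0)"
    using alternating_skew[OF alt_b, of "k c" "shift h d"] by simp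
qed

lemma b_shift_UU: "u \<in> U \<Longrightarrow> v \<in> U \<Longrightarrow> b (shift h u) (shift g v) = b u v"
  using b_KK[OF corr_K corr_K] b_UK[OF _ corr_K] b_KU[OF corr_K] by (simp add: shift_def b_simps)

lemma b_shift_UC: "u \<in> U \<Longrightarrow> c \<in> C \<Longrightarrow> b (shift 1 u) (shift h c) = 0"
  using b_KK[OF corr_K corr_K] b_UK[OF _ corr_K] b_corr'[of c 1 u] alternating_skew[OF alt_b, of u c]
  by (simp add: shift_def b_simps)

lemma b_shift_CU: "u \<in> U \<Longrightarrow> c \<in> C \<Longrightarrow> b (shift h c) (shift 1 u) = 0"
  using b_shift_UC alternating_zero_sym[OF alt_b] by blast

lemma b_shift_CC: assumes "c \<in> C" "d \<in> C" shows "b (shift (1/2) c) (shift (1/2) d) = 0"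
proof -
  have "b (shift (1/2) c) (shift (1/2) d) = b c d - b c (corr (1/2) d) - b (corr (1/2) c) d"
    using b_KK[OF corr_K corr_K] by (simp add: shift_def b_simps)
  also have "\<dots> = b c d - b c d / 2 + b d c / 2" using assms by (simp add: b_corr b_corr')
  also have "\<dots> = 0" using two_nonzero alternating_skew[OF alt_b, of d c] by (simp add: field_simps)
  finally show ?thesis .
qed

text \<open>The shifted copy of \<open>Y \<subseteq> U\<close> together with the new vectors that belong to \<open>D \<subseteq> C\<close>.\<close>

definition gens :: "'b set \<Rightarrow> 'b set \<Rightarrow> 'b set" where
  "gens Y D = shift 1 ` Y \<union> shift (1/2) ` D \<union> k ` D"

lemma ortho_gens:
  assumes "Y \<subseteq> U" "Y' \<subseteq> U" "D \<subseteq> C" "D' \<subseteq> C" "ortho Y Y'" "D \<inter> D' = {}"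
    "\<And>c d. c \<in> D \<Longrightarrow> d \<in> D' \<Longrightarrow> a c d = 0"
    "\<And>c y. c \<in> D \<Longrightarrow> y \<in> Y' \<Longrightarrow> a c y = 0" "\<And>c y. c \<in> D' \<Longrightarrow> y \<in> Y \<Longrightarrow> a c y = 0"
  shows "ortho (gens Y D) (gens Y' D')"
proof -
  have YV: "y \<in> V" "y \<in> U" if "y \<in> Y \<or> y \<in> Y'" for y using that assms(1,2) U_V by auto
  have DV: "d \<in> V" "d \<in> C" if "d \<in> D \<or> d \<in> D'" for d using that assms(3,4) C_V by auto
  have a9: "a y c = 0" if "c \<in> D'" "y \<in> Y" for c y using assms(9)[OF that] alternating_zero_sym[OF alt_a] by blast
  have neq: "d \<in> D \<Longrightarrow> d \<notin> D'" for d using assms(6) by blast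
  show ?thesis
    unfolding ortho_def gens_def
  proof (intro ballI)
    fix u v assume u: "u \<in> shift 1 ` Y \<union> shift (1/2) ` D \<union> k ` D"
      and v: "v \<in> shift 1 ` Y' \<union> shift (1/2) ` D' \<union> k ` D'"
    consider y where "y \<in> Y" "u = shift 1 y" | d where "d \<in> D" "u = shift (1/2) d" | d where "d \<in> D" "u = k d"
      using u by blast
    note U = this
    consider y where "y \<in> Y'" "v = shift 1 y" | d where "d \<in> D'" "v = shift (1/2) d" | d where "d \<in> D'" "v = k d"
      using v by blast
    then show "a u v = 0 \<and> b u v = 0"
    proof cases
      case (1 y)
      show ?thesis using U by cases (use 1 assms(5,8) YV DV in
          \<open>auto simp: a_shift b_shift_UU b_shift_CU a_k b_k ortho_def\<close>)
    next
      case (2 d)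
      show ?thesis using U by cases (use 2 assms(7) a9 neq YV DV in
          \<open>auto simp: a_shift b_shift_UC b_shift_CC a_k b_k\<close>)
    next
      case (3 d)
      show ?thesis using U by cases (use 3 neq YV DV in \<open>auto simp: a_k b_k\<close>)
    qed
  qed
qed

lemma ortho_uminus: "ortho X Y \<Longrightarrow> ortho (X \<union> uminus ` X) (Y \<union> uminus ` Y)"
  unfolding ortho_def by (auto simp: a_simps b_simps)

text \<open>Prolonging a chain beyond its free ends \<open>r\<close> by an edge of \<open>a\<close> to the vector of \<open>C\<close> dual to \<open>r\<close> and then
  an edge of \<open>b\<close> to the vector of \<open>K\<close> dual to that one. A chain of the first kind has two free ends
  and grows from \<open>K_pair n\<close> to \<open>K_pair (n + 2)\<close>; a chain of the second kind grows from \<open>L_pair n\<close> to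
  \<open>L_pair (n + 1)\<close>.\<close>

definition ext_chain :: "('b \<Rightarrow> 'b) \<Rightarrow> 'b list \<times> 'b list \<Rightarrow> 'b list \<times> 'b list" where
  "ext_chain c p = (let q = c (hd (fst p)); r = c (last (snd p));
      es = map (shift 1) (fst p) @ [shift (1/2) r]; fs = map (shift 1) (snd p) @ [k r] in
    if length (fst p) = length (snd p) then (k q # es, (- shift (1/2) q) # fs) else (es, fs))"

lemma length_ext_chain: "length (vecs (ext_chain c p)) = length (vecs p) + 2 * length (ends p)"
  by (simp add: ext_chain_def vecs_def Let_def ends_def)

lemma vecs_ext_chain:
  "set (vecs (ext_chain c p)) \<subseteq> gens (set (vecs p)) (c ` set (ends p)) \<union> uminus ` gens (set (vecs p)) (c ` set (ends p))"
  by (auto simp: ext_chain_def vecs_def Let_def ends_def gens_def)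

lemma span_ext_chain: "gens (set (vecs p)) (c ` set (ends p)) \<subseteq> span (set (vecs (ext_chain c p)))"
proof -
  have "gens (set (vecs p)) (c ` set (ends p)) \<subseteq> set (vecs (ext_chain c p)) \<union> uminus ` set (vecs (ext_chain c p))"
    by (auto simp: ext_chain_def vecs_def Let_def ends_def gens_def image_iff)
  also have "\<dots> \<subseteq> span (set (vecs (ext_chain c p)))" by (auto intro: span_base span_neg)
  finally show ?thesis .
qed

lemma nth_snoc: "i < Suc (length xs) \<Longrightarrow> (map f xs @ [z]) ! i = (if i < length xs then f (xs ! i) else z)"
  by (auto simp: nth_append less_Suc_eq)

lemma ext_L_chain:
  assumes "L_chain p" "set (vecs p) \<subseteq> U" "distinct (vecs p)"
    and c: "\<And>r. r \<in> set (ends p) \<Longrightarrow> c r \<in> C"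
    and dual: "\<And>r v. r \<in> set (ends p) \<Longrightarrow> v \<in> set (vecs p) \<Longrightarrow> a (c r) v = (if v = r then 1 else 0)"
  shows "L_chain (ext_chain c p)"
proof -
  obtain es fs where p: "p = (es, fs)" by (cases p)
  have len: "length fs = Suc (length es)" using assms(1) by (simp add: L_chain_def p)
  define r where "r = last fs"
  have rn: "r = fs ! length es" using len unfolding r_def by (subst last_conv_nth) auto
  have rends: "r \<in> set (ends p)" using len by (simp add: ends_def p r_def)
  note rC = c[OF rends]
  have rV: "c r \<in> V" using rC C_V by blast
  have U: "\<And>i. i < length es \<Longrightarrow> es ! i \<in> U" "\<And>i. i < length fs \<Longrightarrow> fs ! i \<in> U"
    using assms(2) by (auto simp: vecs_def p)
  have V: "\<And>i. i < length es \<Longrightarrow> es ! i \<in> V" "\<And>i. i < length fs \<Longrightarrow> fs ! i \<in> V"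
    using U U_V by auto
  have ne: "es ! i \<noteq> r" if "i < length es" for i
    using that assms(3) len unfolding rn by (force simp: vecs_def p in_set_conv_nth)
  have nf: "fs ! j = r \<longleftrightarrow> j = length es" if "j < length fs" for j
    using that assms(3) len unfolding rn by (simp add: vecs_def p nth_eq_iff_index_eq)
  have de: "a (c r) (es ! i) = 0" if "i < length es" for i
    using dual[OF rends, of "es ! i"] ne[OF that] that by (simp add: vecs_def p)
  have df: "a (c r) (fs ! j) = (if j = length es then 1 else 0)" if "j < length fs" for j
    using dual[OF rends, of "fs ! j"] nf[OF that] that by (simp add: vecs_def p)
  have de': "a (es ! i) (c r) = 0" if "i < length es" for i
    using de[OF that] alternating_zero_sym[OF alt_a] by blast
  have E: "ext_chain c p = (map (shift 1) es @ [shift (1/2) (c r)], map (shift 1) fs @ [k (c r)])"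
    using len by (simp add: ext_chain_def p r_def Let_def)
  have G: "chain_gram a (\<lambda>i j. if i = j then 1 else 0) (es, fs)" "chain_gram b (\<lambda>i j. if j = Suc i then 1 else 0) (es, fs)"
    using assms(1) by (simp_all add: L_chain_def p)
  have 1: "chain_gram a (\<lambda>i j. if i = j then 1 else 0) (ext_chain c p)"
    unfolding chain_gram_def E
    using G(1) V len de df de' rV rC
    by (auto simp: chain_gram_def nth_snoc a_shift a_k a_simps less_Suc_eq)
  have 2: "chain_gram b (\<lambda>i j. if j = Suc i then 1 else 0) (ext_chain c p)"
    unfolding chain_gram_def E
    using G(2) U len rC
    by (auto simp: chain_gram_def nth_snoc b_shift_UU b_shift_UC b_shift_CU b_shift_CC b_k b_simps less_Suc_eq)
  show ?thesis using 1 2 len unfolding L_chain_def E by simp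
qed

lemma nth_Cons_snoc:
  "i < Suc (Suc (length xs)) \<Longrightarrow>
    (y # map f xs @ [z]) ! i = (if i = 0 then y else if i = Suc (length xs) then z else f (xs ! (i - 1)))"
  by (cases i) (auto simp: nth_append less_Suc_eq)

lemma ext_K_chain:
  assumes "K_chain p" "set (vecs p) \<subseteq> U" "distinct (vecs p)"
    and c: "\<And>r. r \<in> set (ends p) \<Longrightarrow> c r \<in> C"
    and dual: "\<And>r v. r \<in> set (ends p) \<Longrightarrow> v \<in> set (vecs p) \<Longrightarrow> a (c r) v = (if v = r then 1 else 0)"
    and iso: "\<And>r s. r \<in> set (ends p) \<Longrightarrow> s \<in> set (ends p) \<Longrightarrow> a (c r) (c s) = 0"
  shows "K_chain (ext_chain c p)"
proof -
  obtain es fs where p: "p = (es, fs)" by (cases p)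
  have len: "length fs = length es" and nonempty: "es \<noteq> []" using assms(1) by (simp_all add: K_chain_def p)
  define m where "m = length es"
  have m: "m > 0" "length es = m" "length fs = m" using nonempty len by (simp_all add: m_def)
  define q where "q = hd es"
  define r where "r = last fs"
  have qn: "q = es ! 0" using nonempty by (simp add: q_def hd_conv_nth)
  have rn: "r = fs ! (m - 1)" using m unfolding r_def by (subst last_conv_nth) auto
  have rends: "r \<in> set (ends p)" and qends: "q \<in> set (ends p)" using len by (simp_all add: ends_def p r_def q_def)
  note rC = c[OF rends] and qC = c[OF qends]
  have rV: "c r \<in> V" "c q \<in> V" using rC qC C_V by auto
  have U: "\<And>i. i < m \<Longrightarrow> es ! i \<in> U" "\<And>i. i < m \<Longrightarrow> fs ! i \<in> U"
    using assms(2) m by (auto simp: vecs_def p)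
  have V: "\<And>i. i < m \<Longrightarrow> es ! i \<in> V" "\<And>i. i < m \<Longrightarrow> fs ! i \<in> V"
    using U U_V by auto
  have disj: "es ! i \<noteq> fs ! j" if "i < m" "j < m" for i j
  proof -
    have "es ! i \<in> set es" "fs ! j \<in> set fs" using that m by auto
    moreover have "set es \<inter> set fs = {}" using assms(3) by (simp add: vecs_def p)
    ultimately show ?thesis by (metis disjoint_iff)
  qed
  have ff: "fs ! j = r \<longleftrightarrow> j = m - 1" if "j < m" for j
    using that assms(3) m unfolding rn by (simp add: vecs_def p nth_eq_iff_index_eq)
  have ee: "es ! i = q \<longleftrightarrow> i = 0" if "i < m" for i
    using that assms(3) m unfolding qn by (simp add: vecs_def p nth_eq_iff_index_eq)
  have re: "a (c r) (es ! i) = 0" if "i < m" for i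
    using dual[OF rends, of "es ! i"] disj[OF that, of "m - 1"] that m by (simp add: vecs_def p rn)
  have rf: "a (c r) (fs ! j) = (if j = m - 1 then 1 else 0)" if "j < m" for j
    using dual[OF rends, of "fs ! j"] ff[OF that] that m by (simp add: vecs_def p)
  have qe: "a (c q) (es ! i) = (if i = 0 then 1 else 0)" if "i < m" for i
    using dual[OF qends, of "es ! i"] ee[OF that] that m by (simp add: vecs_def p)
  have qf: "a (c q) (fs ! j) = 0" if "j < m" for j
    using dual[OF qends, of "fs ! j"] disj[OF m(1) that] that m by (simp add: vecs_def p qn)
  have re': "a (es ! i) (c r) = 0" if "i < m" for i
    using re[OF that] alternating_zero_sym[OF alt_a] by blast
  have qf': "a (fs ! i) (c q) = 0" if "i < m" for i
    using qf[OF that] alternating_zero_sym[OF alt_a] by blast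
  have qe': "a (es ! i) (c q) = (if i = 0 then - 1 else 0)" if "i < m" for i
    using qe[OF that] alternating_skew[OF alt_a, of "es ! i" "c q"] by simp
  have cqr: "c q \<noteq> c r"
  proof
    assume "c q = c r"
    then show False using re[OF m(1)] qe[OF m(1)] by simp
  qed
  have E: "ext_chain c p = (k (c q) # map (shift 1) es @ [shift (1/2) (c r)],
      (- shift (1/2) (c q)) # map (shift 1) fs @ [k (c r)])"
    using len by (simp add: ext_chain_def p r_def q_def Let_def)
  have Ga: "\<And>i j. i < m \<Longrightarrow> j < m \<Longrightarrow> a (es ! i) (es ! j) = 0" "\<And>i j. i < m \<Longrightarrow> j < m \<Longrightarrow> a (fs ! i) (fs ! j) = 0"
    "\<And>i j. i < m \<Longrightarrow> j < m \<Longrightarrow> a (es ! i) (fs ! j) = (if i = Suc j then 1 else 0)"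
    using assms(1) m by (simp_all add: K_chain_def p chain_gram_def)
  have Gb: "\<And>i j. i < m \<Longrightarrow> j < m \<Longrightarrow> b (es ! i) (es ! j) = 0" "\<And>i j. i < m \<Longrightarrow> j < m \<Longrightarrow> b (fs ! i) (fs ! j) = 0"
    "\<And>i j. i < m \<Longrightarrow> j < m \<Longrightarrow> b (es ! i) (fs ! j) = (if i = j then 1 else 0)"
    using assms(1) m by (simp_all add: K_chain_def p chain_gram_def)
  have N: "i - 1 < m" if "i < Suc (Suc m)" "i \<noteq> 0" "i \<noteq> Suc m" for i using that by auto
  have 1: "chain_gram a (\<lambda>i j. if i = Suc j then 1 else 0) (ext_chain c p)"
    unfolding chain_gram_def E fst_conv snd_conv length_Cons length_append length_map m list.size add_0_right add_Suc_right
    by (intro conjI allI impI;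
        simp add: nth_Cons_snoc m a_k a_shift a_simps V rV rC qC iso rends qends Ga re rf qe qf re' qf' qe' N;
        use m in auto)
  have 2: "chain_gram b (\<lambda>i j. if i = j then 1 else 0) (ext_chain c p)"
    unfolding chain_gram_def E fst_conv snd_conv length_Cons length_append length_map m list.size add_0_right add_Suc_right
    by (intro conjI allI impI;
        simp add: nth_Cons_snoc m b_shift_UU b_shift_UC b_shift_CU b_shift_CC b_k b_simps U rC qC Gb cqr cqr[symmetric] N;
        use m in auto)
  show ?thesis using 1 2 len unfolding K_chain_def E by simp
qed

text \<open>A hyperbolic pair \<open>(x, y)\<close> for \<open>a\<close> in \<open>C\<close> gives, up to shifts and a sign, the path
  \<open>k y, y, x, k x\<close>, which is a basis of \<open>K_pair 2\<close>.\<close>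

definition pair_chain :: "'b \<times> 'b \<Rightarrow> 'b list \<times> 'b list" where
  "pair_chain q = ([- k (snd q), shift (1/2) (fst q)], [shift (1/2) (snd q), k (fst q)])"

lemma pair_chain_K:
  assumes "fst q \<in> C" "snd q \<in> C" "a (fst q) (snd q) = 1"
  shows "K_chain (pair_chain q)"
proof -
  have V: "fst q \<in> V" "snd q \<in> V" using assms C_V by auto
  have ne: "fst q \<noteq> snd q" using assms(3) by (auto simp: a_simps)
  show ?thesis
    unfolding K_chain_def chain_gram_def pair_chain_def
    using assms V ne by (auto simp: less_Suc_eq a_simps b_simps a_k a_shift b_k b_shift_CC)
qed

lemma vecs_pair_chain:
  "set (vecs (pair_chain q)) \<subseteq> gens {} {fst q, snd q} \<union> uminus ` gens {} {fst q, snd q}"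
  by (auto simp: pair_chain_def vecs_def gens_def)

lemma span_pair_chain: "gens {} {fst q, snd q} \<subseteq> span (set (vecs (pair_chain q)))"
proof -
  have "gens {} {fst q, snd q} \<subseteq> set (vecs (pair_chain q)) \<union> uminus ` set (vecs (pair_chain q))"
    by (auto simp: pair_chain_def vecs_def gens_def)
  also have "\<dots> \<subseteq> span (set (vecs (pair_chain q)))" by (auto intro: span_base span_neg)
  finally show ?thesis .
qed

end

section \<open>Splitting off the radical of the first form\<close>

context two_forms
begin

lemma distinct_ends:
  assumes "\<forall>p\<in>set ps. K_chain p \<or> L_chain p" "distinct (all_vecs ps)"
  shows "distinct (concat (map ends ps))"
  using assms
proof (induction ps)
  case Nil then show ?case by simp
next
  case (Cons p ps)
  have sub: "set (ends q) \<subseteq> set (vecs q)" if "q \<in> set (p # ps)" for q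
    using chain_ends(1) Cons.prems(1) that by blast
  have d: "distinct (vecs p)" "set (vecs p) \<inter> set (all_vecs ps) = {}" "distinct (all_vecs ps)"
    using Cons.prems(2) by (auto simp: all_vecs_def)
  have "distinct (ends p)"
  proof (cases "length (fst p) = length (snd p)")
    case True
    then have "fst p \<noteq> []" "snd p \<noteq> []" using Cons.prems(1) by (auto simp: K_chain_def L_chain_def)
    then have "hd (fst p) \<in> set (fst p)" "last (snd p) \<in> set (snd p)" by auto
    then show ?thesis using d(1) True by (auto simp: ends_def vecs_def)
  next
    case False then show ?thesis by (simp add: ends_def)
  qed
  moreover have "set (ends p) \<inter> set (concat (map ends ps)) = {}"
  proof -
    have "(\<Union>q\<in>set ps. set (ends q)) \<subseteq> (\<Union>q\<in>set ps. set (vecs q))"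
      by (intro UN_mono subset_refl sub) simp
    then show ?thesis using sub[of p] d(2) by (simp add: set_all_vecs) blast
  qed
  ultimately show ?case using Cons.IH Cons.prems(1) d(3) by simp
qed

lemma sorted_wrt_disjoint:
  assumes "distinct (all_vecs ps)"
  shows "sorted_wrt (\<lambda>p q. set (vecs p) \<inter> set (vecs q) = {}) ps"
  using assms by (induction ps) (auto simp: all_vecs_def)

lemma sorted_wrt_conj: "sorted_wrt P xs \<Longrightarrow> sorted_wrt Q xs \<Longrightarrow> sorted_wrt (\<lambda>x y. P x y \<and> Q x y) xs"
  by (induction xs) auto

lemma ortho_mono: "ortho X Y \<Longrightarrow> X' \<subseteq> X \<Longrightarrow> Y' \<subseteq> Y \<Longrightarrow> ortho X' Y'"
  unfolding ortho_def by blast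

lemma decomposition_Cons:
  assumes "decomposition V' W ps" "V' \<subseteq> V" "K_chain p \<or> L_chain p" "set (vecs p) \<subseteq> V"
    "ortho (set (vecs p)) V'" "V \<subseteq> span (set (vecs p) \<union> V')" "dim V' + length (vecs p) \<le> dim V"
  shows "decomposition V W (p # ps)"
proof -
  note D = assms(1)[unfolded decomposition_def]
  have av: "all_vecs (p # ps) = vecs p @ all_vecs ps" by (simp add: all_vecs_def)
  let ?S = "W \<union> set (all_vecs (p # ps))"
  have "span (W \<union> set (all_vecs ps)) \<subseteq> span ?S" by (rule span_mono) (auto simp: av)
  then have "V' \<subseteq> span ?S" using D by blast
  then have "set (vecs p) \<union> V' \<subseteq> span ?S" by (auto simp: av intro: span_base)
  then have "span (set (vecs p) \<union> V') \<subseteq> span ?S" by (rule span_minimal) simp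
  then have 1: "V \<subseteq> span ?S" using assms(6) by blast
  have "\<forall>q\<in>set ps. ortho_chains p q"
  proof
    fix q assume "q \<in> set ps"
    then have "set (vecs q) \<subseteq> V'" using D by (auto simp: set_all_vecs)
    then show "ortho_chains p q" unfolding ortho_chains_def using ortho_mono[OF assms(5)] by blast
  qed
  moreover have "ortho W (set (vecs p))" using ortho_sym[OF ortho_mono[OF assms(5), of "set (vecs p)" W]] D by blast
  then have "ortho W (set (all_vecs (p # ps)))" using D by (auto simp: av ortho_def)
  ultimately show ?thesis
    unfolding decomposition_def using 1 D assms by (auto simp: av)
qed

text \<open>The inductive step. Here \<open>K\<close> is the radical of \<open>a\<close>, and the decomposition of the smaller space \<open>U\<close> is
  carried over to \<open>V\<close>: all chains are prolonged, and further chains for \<open>K_pair 2\<close> arise from the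
  part of \<open>V1\<close> that is not reached by the free ends.\<close>

lemma decomposition_extend:
  assumes fdV: "fin_dim V"
  defines "K \<equiv> perp a V V"
  assumes Kb: "\<And>x y. x \<in> K \<Longrightarrow> y \<in> K \<Longrightarrow> b x y = 0"
    and Kn: "\<And>x. x \<in> K \<Longrightarrow> (\<And>y. y \<in> V \<Longrightarrow> b x y = 0) \<Longrightarrow> x = 0"
    and V1: "subspace V1" "V1 \<subseteq> V" "K \<inter> V1 = {0}" "\<forall>v\<in>V. \<exists>w\<in>K. \<exists>w'\<in>V1. v = w + w'"
      "dim V = dim K + dim V1"
  defines "U \<equiv> perp b V1 K"
  assumes D: "decomposition U W ps"
  shows "\<exists>W' ps'. decomposition V W' ps'"
proof -
  have V: "subspace V" using fin_dim_subspace[OF fdV] .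
  have K: "subspace K" "K \<subseteq> V" unfolding K_def using perp_subspace[OF alt_a V] perp_subset by auto
  have fdK: "fin_dim K" using fin_dim_subset[OF fdV K] .
  have fdV1: "fin_dim V1" using fin_dim_subset[OF fdV V1(1,2)] .
  have U: "subspace U" "U \<subseteq> V1" unfolding U_def using perp_subspace[OF alt_b V1(1)] perp_subset by auto
  have fdU: "fin_dim U" using fin_dim_subset[OF fdV1 U] .
  have aK: "a x y = 0" if "x \<in> K" "y \<in> V" for x y using that by (auto simp: K_def perp_def)
  have aK': "a y x = 0" if "x \<in> K" "y \<in> V" for x y using aK[OF that] alternating_zero_sym[OF alt_a] by blast
  have bU: "b x y = 0" if "x \<in> U" "y \<in> K" for x y using that by (auto simp: U_def perp_def)
  have bU': "b y x = 0" if "x \<in> U" "y \<in> K" for x y using bU[OF that] alternating_zero_sym[OF alt_b] by blast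
  have nd1: "nondeg a V1"
    unfolding nondeg_def
  proof (intro ballI impI)
    fix x assume x: "x \<in> V1" "\<forall>y\<in>V1. a x y = 0"
    have "a x v = 0" if v: "v \<in> V" for v
    proof -
      obtain w w' where w: "w \<in> K" "w' \<in> V1" "v = w + w'" using bspec[OF V1(4) v] by blast
      then show ?thesis using x aK'[OF w(1), of x] V1(2) by (auto simp: a_simps)
    qed
    then have "x \<in> K" using x(1) V1(2) by (auto simp: K_def perp_def)
    then show "x = 0" using x(1) V1(3) by blast
  qed
  define B where "B = set (all_vecs ps)"
  define R where "R = free_ends ps"
  define U0 where "U0 = span (W \<union> (B - R))"
  note FE = decomposition_free_ends[OF D, folded B_def R_def]
  note DD = decomposition_distinct[OF fdU D, folded B_def]
  have W: "subspace W" "W \<subseteq> U" "nondeg a W" "ortho W B" using D by (auto simp: decomposition_def B_def)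
  have BU: "B \<subseteq> U" using D by (auto simp: decomposition_def B_def)
  have finB: "finite B" by (simp add: B_def)
  have finR: "finite R" using finB FE(1) finite_subset by blast
  have chain: "K_chain p \<or> L_chain p" if "p \<in> set ps" for p using D that by (auto simp: decomposition_def)
  have nd0: "nondeg a U0" unfolding U0_def R_def B_def using decomposition_nondeg_part[OF D] .
  have U0: "subspace U0" "U0 \<subseteq> U" "U0 \<subseteq> V1"
  proof -
    show "subspace U0" unfolding U0_def by simp
    show "U0 \<subseteq> U" unfolding U0_def using W(2) BU U(1) by (intro span_minimal) auto
    then show "U0 \<subseteq> V1" using U(2) by blast
  qed
  have U_sp: "U \<subseteq> span (W \<union> B)" using D by (auto simp: decomposition_def B_def)
  have U_sp0: "U \<subseteq> span (U0 \<union> R)"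
  proof -
    have "W \<union> B \<subseteq> U0 \<union> R" unfolding U0_def by (auto intro: span_base)
    then show ?thesis using U_sp span_mono by blast
  qed
  define V2 where "V2 = perp a V1 U0"
  note PD = perp_decomposition[OF alt_a fdV1 U0(1,3) nd0, folded V2_def]
  have V2: "subspace V2" "V2 \<subseteq> V1" unfolding V2_def using perp_subspace[OF alt_a V1(1)] perp_subset by auto
  have fdV2: "fin_dim V2" using fin_dim_subset[OF fdV1 V2] .
  have RV2: "R \<subseteq> V2"
  proof
    fix r assume r: "r \<in> R"
    have "a r u = 0" if u: "u \<in> U0" for u
      using alternating_span_zero[OF alt_a u[unfolded U0_def], of r] FE(2,3)[OF r] by blast
    then show "r \<in> V2" using r FE(1) BU U by (auto simp: V2_def perp_def)
  qed
  have indR: "independent R" using DD(2) FE(1) by (rule independent_mono)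
  have RR: "a r s = 0" if "r \<in> R" "s \<in> R" for r s using FE(1,2) that by blast
  obtain c hp where SC: "symplectic_completion a V2 R c hp"
    using symplectic_completion_exists[OF alt_a fdV2 PD(3)[OF nd1] finR RV2 indR RR] by blast
  define C where "C = c ` R \<union> fst ` set hp \<union> snd ` set hp"
  have finC: "finite C" by (simp add: C_def finR)
  have S_c: "c r \<in> V2" "a (c r) s = (if r = s then 1 else 0)" "a (c r) (c s) = 0" if "r \<in> R" "s \<in> R" for r s
    using SC that by (auto simp: symplectic_completion_def)
  have S_hp: "fst q \<in> V2" "snd q \<in> V2" "a (fst q) (snd q) = 1" if "q \<in> set hp" for q
    using SC that by (auto simp: symplectic_completion_def)
  have S_hpR: "a u r = 0" "a u (c r) = 0" if "q \<in> set hp" "u \<in> {fst q, snd q}" "r \<in> R" for q u r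
    using SC that unfolding symplectic_completion_def by blast+
  have S_sort: "sorted_wrt (ortho_pairs a) hp" using SC by (simp add: symplectic_completion_def)
  have S_span: "V2 \<subseteq> span (R \<union> C)" using SC by (simp add: symplectic_completion_def C_def Un_assoc)
  have S_dim: "2 * card R + 2 * length hp = dim V2" using SC by (simp add: symplectic_completion_def)
  have CV2: "C \<subseteq> V2" using S_c(1) S_hp(1,2) by (auto simp: C_def)
  have aV2: "a x u = 0" if "x \<in> V2" "u \<in> W \<union> (B - R)" for x u
    using that span_base[of u "W \<union> (B - R)"] by (auto simp: V2_def perp_def U0_def)
  have a_cB: "a (c r) v = (if v = r then 1 else 0)" if "r \<in> R" "v \<in> B" for r v
    using S_c(2)[OF that(1), of v] aV2[OF S_c(1)[OF that(1) that(1)], of v] that by (cases "v \<in> R") auto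
  have a_cW: "a (c r) w = 0" if "r \<in> R" "w \<in> W" for r w using aV2[OF S_c(1)[OF that(1) that(1)]] that by blast
  have a_hp: "a u v = 0" if "q \<in> set hp" "u \<in> {fst q, snd q}" "v \<in> W \<union> B" for q u v
    using that aV2[of u v] S_hp[OF that(1)] S_hpR(1)[OF that(1,2), of v] by (cases "v \<in> R") auto
  have V1_sp: "V1 \<subseteq> span (U \<union> C)"
  proof
    fix v assume "v \<in> V1"
    then obtain u w where uw: "u \<in> U0" "w \<in> V2" "v = u + w" using PD(2) by blast
    have "u \<in> span (U \<union> C)" using uw(1) U0 by (auto intro: span_base)
    moreover have "R \<union> C \<subseteq> U \<union> C" using FE(1) BU by blast
    then have "w \<in> span (U \<union> C)" using uw(2) S_span span_mono by blast
    ultimately show "v \<in> span (U \<union> C)" using uw(3) span_add by simp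
  qed
  have dU0: "dim U \<le> dim U0 + card R"
  proof -
    obtain B0 where B0: "finite B0" "B0 \<subseteq> U0" "independent B0" "span B0 = U0" "card B0 = dim U0"
      using fin_dim_basis[OF fin_dim_subset[OF fdU U0(1,2)]] .
    have "span (U0 \<union> R) \<subseteq> span (B0 \<union> R)"
      using B0(4) span_mono[of B0 "B0 \<union> R"] by (intro span_minimal) (auto intro: span_base)
    then have "dim U \<le> card (B0 \<union> R)" using U_sp0 B0(1) finR by (intro dim_le_card) auto
    also have "\<dots> \<le> card B0 + card R" by (rule card_Un_le)
    finally show ?thesis using B0(5) by simp
  qed
  \<comment> \<open>\<open>dim K\<close> linear conditions cut out \<open>U\<close> in \<open>V1\<close>, and this makes \<open>K\<close> large enough to be dual to \<open>C\<close>\<close>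
  have dV1: "dim V1 \<le> dim U + dim K"
  proof -
    obtain BK where BK: "finite BK" "BK \<subseteq> K" "independent BK" "span BK = K" "card BK = dim K"
      using fin_dim_basis[OF fdK] .
    have "{v\<in>V1. \<forall>i\<in>BK. b v i = 0} = U"
    proof
      show "U \<subseteq> {v\<in>V1. \<forall>i\<in>BK. b v i = 0}" using U(2) bU BK(2) by blast
      show "{v\<in>V1. \<forall>i\<in>BK. b v i = 0} \<subseteq> U"
        using alternating_span_zero[OF alt_b, of _ BK] BK(4) by (auto simp: U_def perp_def)
    qed
    then show ?thesis
      using dim_zeros[OF fdV1 BK(1), of "\<lambda>i v. b v i"] alternating_functional[OF alt_b] BK(5) by simp
  qed
  have dV1': "dim V1 = dim U0 + 2 * card R + 2 * length hp" using PD(1) S_dim by simp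
  have dK: "card R + 2 * length hp \<le> dim K" using dU0 dV1 dV1' by linarith
  have "card C \<le> card (c ` R) + card (fst ` set hp) + card (snd ` set hp)"
    unfolding C_def by (meson add_le_mono1 card_Un_le le_trans)
  also have "\<dots> \<le> card R + length hp + length hp"
    by (intro add_mono card_image_le finR) (metis card_length length_map set_map)+
  finally have cardC: "card C \<le> dim K" using dK by simp
  \<comment> \<open>\<open>b\<close> pairs \<open>K\<close> with \<open>C\<close> without left kernel, because \<open>K\<close> is orthogonal to \<open>K\<close> and to \<open>U\<close>, but no nonzero vector of \<open>K\<close> to all of \<open>V\<close>\<close>
  have K0: "x = 0" if x: "x \<in> K" "\<And>d. d \<in> C \<Longrightarrow> b d x = 0" for x
  proof (rule Kn[OF x(1)])
    fix y assume "y \<in> V"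
    then obtain w w' where w: "w \<in> K" "w' \<in> V1" "y = w + w'" using V1(4) by blast
    have "b x w' = 0"
    proof (rule alternating_span_zero[OF alt_b])
      show "w' \<in> span (U \<union> C)" using w(2) V1_sp by blast
      show "b x s = 0" if "s \<in> U \<union> C" for s
        using that bU'[OF _ x(1)] x(2) alternating_zero_sym[OF alt_b, of s x] by blast
    qed
    then show "b x y = 0" using Kb[OF x(1) w(1)] w(3) by (simp add: b_simps)
  qed
  have "\<exists>k. \<forall>r\<in>C. k r \<in> K \<and> (\<forall>i\<in>C. b i (k r) = (if i = r then 1 else 0))"
    by (rule dual_family[OF fdK finC _ cardC]) (use alternating_functional[OF alt_b] K0 in auto)
  then obtain k where k: "\<forall>r\<in>C. k r \<in> K \<and> (\<forall>i\<in>C. b i (k r) = (if i = r then 1 else 0))" by (rule exE)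
  interpret E: kernel_extension scale a b V K U C k
  proof
    show "finite C" "subspace K" "K \<subseteq> V" "U \<subseteq> V" "C \<subseteq> V"
      using finC K U(2) V1(2) CV2 V2(2) by auto
    show "k d \<in> K" if "d \<in> C" for d using k that by blast
    show "b d (k e) = (if d = e then 1 else 0)" if "d \<in> C" "e \<in> C" for d e using k that by blast
  qed (use aK Kb bU in blast)+
  define W' where "W' = E.shift 1 ` W"
  define ps' where "ps' = map (E.ext_chain c) ps @ map E.pair_chain hp"
  have WU: "W \<subseteq> V" using W(2) U(2) V1(2) by blast
  have vU: "set (vecs p) \<subseteq> B" if "p \<in> set ps" for p using that by (auto simp: B_def set_all_vecs)
  have eR: "set (ends p) \<subseteq> R" if "p \<in> set ps" for p using that by (auto simp: R_def free_ends_def)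
  have ev: "set (ends p) \<subseteq> set (vecs p)" if "p \<in> set ps" for p using chain_ends(1)[OF chain[OF that]] by blast
  have dv: "distinct (vecs p)" if "p \<in> set ps" for p
    using DD(1) that unfolding all_vecs_def by (metis distinct_concat_iff image_eqI set_map)
  have cC: "c ` R \<subseteq> C" and hC: "\<And>q. q \<in> set hp \<Longrightarrow> fst q \<in> C \<and> snd q \<in> C" by (auto simp: C_def)
  have chain': "K_chain q \<or> L_chain q" if q: "q \<in> set ps'" for q
  proof -
    consider p where "p \<in> set ps" "q = E.ext_chain c p" | h where "h \<in> set hp" "q = E.pair_chain h"
      using q unfolding ps'_def set_append set_map by blast
    then show ?thesis
    proof cases
      case (1 p)
      have 2: "set (vecs p) \<subseteq> U" using vU[OF 1(1)] BU by blast
      have 3: "\<And>r. r \<in> set (ends p) \<Longrightarrow> c r \<in> C" using eR[OF 1(1)] cC by blast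
      have 4: "\<And>r v. r \<in> set (ends p) \<Longrightarrow> v \<in> set (vecs p) \<Longrightarrow> a (c r) v = (if v = r then 1 else 0)"
        using a_cB eR[OF 1(1)] vU[OF 1(1)] by blast
      have 5: "\<And>r s. r \<in> set (ends p) \<Longrightarrow> s \<in> set (ends p) \<Longrightarrow> a (c r) (c s) = 0"
        using S_c(3) eR[OF 1(1)] by blast
      show ?thesis using chain[OF 1(1)] E.ext_K_chain[OF _ 2 dv[OF 1(1)] 3 4 5] E.ext_L_chain[OF _ 2 dv[OF 1(1)] 3 4] 1(2)
        by blast
    next
      case (2 h) then show ?thesis using E.pair_chain_K[of h] hC S_hp(3) by blast
    qed
  qed
  define G where "G = (\<lambda>p. E.gens (set (vecs p)) (c ` set (ends p)))"
  define H where "H = (\<lambda>q. E.gens {} {fst q, snd q})"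
  have GG: "ortho (G p) (G q)" if "p \<in> set ps" "q \<in> set ps" "ortho_chains p q" "set (vecs p) \<inter> set (vecs q) = {}" for p q
    unfolding G_def
  proof (rule E.ortho_gens)
    show "set (vecs p) \<subseteq> U" "set (vecs q) \<subseteq> U" using vU that(1,2) BU by blast+
    show "c ` set (ends p) \<subseteq> C" "c ` set (ends q) \<subseteq> C" using eR that(1,2) cC by blast+
    show "ortho (set (vecs p)) (set (vecs q))" using that(3) by (simp add: ortho_chains_def)
    have ne: "r \<noteq> s" if "r \<in> set (ends p)" "s \<in> set (vecs q)" for r s
      using that ev[OF \<open>p \<in> set ps\<close>] \<open>set (vecs p) \<inter> set (vecs q) = {}\<close> by blast
    have ne': "r \<noteq> s" if "r \<in> set (ends q)" "s \<in> set (vecs p)" for r s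
      using that ev[OF \<open>q \<in> set ps\<close>] \<open>set (vecs p) \<inter> set (vecs q) = {}\<close> by blast
    have R: "\<And>r. r \<in> set (ends p) \<Longrightarrow> r \<in> R" "\<And>r. r \<in> set (ends q) \<Longrightarrow> r \<in> R" using eR that(1,2) by blast+
    show "c ` set (ends p) \<inter> c ` set (ends q) = {}"
    proof -
      have "c r \<noteq> c s" if "r \<in> set (ends p)" "s \<in> set (ends q)" for r s
      proof
        assume eq: "c r = c s"
        have "r \<noteq> s" using ne[OF that(1)] that(2) ev[OF \<open>q \<in> set ps\<close>] by blast
        then show False using S_c(2)[OF R(1)[OF that(1)] R(1)[OF that(1)]] S_c(2)[OF R(2)[OF that(2)] R(1)[OF that(1)]] eq
          by simp
      qed
      then show ?thesis by blast
    qed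
    show "a x y = 0" if "x \<in> c ` set (ends p)" "y \<in> c ` set (ends q)" for x y
      using that S_c(3) R by blast
    show "a x y = 0" if xy: "x \<in> c ` set (ends p)" "y \<in> set (vecs q)" for x y
    proof -
      obtain r where r: "r \<in> set (ends p)" "x = c r" using xy(1) by blast
      have "y \<in> B" using xy(2) vU[OF \<open>q \<in> set ps\<close>] by blast
      then show ?thesis using a_cB[OF R(1)[OF r(1)], of y] ne[OF r(1) xy(2)] r(2) by auto
    qed
    show "a x y = 0" if xy: "x \<in> c ` set (ends q)" "y \<in> set (vecs p)" for x y
    proof -
      obtain r where r: "r \<in> set (ends q)" "x = c r" using xy(1) by blast
      have "y \<in> B" using xy(2) vU[OF \<open>p \<in> set ps\<close>] by blast
      then show ?thesis using a_cB[OF R(2)[OF r(1)], of y] ne'[OF r(1) xy(2)] r(2) by auto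
    qed
  qed
  have GH: "ortho (G p) (H q)" if pq: "p \<in> set ps" "q \<in> set hp" for p q
    unfolding G_def H_def
  proof (rule E.ortho_gens)
    show "set (vecs p) \<subseteq> U" using vU pq(1) BU by blast
    show "c ` set (ends p) \<subseteq> C" using eR pq(1) cC by blast
    show "{fst q, snd q} \<subseteq> C" using hC[OF pq(2)] by simp
    have hc: "a u (c r) = 0" if "u \<in> {fst q, snd q}" "r \<in> set (ends p)" for u r
      using S_hpR(2)[OF pq(2) that(1)] that(2) eR[OF pq(1)] by blast
    show "c ` set (ends p) \<inter> {fst q, snd q} = {}"
    proof -
      have "c r \<noteq> u" if u: "u \<in> {fst q, snd q}" and r: "r \<in> set (ends p)" for u r
      proof
        assume "c r = u"
        moreover have "r \<in> R" using r eR[OF pq(1)] by blast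
        ultimately show False using S_c(2)[of r r] S_hpR(1)[OF pq(2) u, of r] by simp
      qed
      then show ?thesis by blast
    qed
    show "a x y = 0" if "x \<in> c ` set (ends p)" "y \<in> {fst q, snd q}" for x y
      using that hc alternating_zero_sym[OF alt_a] by blast
    show "a x y = 0" if "x \<in> {fst q, snd q}" "y \<in> set (vecs p)" for x y
      using a_hp[OF pq(2) that(1)] that(2) vU[OF pq(1)] by blast
  qed (auto simp: ortho_def)
  have HH: "ortho (H q) (H q')" if q: "q \<in> set hp" "q' \<in> set hp" and o: "ortho_pairs a q q'" for q q'
    unfolding H_def
  proof (rule E.ortho_gens)
    show "{fst q, snd q} \<subseteq> C" "{fst q', snd q'} \<subseteq> C" using hC q by auto
    have o': "a u v = 0" if "u \<in> {fst q, snd q}" "v \<in> {fst q', snd q'}" for u v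
      using o that unfolding ortho_pairs_def by blast
    show "{fst q, snd q} \<inter> {fst q', snd q'} = {}"
    proof -
      have 1: "a (fst q) (snd q) = 1" "a (snd q) (fst q) \<noteq> 0"
        using S_hp(3)[OF q(1)] alternating_zero_sym[OF alt_a, of "snd q" "fst q"] by auto
      have "fst q \<notin> {fst q', snd q'}" using o'[of "snd q" "fst q"] 1 by blast
      moreover have "snd q \<notin> {fst q', snd q'}" using o'[of "fst q" "snd q"] 1 by auto
      ultimately show ?thesis by blast
    qed
    show "a x y = 0" if "x \<in> {fst q, snd q}" "y \<in> {fst q', snd q'}" for x y using o'[OF that] .
  qed (auto simp: ortho_def)
  have WG: "ortho W' (G p)" if p: "p \<in> set ps" for p
  proof -
    have "ortho (E.gens W {}) (G p)"
      unfolding G_def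
    proof (rule E.ortho_gens)
      show "set (vecs p) \<subseteq> U" using vU p BU by blast
      show "c ` set (ends p) \<subseteq> C" using eR p cC by blast
      show "ortho W (set (vecs p))" using ortho_mono[OF W(4)] vU[OF p] by blast
      show "a x y = 0" if "x \<in> c ` set (ends p)" "y \<in> W" for x y using that a_cW eR[OF p] by blast
    qed (use W(2) in auto)
    then show ?thesis by (simp add: E.gens_def W'_def)
  qed
  have WH: "ortho W' (H q)" if q: "q \<in> set hp" for q
  proof -
    have "ortho (E.gens W {}) (H q)"
      unfolding H_def
    proof (rule E.ortho_gens)
      show "{fst q, snd q} \<subseteq> C" using hC[OF q] by simp
      show "a x y = 0" if "x \<in> {fst q, snd q}" "y \<in> W" for x y using a_hp[OF q that(1)] that(2) by blast
    qed (use W(2) in \<open>auto simp: ortho_def\<close>)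
    then show ?thesis by (simp add: E.gens_def W'_def)
  qed
  have vG: "set (vecs (E.ext_chain c p)) \<subseteq> G p \<union> uminus ` G p" for p
    unfolding G_def by (rule E.vecs_ext_chain)
  have vH: "set (vecs (E.pair_chain q)) \<subseteq> H q \<union> uminus ` H q" for q
    unfolding H_def by (rule E.vecs_pair_chain)
  have gV: "E.gens Y D' \<subseteq> V" if "Y \<subseteq> V" "D' \<subseteq> C" for Y D'
    using that E.shift_V[OF V] E.k_K K(2) E.C_V unfolding E.gens_def by blast
  have GV: "G p \<subseteq> V" if "p \<in> set ps" for p
    unfolding G_def using gV eR[OF that] cC vU[OF that] BU U(2) V1(2) by (metis image_mono subset_trans)
  have HV: "H q \<subseteq> V" if "q \<in> set hp" for q
    unfolding H_def using gV[of "{}" "{fst q, snd q}"] hC[OF that] by simp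
  have av': "all_vecs ps' = concat (map (vecs \<circ> E.ext_chain c) ps) @ concat (map (vecs \<circ> E.pair_chain) hp)"
    by (simp add: ps'_def all_vecs_def)
  have sv': "set (all_vecs ps') \<subseteq> (\<Union>p\<in>set ps. G p \<union> uminus ` G p) \<union> (\<Union>q\<in>set hp. H q \<union> uminus ` H q)"
  proof
    fix x assume "x \<in> set (all_vecs ps')"
    then obtain q where q: "q \<in> set ps'" "x \<in> set (vecs q)" unfolding set_all_vecs by blast
    have "q \<in> E.ext_chain c ` set ps \<or> q \<in> E.pair_chain ` set hp"
      using q(1) unfolding ps'_def set_append set_map by blast
    then consider p where "p \<in> set ps" "q = E.ext_chain c p" | h where "h \<in> set hp" "q = E.pair_chain h"
      by blast
    then show "x \<in> (\<Union>p\<in>set ps. G p \<union> uminus ` G p) \<union> (\<Union>q\<in>set hp. H q \<union> uminus ` H q)"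
    proof cases
      case (1 p)
      have "x \<in> G p \<union> uminus ` G p" using q(2) vG[of p] unfolding 1(2) by (rule subsetD[rotated])
      then show ?thesis by (rule UnI1[OF UN_I[OF 1(1)]])
    next
      case (2 h)
      have "x \<in> H h \<union> uminus ` H h" using q(2) vH[of h] unfolding 2(2) by (rule subsetD[rotated])
      then show ?thesis by (rule UnI2[OF UN_I[OF 2(1)]])
    qed
  qed
  have sortG: "sorted_wrt ortho_chains (map (E.ext_chain c) ps)"
  proof -
    have "sorted_wrt (\<lambda>p q. ortho_chains p q \<and> set (vecs p) \<inter> set (vecs q) = {}) ps"
      using sorted_wrt_conj[OF _ sorted_wrt_disjoint[OF DD(1)]] D unfolding decomposition_def by blast
    then show ?thesis
      unfolding sorted_wrt_map
    proof (rule sorted_wrt_mono_rel[rotated])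
      fix p q assume pq: "p \<in> set ps" "q \<in> set ps" "ortho_chains p q \<and> set (vecs p) \<inter> set (vecs q) = {}"
      then have "ortho (G p) (G q)" using GG by blast
      then show "ortho_chains (E.ext_chain c p) (E.ext_chain c q)"
        unfolding ortho_chains_def by (rule ortho_mono[OF E.ortho_uminus vG vG])
    qed
  qed
  have sortH: "sorted_wrt ortho_chains (map E.pair_chain hp)"
    unfolding sorted_wrt_map
  proof (rule sorted_wrt_mono_rel[OF _ S_sort])
    fix p q assume pq: "p \<in> set hp" "q \<in> set hp" "ortho_pairs a p q"
    then have "ortho (H p) (H q)" using HH by blast
    then show "ortho_chains (E.pair_chain p) (E.pair_chain q)"
      unfolding ortho_chains_def by (rule ortho_mono[OF E.ortho_uminus vH vH])
  qed
  have "ortho_chains (E.ext_chain c p) (E.pair_chain q)" if "p \<in> set ps" "q \<in> set hp" for p q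
    unfolding ortho_chains_def using GH[OF that] by (rule ortho_mono[OF E.ortho_uminus vG vH])
  then have sort': "sorted_wrt ortho_chains ps'"
    unfolding ps'_def sorted_wrt_append set_map using sortG sortH by blast
  have neg: "uminus ` X \<subseteq> V" if "X \<subseteq> V" for X using that subspace_neg[OF V] by blast
  have subV: "set (all_vecs ps') \<subseteq> V"
  proof -
    have "(\<Union>p\<in>set ps. G p \<union> uminus ` G p) \<subseteq> V" by (intro UN_least Un_least GV neg)
    moreover have "(\<Union>q\<in>set hp. H q \<union> uminus ` H q) \<subseteq> V" by (intro UN_least Un_least HV neg)
    ultimately show ?thesis by (intro subset_trans[OF sv'] Un_least)
  qed
  have orthoW': "ortho W' (set (all_vecs ps'))"
  proof -
    have "ortho W' (\<Union>p\<in>set ps. G p \<union> uminus ` G p)"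
      using WG unfolding ortho_def by (auto simp: a_simps b_simps)
    moreover have "ortho W' (\<Union>q\<in>set hp. H q \<union> uminus ` H q)"
      using WH unfolding ortho_def by (auto simp: a_simps b_simps)
    ultimately have "ortho W' ((\<Union>p\<in>set ps. G p \<union> uminus ` G p) \<union> (\<Union>q\<in>set hp. H q \<union> uminus ` H q))"
      unfolding ortho_def by blast
    then show ?thesis using ortho_mono sv' by blast
  qed
  have subW': "subspace W'"
    unfolding subspace_def
  proof (intro conjI ballI allI)
    have "E.shift 1 0 = 0" using E.shift_linear(2)[of 1 0 0] by simp
    then show "0 \<in> W'" using subspace_0[OF W(1)] unfolding W'_def by force
    fix x y assume "x \<in> W'" "y \<in> W'"
    then show "x + y \<in> W'"
      unfolding W'_def using subspace_add[OF W(1)] by (auto simp: E.shift_linear(1)[symmetric])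
  next
    fix r x assume "x \<in> W'"
    then show "r *s x \<in> W'"
      unfolding W'_def using subspace_scale[OF W(1)] by (auto simp: E.shift_linear(2)[symmetric])
  qed
  have W'V: "W' \<subseteq> V" unfolding W'_def using E.shift_V[OF V] WU by blast
  have ndW': "nondeg a W'"
    unfolding nondeg_def
  proof (intro ballI impI)
    fix x assume x: "x \<in> W'" "\<forall>y\<in>W'. a x y = 0"
    then obtain w where w: "w \<in> W" "x = E.shift 1 w" by (auto simp: W'_def)
    have "a w y = 0" if "y \<in> W" for y
    proof -
      have "a (E.shift 1 w) (E.shift 1 y) = 0" using x(2) w(2) that by (auto simp: W'_def)
      moreover have "w \<in> V" "y \<in> V" using w(1) that WU by auto
      ultimately show ?thesis using E.a_shift by simp
    qed
    then have "w = 0" using nondegD[OF W(3) w(1)] by blast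
    then show "x = 0" using w(2) E.shift_linear(2)[of 1 0 0] by simp
  qed
  have dimW': "dim W' \<le> dim W"
  proof -
    obtain B0 where B0: "finite B0" "B0 \<subseteq> W" "independent B0" "span B0 = W" "card B0 = dim W"
      using fin_dim_basis[OF fin_dim_subset[OF fdU W(1,2)]] .
    let ?T = "{x. E.shift 1 x \<in> span (E.shift 1 ` B0)}"
    have "subspace ?T"
      unfolding subspace_def using E.shift_linear(2)[of 1 0 0]
      by (auto simp: E.shift_linear span_zero span_add span_scale)
    moreover have "B0 \<subseteq> ?T" by (auto intro: span_base)
    ultimately have "W \<subseteq> ?T" using B0(4) span_minimal by blast
    then have "W' \<subseteq> span (E.shift 1 ` B0)" by (auto simp: W'_def)
    then have "dim W' \<le> card (E.shift 1 ` B0)" using B0(1) by (intro dim_le_card) auto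
    also have "\<dots> \<le> card B0" using B0(1) by (rule card_image_le)
    finally show ?thesis using B0(5) by simp
  qed
  have len': "length (all_vecs ps') = card B + 2 * card R + 4 * length hp"
  proof -
    have 1: "length (concat (map (vecs \<circ> E.ext_chain c) ps)) = length (all_vecs ps) + 2 * length (concat (map ends ps))" for ps
      by (induction ps) (auto simp: all_vecs_def E.length_ext_chain)
    have 2: "length (concat (map (vecs \<circ> E.pair_chain) hp)) = 4 * length hp" for hp
      by (induction hp) (auto simp: vecs_def E.pair_chain_def)
    have "distinct (concat (map ends ps))" using distinct_ends DD(1) chain by blast
    then have "length (concat (map ends ps)) = card R"
      by (metis R_def UN_simps(10) distinct_card free_ends_def set_concat set_map)
    moreover have "length (all_vecs ps) = card B" using DD(1) by (simp add: B_def distinct_card)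
    ultimately show ?thesis unfolding av' using 1[of ps] 2[of hp] by simp
  qed
  have dim': "dim W' + length (all_vecs ps') \<le> dim V"
    using len' dimW' DD(3) dU0 dV1' dK V1(5) by linarith
  let ?S = "W' \<union> set (all_vecs ps')"
  \<comment> \<open>the shifts differ from the identity by elements of the span of \<open>k ` C\<close>, which is all of \<open>K\<close>\<close>
  have span': "V \<subseteq> span ?S"
  proof -
    have Gs: "G p \<subseteq> span ?S" if "p \<in> set ps" for p
    proof -
      have "set (vecs (E.ext_chain c p)) \<subseteq> ?S" using that by (auto simp: av')
      then show ?thesis using E.span_ext_chain[of p c] span_mono unfolding G_def by blast
    qed
    have Hs: "H q \<subseteq> span ?S" if "q \<in> set hp" for q
    proof -
      have "set (vecs (E.pair_chain q)) \<subseteq> ?S" using that by (auto simp: av')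
      then show ?thesis using E.span_pair_chain[of q] span_mono unfolding H_def by blast
    qed
    have C1: "k d \<in> span ?S \<and> E.shift (1/2) d \<in> span ?S" if d: "d \<in> C" for d
    proof -
      consider r p where "p \<in> set ps" "r \<in> set (ends p)" "d = c r" | q where "q \<in> set hp" "d \<in> {fst q, snd q}"
        using d unfolding C_def R_def free_ends_def by blast
      then show ?thesis
      proof cases
        case 1 then show ?thesis using Gs[OF 1(1)] unfolding G_def E.gens_def by blast
      next
        case 2 then show ?thesis using Hs[OF 2(1)] unfolding H_def E.gens_def by blast
      qed
    qed
    have corr: "E.corr h x \<in> span ?S" for h x
      unfolding E.corr_def using C1 by (intro span_sum span_scale) auto
    have sh: "x \<in> span ?S" if "E.shift h x \<in> span ?S" for h x
      using span_add[OF that corr[of h x]] by (simp add: E.shift_def)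
    have "C \<subseteq> span ?S" using C1 sh by blast
    moreover have "W \<subseteq> span ?S"
    proof
      fix x assume "x \<in> W"
      then have "E.shift 1 x \<in> ?S" by (simp add: W'_def)
      then show "x \<in> span ?S" using sh span_base by blast
    qed
    moreover have "B \<subseteq> span ?S"
    proof
      fix x assume "x \<in> B"
      then obtain p where "p \<in> set ps" "x \<in> set (vecs p)" by (auto simp: B_def set_all_vecs)
      then have "E.shift 1 x \<in> span ?S" using Gs[of p] unfolding G_def E.gens_def by blast
      then show "x \<in> span ?S" using sh by blast
    qed
    ultimately have "W \<union> B \<subseteq> span ?S" "C \<subseteq> span ?S" by blast+
    moreover from this have "span (W \<union> B) \<subseteq> span ?S" by (intro span_minimal) auto
    ultimately have "span (W \<union> B) \<subseteq> span ?S" "C \<subseteq> span ?S" by blast+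
    then have "U \<union> C \<subseteq> span ?S" using U_sp by blast
    then have "span (U \<union> C) \<subseteq> span ?S" by (rule span_minimal) simp
    then have V1s: "V1 \<subseteq> span ?S" using V1_sp by blast
    have Ks: "x \<in> span ?S" if x: "x \<in> K" for x
    proof -
      have "x - E.corr 1 x = 0"
        using K0[of "x - E.corr 1 x"] E.b_corr[of _ 1 x] x E.corr_K[of 1 x] K(1) by (simp add: subspace_diff b_simps)
      then show ?thesis using corr[of 1 x] by simp
    qed
    show ?thesis
    proof
      fix v assume "v \<in> V"
      then obtain w w' where "w \<in> K" "w' \<in> V1" "v = w + w'" using V1(4) by blast
      then show "v \<in> span ?S" using Ks V1s span_add by blast
    qed
  qed
  have "decomposition V W' ps'"
    unfolding decomposition_def using subW' W'V ndW' chain' sort' subV orthoW' span' dim' by blast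
  then show ?thesis by blast
qed

text \<open>By induction on the dimension. Vectors of the radical \<open>K\<close> of \<open>a\<close> that are not orthogonal for \<open>b\<close> span a
  summand \<open>K_pair 1\<close>, and a vector in both radicals spans a summand \<open>L_pair 1\<close>; the remaining case is
  the inductive step above.\<close>

theorem decomposition_exists:
  assumes "fin_dim V" shows "\<exists>W ps. decomposition V W ps"
  using assms
proof (induction "dim V" arbitrary: V rule: less_induct)
  case less
  note fdV = less.prems
  have V: "subspace V" using fin_dim_subspace[OF fdV] .
  define K where "K = perp a V V"
  have K: "subspace K" "K \<subseteq> V" unfolding K_def using perp_subspace[OF alt_a V] perp_subset by auto
  have aK: "a x y = 0" "a y x = 0" if "x \<in> K" "y \<in> V" for x y
    using that alternating_zero_sym[OF alt_a] by (auto simp: K_def perp_def)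
  consider (triv) "K = {0}" | (hyp) x y where "x \<in> K" "y \<in> K" "b x y \<noteq> 0"
    | (common) x where "x \<in> K" "x \<noteq> 0" "\<And>y. y \<in> V \<Longrightarrow> b x y = 0"
    | (main) "K \<noteq> {0}" "\<And>x y. x \<in> K \<Longrightarrow> y \<in> K \<Longrightarrow> b x y = 0" "\<And>x. x \<in> K \<Longrightarrow> (\<And>y. y \<in> V \<Longrightarrow> b x y = 0) \<Longrightarrow> x = 0"
    by blast
  then show ?case
  proof cases
    case triv
    have "nondeg a V" using triv unfolding nondeg_def K_def perp_def by blast
    then have "decomposition V V []"
      using V by (auto simp: decomposition_def all_vecs_def ortho_def span_base)
    then show ?thesis by blast
  next
    case hyp
    define z where "z = (1 / b x y) *s y"
    have z: "z \<in> K" "b x z = 1" using hyp K by (simp_all add: z_def subspace_scale b_simps)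
    have xz: "x \<in> V" "z \<in> V" using hyp z K by auto
    define V' where "V' = perp b V (span {x, z})"
    note HS = hyperbolic_split[OF alt_b fdV xz z(2), folded V'_def]
    obtain W ps where D: "decomposition V' W ps" using less.hyps[OF _ HS(1)] HS(2) by auto
    have "decomposition V W (([x], [z]) # ps)"
    proof (rule decomposition_Cons[OF D HS(3)])
      show "K_chain ([x], [z]) \<or> L_chain ([x], [z])"
        using z(2) aK hyp(1) xz by (simp add: K_chain_def chain_gram_def a_simps b_simps)
      show "ortho (set (vecs ([x], [z]))) V'"
        using aK hyp(1) z(1) HS(3) HS(5) alternating_zero_sym[OF alt_b] by (auto simp: ortho_def vecs_def)
    qed (use xz HS in \<open>auto simp: vecs_def\<close>)
    then show ?thesis by blast
  next
    case common
    have xV: "x \<in> V" using common K by blast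
    have sx: "subspace (span {x})" "span {x} \<subseteq> V" using xV V by (simp_all add: span_minimal)
    obtain V' where V': "subspace V'" "V' \<subseteq> V" "span {x} \<inter> V' = {0}"
      "\<forall>v\<in>V. \<exists>w\<in>span {x}. \<exists>w'\<in>V'. v = w + w'" "dim V = dim (span {x}) + dim V'"
      using exists_complement[OF fdV sx] .
    have "independent {x}" using common(2) by simp
    then have dx: "dim (span {x}) = 1" using dim_span_eq_card_independent[of "{x}"] by simp
    obtain W ps where D: "decomposition V' W ps"
      using less.hyps[OF _ fin_dim_subset[OF fdV V'(1,2)]] V'(5) dx by auto
    have "decomposition V W (([], [x]) # ps)"
    proof (rule decomposition_Cons[OF D V'(2)])
      show "K_chain ([], [x]) \<or> L_chain ([], [x])" by (simp add: L_chain_def chain_gram_def a_simps b_simps)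
      show "ortho (set (vecs ([], [x]))) V'"
        using aK common V'(2) by (auto simp: ortho_def vecs_def)
      show "V \<subseteq> span (set (vecs ([], [x])) \<union> V')"
      proof
        fix v assume "v \<in> V"
        then obtain w w' where w: "w \<in> span {x}" "w' \<in> V'" "v = w + w'" using V'(4) by blast
        have "w \<in> span ({x} \<union> V')" using w(1) span_mono[of "{x}" "{x} \<union> V'"] by blast
        moreover have "w' \<in> span ({x} \<union> V')" using w(2) by (intro span_base) simp
        ultimately show "v \<in> span (set (vecs ([], [x])) \<union> V')" using w(3) span_add by (simp add: vecs_def)
      qed
    qed (use xV V'(5) dx in \<open>auto simp: vecs_def\<close>)
    then show ?thesis by blast
  next
    case main
    obtain V1 where V1: "subspace V1" "V1 \<subseteq> V" "K \<inter> V1 = {0}"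
      "\<forall>v\<in>V. \<exists>w\<in>K. \<exists>w'\<in>V1. v = w + w'" "dim V = dim K + dim V1"
      using exists_complement[OF fdV K] .
    define U where "U = perp b V1 K"
    have fdV1: "fin_dim V1" using fin_dim_subset[OF fdV V1(1,2)] .
    have U: "subspace U" "U \<subseteq> V1" unfolding U_def using perp_subspace[OF alt_b V1(1)] perp_subset by auto
    have "dim K \<noteq> 0" using dim_eq_0_iff[OF fin_dim_subset[OF fdV K]] main(1) by simp
    then have "dim U < dim V" using dim_le_of_subset[OF fdV1 U(2,1)] V1(5) by linarith
    then obtain W ps where D: "decomposition U W ps" using less.hyps fin_dim_subset[OF fdV1 U] by blast
    show ?thesis
      using decomposition_extend[OF fdV, folded K_def, OF main(2,3) V1, folded U_def, OF _ _ _ _ D] by blast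
  qed
qed

end

section \<open>Canonical bases\<close>

text \<open>The Gram matrix of a list of vectors.\<close>

definition gram :: "('b \<Rightarrow> 'b \<Rightarrow> 'a) \<Rightarrow> 'b list \<Rightarrow> 'a mat" where
  "gram f xs = mat (length xs) (length xs) (\<lambda>(i, j). f (xs ! i) (xs ! j))"

lemma gram_carrier [simp]: "gram f xs \<in> carrier_mat (length xs) (length xs)"
  by (simp add: gram_def)

lemma gram_append:
  assumes "\<And>x y. x \<in> set xs \<Longrightarrow> y \<in> set ys \<Longrightarrow> f x y = 0 \<and> f y x = 0"
  shows "gram f (xs @ ys) =
    four_block_mat (gram f xs) (0\<^sub>m (length xs) (length ys)) (0\<^sub>m (length ys) (length xs)) (gram f ys)"
  by (rule eq_matI) (auto simp: gram_def nth_append assms)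

lemma gram_concat:
  assumes "sorted_wrt (\<lambda>xs ys. \<forall>x\<in>set xs. \<forall>y\<in>set ys. f x y = 0 \<and> f y x = 0) xss"
  shows "gram f (concat xss) = diag_block_mat (map (gram f) xss)"
  using assms
proof (induction xss)
  case Nil then show ?case by (auto simp: gram_def intro!: eq_matI)
next
  case (Cons xs xss)
  have IH: "diag_block_mat (map (gram f) xss) = gram f (concat xss)" using Cons by simp
  have "dim_row (diag_block_mat (map (gram f) xss)) = length (concat xss)"
    "dim_col (diag_block_mat (map (gram f) xss)) = length (concat xss)"
    unfolding IH by (simp_all add: gram_def)
  moreover have "gram f (xs @ concat xss) = four_block_mat (gram f xs) (0\<^sub>m (length xs) (length (concat xss)))
      (0\<^sub>m (length (concat xss)) (length xs)) (gram f (concat xss))"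
    using Cons.prems by (intro gram_append) auto
  ultimately show ?case using Cons by (simp add: Let_def gram_def[of f xs])
qed

lemma lower_jordan_block_mat:
  "lower_jordan_block n c = mat n n (\<lambda>(i, j). if i = j then c else if i = Suc j then 1 else 0)"
  by (rule eq_matI) (auto simp: lower_jordan_block_def jordan_block_def)

lemma chain_mats:
  "mat n n (\<lambda>(i, j). if i = Suc j then 1 else 0) = lower_jordan_block n 0"
  "mat n n (\<lambda>(i, j). if i = j then 1 else 0) = 1\<^sub>m n"
  "mat n n (\<lambda>(i, j). if i = j then c else if i = Suc j then 1 else 0) = lower_jordan_block n c"
  "mat m (Suc m) (\<lambda>(i, j). if i = j then 1 else 0) = L_mat (Suc m)"
  "mat m (Suc m) (\<lambda>(i, j). if j = Suc i then 1 else 0) = R_mat (Suc m)"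
  by (rule eq_matI; auto simp: lower_jordan_block_mat L_mat_def R_mat_def)+

context lin_space
begin

lemma nth_lincomb_0:
  assumes "distinct xs" "independent (set xs)" "(\<Sum>j<length xs. v j *s xs ! j) = 0" "i < length xs"
  shows "v i = 0"
proof -
  define u where "u = (\<lambda>y. v (inv_into {..<length xs} ((!) xs) y))"
  have bij: "bij_betw ((!) xs) {..<length xs} (set xs)" using bij_betw_nth[OF assms(1) refl refl] .
  have u: "u (xs ! j) = v j" if "j < length xs" for j
    using bij that unfolding u_def bij_betw_def by (simp add: inv_into_f_f)
  have "(\<Sum>y\<in>set xs. u y *s y) = (\<Sum>j<length xs. u (xs ! j) *s xs ! j)"
    using sum.reindex_bij_betw[OF bij, of "\<lambda>y. u y *s y"] by simp
  also have "\<dots> = 0" using u assms(3) by simp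
  finally have "u (xs ! i) = 0" using independentD[OF assms(2) finite_set subset_refl] assms(4) by (simp add: nth_mem)
  then show ?thesis using u[OF assms(4)] by simp
qed

lemma span_nth_lincomb:
  assumes "x \<in> span (set xs)"
  shows "\<exists>v. x = (\<Sum>j<length xs. v j *s xs ! j)"
  using assms
proof (induction xs arbitrary: x)
  case Nil then show ?case by simp
next
  case (Cons y xs)
  obtain c where "x - c *s y \<in> span (set xs)" using Cons.prems span_breakdown_eq[of x y "set xs"] by auto
  then obtain v where v: "x - c *s y = (\<Sum>j<length xs. v j *s xs ! j)" using Cons.IH by blast
  have "x = c *s y + (\<Sum>j<length xs. v j *s xs ! j)" using v by (simp add: algebra_simps)
  also have "\<dots> = (\<Sum>j<length (y # xs). (case j of 0 \<Rightarrow> c | Suc i \<Rightarrow> v i) *s (y # xs) ! j)"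
    by (simp add: sum.lessThan_Suc_shift del: sum.lessThan_Suc)
  finally show ?case by blast
qed

end

context two_forms
begin

lemma gram_chain:
  assumes "alternating f" "chain_gram f M p"
  shows "gram f (vecs p) = skew_block (mat (length (fst p)) (length (snd p)) (\<lambda>(i, j). M i j))"
proof (rule eq_matI)
  let ?R = "skew_block (mat (length (fst p)) (length (snd p)) (\<lambda>(i, j). M i j))"
  have d: "dim_row ?R = length (vecs p)" "dim_col ?R = length (vecs p)" by (auto simp: skew_block_def vecs_def)
  then show "dim_row (gram f (vecs p)) = dim_row ?R" "dim_col (gram f (vecs p)) = dim_col ?R" by (auto simp: gram_def)
  fix i j assume ij: "i < dim_row ?R" "j < dim_col ?R"
  then have ij': "i < length (fst p) + length (snd p)" "j < length (fst p) + length (snd p)"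
    using d by (auto simp: vecs_def)
  have sk: "f (snd p ! i) (fst p ! j) = - M j i" if "i < length (snd p)" "j < length (fst p)" for i j
    using alternating_skew[OF assms(1), of "snd p ! i" "fst p ! j"] assms(2) that by (simp add: chain_gram_def)
  show "gram f (vecs p) $$ (i, j) = ?R $$ (i, j)"
    using ij ij' assms(2) sk by (auto simp: gram_def skew_block_def vecs_def nth_append chain_gram_def)
qed

text \<open>The pair of Gram matrices of a chain.\<close>

definition block_pair :: "'b list \<times> 'b list \<Rightarrow> 'a mat \<times> 'a mat" where
  "block_pair p = (gram a (vecs p), gram b (vecs p))"

lemma K_chain_block:
  assumes "K_chain p" shows "block_pair p = K_pair (length (fst p))"
proof -
  have K: "length (fst p) = length (snd p)" "chain_gram a (\<lambda>i j. if i = Suc j then 1 else 0) p"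
    "chain_gram b (\<lambda>i j. if i = j then 1 else 0) p"
    using assms by (simp_all add: K_chain_def)
  show ?thesis
    using gram_chain[OF alt_a K(2)] gram_chain[OF alt_b K(3)] K(1) by (simp add: block_pair_def K_pair_def chain_mats)
qed

lemma L_chain_block:
  assumes "L_chain p" shows "block_pair p = L_pair (length (snd p))"
proof -
  have L: "length (snd p) = Suc (length (fst p))" "chain_gram a (\<lambda>i j. if i = j then 1 else 0) p"
    "chain_gram b (\<lambda>i j. if j = Suc i then 1 else 0) p"
    using assms by (simp_all add: L_chain_def)
  show ?thesis
    using gram_chain[OF alt_a L(2)] gram_chain[OF alt_b L(3)] L(1) by (simp add: block_pair_def L_pair_def chain_mats)
qed

lemma J_chain_block:
  assumes "length (fst p) = length (snd p)" "chain_gram a (\<lambda>i j. if i = j then 1 else 0) p"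
    "chain_gram b (\<lambda>i j. if i = j then l else if i = Suc j then 1 else 0) p"
  shows "block_pair p = J_pair (length (fst p)) l"
  using gram_chain[OF alt_a assms(2)] gram_chain[OF alt_b assms(3)] assms(1)
  by (simp add: block_pair_def J_pair_def chain_mats)

text \<open>A basis of \<open>V\<close> cut into mutually orthogonal pieces whose Gram matrices are canonical pairs. As before,
  independence is expressed by the number of vectors.\<close>

definition canonical_basis :: "'b set \<Rightarrow> ('b list \<times> 'b list) list \<Rightarrow> bool" where
  "canonical_basis V ps \<longleftrightarrow> (\<forall>p\<in>set ps. block_pair p \<in> canonical_pairs) \<and> sorted_wrt ortho_chains ps \<and>
    set (all_vecs ps) \<subseteq> V \<and> V \<subseteq> span (set (all_vecs ps)) \<and> length (all_vecs ps) \<le> dim V"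

lemma canonical_basis_append:
  assumes "W \<subseteq> V" "canonical_basis W qs" "\<forall>p\<in>set ps. block_pair p \<in> canonical_pairs"
    "sorted_wrt ortho_chains ps" "set (all_vecs ps) \<subseteq> V" "ortho W (set (all_vecs ps))"
    "V \<subseteq> span (W \<union> set (all_vecs ps))" "dim W + length (all_vecs ps) \<le> dim V"
  shows "canonical_basis V (qs @ ps)"
proof -
  note E = assms(2)[unfolded canonical_basis_def]
  have av: "all_vecs (qs @ ps) = all_vecs qs @ all_vecs ps" by (simp add: all_vecs_def)
  have "ortho_chains q p" if "q \<in> set qs" "p \<in> set ps" for p q
    unfolding ortho_chains_def
  proof (rule ortho_mono[OF assms(6)])
    show "set (vecs q) \<subseteq> W" using E that(1) unfolding set_all_vecs by blast
    show "set (vecs p) \<subseteq> set (all_vecs ps)" using that(2) unfolding set_all_vecs by blast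
  qed
  then have "sorted_wrt ortho_chains (qs @ ps)" using E assms(4) unfolding sorted_wrt_append by blast
  moreover have "V \<subseteq> span (set (all_vecs (qs @ ps)))"
  proof -
    let ?S = "set (all_vecs qs) \<union> set (all_vecs ps)"
    have "W \<subseteq> span ?S" using E span_mono[of "set (all_vecs qs)" ?S] by blast
    then have "W \<union> set (all_vecs ps) \<subseteq> span ?S" by (auto intro: span_base)
    then have "span (W \<union> set (all_vecs ps)) \<subseteq> span ?S" by (intro span_minimal) auto
    then show ?thesis using assms(7) unfolding av set_append by blast
  qed
  moreover have "set (all_vecs (qs @ ps)) \<subseteq> V" using E assms(1,5) unfolding av set_append by blast
  moreover have "length (all_vecs (qs @ ps)) \<le> dim V" using E assms(8) by (simp add: av)
  moreover have "\<forall>p\<in>set (qs @ ps). block_pair p \<in> canonical_pairs" using E assms(3) unfolding set_append by blast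
  ultimately show ?thesis unfolding canonical_basis_def by blast
qed

lemma chain_canonical:
  assumes "K_chain p \<or> L_chain p" shows "block_pair p \<in> canonical_pairs"
  using assms
proof
  assume K: "K_chain p"
  then have "1 \<le> length (fst p)" by (cases "fst p") (auto simp: K_chain_def)
  then show ?thesis using K_chain_block[OF K] unfolding canonical_pairs_def by blast
next
  assume L: "L_chain p"
  then have "1 \<le> length (snd p)" by (auto simp: L_chain_def)
  then show ?thesis using L_chain_block[OF L] unfolding canonical_pairs_def by blast
qed

end

locale two_forms_closed = two_forms scale a b
  for scale :: "'a :: alg_closed_field \<Rightarrow> 'b :: ab_group_add \<Rightarrow> 'b" (infixr \<open>*s\<close> 75) and a b :: "'b \<Rightarrow> 'b \<Rightarrow> 'a"
begin

text \<open>In coordinates, the forms \<open>a\<close> and \<open>b\<close> have matrices \<open>A\<close> and \<open>M\<close> with \<open>A\<close> invertible, and \<open>l\<close> is an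
  eigenvalue of \<open>A\<inverse> M\<close>.\<close>

lemma pencil_eigenvalue:
  assumes "fin_dim V" "V \<noteq> {0}" "nondeg a V"
  obtains l x where "x \<in> V" "x \<noteq> 0" "\<And>y. y \<in> V \<Longrightarrow> b x y = l * a x y"
proof -
  obtain B where B: "finite B" "B \<subseteq> V" "independent B" "span B = V" "card B = dim V"
    using fin_dim_basis[OF assms(1)] .
  obtain xs where xs: "set xs = B" "distinct xs" using finite_distinct_list[OF B(1)] by blast
  define n where "n = length xs"
  have xsV: "\<And>i. i < n \<Longrightarrow> xs ! i \<in> V" using xs B(2) nth_mem n_def by blast
  have "n > 0"
  proof (rule ccontr)
    assume "\<not> n > 0" then have "B = {}" using xs n_def by simp
    then show False using B(4) assms(2) by simp
  qed
  define X where "X = (\<lambda>v. \<Sum>j<n. v $ j *s xs ! j)"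
  have XV: "X v \<in> V" for v unfolding X_def using xsV fin_dim_subspace[OF assms(1)] by (intro subspace_sum subspace_scale) auto
  have X0: "X v \<noteq> 0" if "v \<in> carrier_vec n" "v \<noteq> 0\<^sub>v n" for v
  proof
    assume "X v = 0"
    then have "v $ i = 0" if "i < n" for i
      using nth_lincomb_0[OF xs(2), of "($) v" i] B(3) xs(1) that unfolding X_def n_def by simp
    then show False using that by (auto intro: eq_vecI)
  qed
  define A where "A = gram a xs"
  define M where "M = gram b xs"
  have A: "A \<in> carrier_mat n n" and M: "M \<in> carrier_mat n n" by (simp_all add: A_def M_def n_def)
  have Av: "(A *\<^sub>v v) $ i = a (xs ! i) (X v)" if "i < n" "v \<in> carrier_vec n" for i v
    using that by (simp add: A_def gram_def X_def a_simps n_def scalar_prod_def atLeast0LessThan mult.commute)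
  have Mv: "(M *\<^sub>v v) $ i = b (xs ! i) (X v)" if "i < n" "v \<in> carrier_vec n" for i v
    using that by (simp add: M_def gram_def X_def b_simps n_def scalar_prod_def atLeast0LessThan mult.commute)
  have spanV: "y \<in> span (set xs)" if "y \<in> V" for y using that B(4) xs(1) by simp
  have "det A \<noteq> 0"
  proof
    assume "det A = 0"
    then obtain v where v: "v \<in> carrier_vec n" "v \<noteq> 0\<^sub>v n" "A *\<^sub>v v = 0\<^sub>v n"
      using det_0_iff_vec_prod_zero_field[OF A] by blast
    have "a (X v) y = 0" if "y \<in> V" for y
    proof (rule alternating_span_zero[OF alt_a spanV[OF that]])
      fix s assume "s \<in> set xs"
      then obtain i where "i < n" "s = xs ! i" by (auto simp: in_set_conv_nth n_def)
      then show "a (X v) s = 0" using Av[of i v] v alternating_zero_sym[OF alt_a, of s "X v"] by simp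
    qed
    then show False using nondegD[OF assms(3) XV] X0[OF v(1,2)] by blast
  qed
  then obtain A' where A': "A' \<in> carrier_mat n n" "A' * A = 1\<^sub>m n" "A * A' = 1\<^sub>m n"
    using det_non_zero_imp_unit[OF A, of "()"] by (auto simp: Units_def ring_mat_def)
  define T where "T = A' * M"
  have T: "T \<in> carrier_mat n n" using A' M by (simp add: T_def)
  obtain l where "poly (char_poly T) l = 0"
    using alg_closed_imp_poly_has_root[of "char_poly T"] degree_monic_char_poly[OF T] \<open>n > 0\<close> by auto
  then have "eigenvalue T l" using eigenvalue_root_char_poly[OF T] by simp
  then obtain v where "eigenvector T v l" by (auto simp: eigenvalue_def)
  then have v: "v \<in> carrier_vec n" "v \<noteq> 0\<^sub>v n" "T *\<^sub>v v = l \<cdot>\<^sub>v v" using T by (auto simp: eigenvector_def)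
  have "M *\<^sub>v v = (A * A') *\<^sub>v (M *\<^sub>v v)" using A' M v by simp
  also have "\<dots> = A *\<^sub>v (T *\<^sub>v v)"
    unfolding T_def using A A'(1) M v(1) by (simp add: assoc_mult_mat_vec[of _ n n _ n])
  also have "\<dots> = l \<cdot>\<^sub>v (A *\<^sub>v v)" using A v by (simp add: mult_mat_vec)
  finally have eq: "M *\<^sub>v v = l \<cdot>\<^sub>v (A *\<^sub>v v)" .
  have eqi: "b (xs ! i) (X v) = l * a (xs ! i) (X v)" if "i < n" for i
    using arg_cong[OF eq, of "\<lambda>w. w $ i"] Av[OF that v(1)] Mv[OF that v(1)] that A by simp
  have "b (X v) y = l * a (X v) y" if "y \<in> V" for y
  proof -
    obtain w where w: "y = (\<Sum>j<length xs. w j *s xs ! j)" using span_nth_lincomb[OF spanV[OF \<open>y \<in> V\<close>]] by blast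
    have "b (X v) (xs ! j) = l * a (X v) (xs ! j)" if "j < n" for j
      using eqi[OF that] alternating_skew[OF alt_a, of "X v" "xs ! j"] alternating_skew[OF alt_b, of "X v" "xs ! j"] by simp
    then show ?thesis unfolding w by (simp add: a_simps b_simps sum_distrib_left n_def mult.left_commute)
  qed
  then show ?thesis using that[OF XV X0[OF v(1,2)]] by blast
qed

text \<open>If \<open>a\<close> is nondegenerate and \<open>l\<close> is an eigenvalue as above, the pair of forms \<open>(b - l a, a)\<close> is
  decomposed into chains and a rest \<open>W\<close>. The rest is smaller than \<open>V\<close>, since \<open>b - l a\<close> is degenerate
  on \<open>V\<close>, and \<open>a\<close> is nondegenerate on it, so that induction applies.\<close>

lemma nondeg_canonical_basis:
  assumes "fin_dim V" "nondeg a V"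
  shows "\<exists>ps. canonical_basis V ps"
  using assms
proof (induction "dim V" arbitrary: V rule: less_induct)
  case less
  note fdV = less.prems(1) and nd = less.prems(2)
  show ?case
  proof (cases "V = {0}")
    case True
    then have "canonical_basis V []" by (simp add: canonical_basis_def all_vecs_def)
    then show ?thesis by blast
  next
    case False
    obtain l x where x: "x \<in> V" "x \<noteq> 0" "\<And>y. y \<in> V \<Longrightarrow> b x y = l * a x y"
      using pencil_eigenvalue[OF fdV False nd] by blast
    define f where "f = (\<lambda>x y. b x y - l * a x y)"
    have altf: "alternating f"
      unfolding alternating_def functional_def f_def by (auto simp: a_simps b_simps algebra_simps)
    interpret F: two_forms scale f a
      by (unfold_locales; rule altf alt_a two_nonzero)
    obtain W ps where D: "F.decomposition V W ps" using F.decomposition_exists[OF fdV] by blast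
    note D' = D[unfolded F.decomposition_def]
    have W: "subspace W" "W \<subseteq> V" using D' by auto
    have oF: "ortho X Y" if "F.ortho X Y" for X Y
      using that unfolding ortho_def F.ortho_def by (auto simp: f_def)
    have oW: "F.ortho W (set (all_vecs ps))" using D' by blast
    have zero: "z = 0" if z: "z \<in> V" "\<And>u. u \<in> W \<union> set (all_vecs ps) \<Longrightarrow> a z u = 0" for z
    proof (rule nondegD[OF nd z(1)])
      fix y assume "y \<in> V"
      then have "y \<in> span (W \<union> set (all_vecs ps))" using D' by blast
      then show "a z y = 0" by (rule alternating_span_zero[OF alt_a]) (rule z(2))
    qed
    \<comment> \<open>a chain of the second kind begins with a vector orthogonal to all of \<open>V\<close> for the second form, which is \<open>a\<close>\<close>
    have Kch: "F.K_chain p" if p: "p \<in> set ps" for p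
    proof (rule ccontr)
      assume "\<not> F.K_chain p"
      then have L: "F.L_chain p" using D' p by blast
      have len: "length (snd p) = Suc (length (fst p))" using L by (simp add: F.L_chain_def)
      define z where "z = snd p ! 0"
      have "z \<in> set (snd p)" unfolding z_def using len by (intro nth_mem) simp
      then have zp: "z \<in> set (vecs p)" by (simp add: vecs_def)
      then have zall: "z \<in> set (all_vecs ps)" using p unfolding set_all_vecs by blast
      have "z = 0"
      proof (rule zero)
        show "z \<in> V" using zall D' by blast
        fix u assume u: "u \<in> W \<union> set (all_vecs ps)"
        show "a z u = 0"
        proof (cases "u \<in> W")
          case True
          then show ?thesis using F.ortho_sym[OF oW] zall unfolding F.ortho_def by blast
        next
          case False
          then obtain q where q: "q \<in> set ps" "u \<in> set (vecs q)" using u unfolding set_all_vecs by blast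
          show ?thesis
          proof (cases "q = p")
            case True
            have G: "chain_gram a (\<lambda>i j. if j = Suc i then 1 else 0) p" using L by (simp add: F.L_chain_def)
            have "a u z = 0"
              using q(2) G len unfolding True z_def vecs_def chain_gram_def by (auto simp: in_set_conv_nth)
            then show ?thesis using alternating_zero_sym[OF alt_a] by blast
          next
            case False
            then show ?thesis using F.decomposition_ortho[OF D p q(1)] zp q(2) unfolding F.ortho_def by blast
          qed
        qed
      qed
      then have "dependent (set (all_vecs ps))" using zall dependent_zero by blast
      then show False using F.decomposition_distinct(2)[OF fdV D] by blast
    qed
    have ndW: "nondeg a W"
      unfolding nondeg_def
    proof (intro ballI impI)
      fix w assume w: "w \<in> W" "\<forall>y\<in>W. a w y = 0"
      show "w = 0" by (rule zero) (use w W(2) oW in \<open>auto simp: F.ortho_def\<close>)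
    qed
    have "W \<noteq> V"
    proof
      assume "W = V"
      then have "nondeg f V" using D' by blast
      then show False using nondegD[of f V x] x by (simp add: f_def)
    qed
    then have "dim W < dim V" using subspace_eq_of_dim[OF fdV W(2,1)] by (meson leI)
    then obtain qs where qs: "canonical_basis W qs" using less.hyps[OF _ fin_dim_subset[OF fdV W] ndW] by blast
    have "canonical_basis V (qs @ ps)"
    proof (rule canonical_basis_append[OF W(2) qs])
      show "\<forall>p\<in>set ps. block_pair p \<in> canonical_pairs"
      proof
        fix p assume "p \<in> set ps"
        note K = Kch[OF this, unfolded F.K_chain_def]
        \<comment> \<open>\<open>b = f + l a\<close>, so a basis of \<open>K_pair n\<close> for \<open>(f, a)\<close> is one of \<open>J_pair n l\<close> for \<open>(a, b)\<close>\<close>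
        have "chain_gram b (\<lambda>i j. if i = j then l else if i = Suc j then 1 else 0) p"
          using K unfolding chain_gram_def f_def by (auto simp: algebra_simps split: if_splits)
        then have "block_pair p = J_pair (length (fst p)) l" using J_chain_block K by blast
        moreover have "1 \<le> length (fst p)" using K by (cases "fst p") auto
        ultimately show "block_pair p \<in> canonical_pairs" unfolding canonical_pairs_def by blast
      qed
      show "sorted_wrt ortho_chains ps"
        by (rule sorted_wrt_mono_rel[of _ F.ortho_chains]) (use D' oF in \<open>auto simp: ortho_chains_def F.ortho_chains_def\<close>)
    qed (use D' oF in blast)+
    then show ?thesis by blast
  qed
qed

end

section \<open>Existence of the canonical form\<close>

lemma sum_fun_apply: "(\<Sum>i\<in>I. f i) x = (\<Sum>i\<in>I. f i x)"
  by (induction I rule: infinite_finite_induct) auto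

text \<open>Vectors with coordinates indexed by an arbitrary type, with pointwise operations.\<close>

abbreviation (input) fun_scale :: "'a :: field \<Rightarrow> ('i \<Rightarrow> 'a) \<Rightarrow> 'i \<Rightarrow> 'a" where
  "fun_scale c x \<equiv> (\<lambda>i. c * x i)"

interpretation fv: lin_space "fun_scale :: 'a :: field \<Rightarrow> ('i \<Rightarrow> 'a) \<Rightarrow> 'i \<Rightarrow> 'a"
  by unfold_locales (auto simp: fun_eq_iff algebra_simps)

text \<open>The functions that vanish outside \<open>T\<close>.\<close>

definition coord_space :: "'i set \<Rightarrow> ('i \<Rightarrow> 'a :: field) set" where
  "coord_space T = {x. \<forall>i. i \<notin> T \<longrightarrow> x i = 0}"

text \<open>The standard basis vectors.\<close>

definition unit_fun :: "'i \<Rightarrow> 'i \<Rightarrow> 'a :: field" where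
  "unit_fun i = (\<lambda>j. if j = i then 1 else 0)"

lemma coord_space_subspace: "fv.subspace (coord_space T)"
  unfolding fv.subspace_def coord_space_def by auto

lemma coord_expand:
  assumes "x \<in> coord_space T" "finite T" shows "x = (\<Sum>i\<in>T. fun_scale (x i) (unit_fun i))"
proof
  fix j
  have "(\<Sum>i\<in>T. fun_scale (x i) (unit_fun i)) j = (\<Sum>i\<in>T. if i = j then x j else 0)"
    unfolding sum_fun_apply by (intro sum.cong) (auto simp: unit_fun_def)
  also have "\<dots> = x j" using assms by (auto simp: coord_space_def)
  finally show "x j = (\<Sum>i\<in>T. fun_scale (x i) (unit_fun i)) j" by simp
qed

lemma coord_span:
  fixes T :: "'i set"
  assumes "finite T" shows "fv.span (unit_fun ` T) = (coord_space T :: ('i \<Rightarrow> 'a :: field) set)"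
proof
  show "fv.span (unit_fun ` T) \<subseteq> (coord_space T :: ('i \<Rightarrow> 'a) set)"
    by (rule fv.span_minimal[OF _ coord_space_subspace]) (auto simp: coord_space_def unit_fun_def)
  show "(coord_space T :: ('i \<Rightarrow> 'a) set) \<subseteq> fv.span (unit_fun ` T)"
  proof
    fix x :: "'i \<Rightarrow> 'a" assume "x \<in> coord_space T"
    then have "x = (\<Sum>i\<in>T. fun_scale (x i) (unit_fun i))" using assms by (rule coord_expand)
    also have "\<dots> \<in> fv.span (unit_fun ` T)"
      by (intro fv.span_sum fv.span_scale fv.span_base) auto
    finally show "x \<in> fv.span (unit_fun ` T)" .
  qed
qed

lemma unit_fun_inj: "inj (unit_fun :: 'i \<Rightarrow> 'i \<Rightarrow> 'a :: field)"
proof (rule injI)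
  fix i j :: 'i assume "unit_fun i = (unit_fun j :: 'i \<Rightarrow> 'a)"
  then have "unit_fun i i = (unit_fun j i :: 'a)" by simp
  then show "i = j" by (simp add: unit_fun_def split: if_splits)
qed

lemma unit_independent:
  assumes "finite T" shows "fv.independent (unit_fun ` T :: ('i \<Rightarrow> 'a :: field) set)"
proof (rule fv.independent_if_scalars_zero)
  fix f :: "('i \<Rightarrow> 'a) \<Rightarrow> 'a" and x :: "'i \<Rightarrow> 'a"
  assume s: "(\<Sum>x\<in>unit_fun ` T. fun_scale (f x) x) = 0" and x: "x \<in> unit_fun ` T"
  then obtain j where j: "j \<in> T" "x = unit_fun j" by auto
  have "0 = (\<Sum>x\<in>unit_fun ` T. fun_scale (f x) x) j" unfolding s by simp
  also have "\<dots> = (\<Sum>i\<in>T. f (unit_fun i) * unit_fun i j)"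
    unfolding sum_fun_apply using inj_on_subset[OF unit_fun_inj] by (subst sum.reindex) auto
  also have "\<dots> = (\<Sum>i\<in>T. if i = j then f (unit_fun j) else 0)"
    by (intro sum.cong) (auto simp: unit_fun_def)
  finally show "f x = 0" using j assms by simp
qed (simp add: assms)

lemma coord_fd: "finite T \<Longrightarrow> fv.fin_dim (coord_space T :: ('i \<Rightarrow> 'a :: field) set)"
  using fv.fin_dim_span[of "unit_fun ` T"] by (simp add: coord_span)

lemma coord_dim:
  assumes "finite T" shows "fv.dim (coord_space T :: ('i \<Rightarrow> 'a :: field) set) = card T"
proof -
  have "card (unit_fun ` T :: ('i \<Rightarrow> 'a) set) = card T"
    using inj_on_subset[OF unit_fun_inj] by (subst card_image) auto
  then show ?thesis using fv.dim_span_eq_card_independent[OF unit_independent[OF assms, where ?'a = 'a]]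
    by (simp add: coord_span assms)
qed

text \<open>The bilinear form with matrix \<open>A\<close>.\<close>

definition mat_form :: "nat \<Rightarrow> 'a :: field mat \<Rightarrow> (nat \<Rightarrow> 'a) \<Rightarrow> (nat \<Rightarrow> 'a) \<Rightarrow> 'a" where
  "mat_form n A x y = (\<Sum>i<n. \<Sum>j<n. x i * A $$ (i, j) * y j)"

lemma mat_form_alternating:
  assumes "A \<in> carrier_mat n n" "skew_symmetric_mat A" "(2 :: 'a :: field) \<noteq> 0"
  shows "fv.alternating (mat_form n (A :: 'a mat))"
  unfolding fv.alternating_def fv.functional_def
proof (intro conjI allI)
  fix x y z :: "nat \<Rightarrow> 'a" and c :: 'a
  show "mat_form n A x (y + z) = mat_form n A x y + mat_form n A x z"
    "mat_form n A (y + z) x = mat_form n A y x + mat_form n A z x"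
    by (simp_all add: mat_form_def sum.distrib[symmetric] algebra_simps)
  show "mat_form n A x (fun_scale c y) = c * mat_form n A x y"
    "mat_form n A (fun_scale c y) x = c * mat_form n A y x"
    by (simp_all add: mat_form_def sum_distrib_left algebra_simps)
  have sk: "A $$ (j, i) = - A $$ (i, j)" if "i < n" "j < n" for i j
  proof -
    have "transpose_mat A $$ (i, j) = (- A) $$ (i, j)" using assms(2) by (simp add: skew_symmetric_mat_def)
    then show ?thesis using assms(1) that by simp
  qed
  have "mat_form n A x x = (\<Sum>j<n. \<Sum>i<n. x i * A $$ (i, j) * x j)"
    unfolding mat_form_def by (rule sum.swap)
  also have "\<dots> = (\<Sum>j<n. \<Sum>i<n. - (x j * A $$ (j, i) * x i))"
  proof (intro sum.cong refl)
    fix j i assume "j \<in> {..<n}" "i \<in> {..<n}"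
    then have "A $$ (j, i) = - A $$ (i, j)" by (intro sk) simp_all
    then show "x i * A $$ (i, j) * x j = - (x j * A $$ (j, i) * x i)" by (simp only: mult_minus_left mult_minus_right minus_minus mult_ac)
  qed
  also have "\<dots> = - mat_form n A x x" by (simp add: mat_form_def sum_negf)
  finally have "2 * mat_form n A x x = 0" by (simp add: eq_neg_iff_add_eq_0)
  then show "mat_form n A x x = 0" using assms(3) by simp
qed

lemma char_not_2:
  assumes "CHAR('a :: field) \<noteq> 2" shows "(2 :: 'a) \<noteq> 0"
proof
  assume "(2 :: 'a) = 0"
  then have "CHAR('a) dvd 2" using of_nat_eq_0_iff_char_dvd[where ?'a = 'a, of 2] by simp
  then have "CHAR('a) = 1 \<or> CHAR('a) = 2" using two_is_prime_nat by (metis prime_nat_iff)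
  then show False using assms by simp
qed

theorem canonical_form_exists:
  fixes A B :: "'a :: alg_closed_field mat"
  assumes "CHAR('a) \<noteq> 2" and A: "A \<in> carrier_mat n n" and B: "B \<in> carrier_mat n n"
    and "skew_symmetric_mat A" and "skew_symmetric_mat B"
  shows "\<exists>ps. set ps \<subseteq> canonical_pairs \<and> congruent_pairs (A, B) (direct_sum_pairs ps)"
proof -
  define a where "a = mat_form n A"
  define b where "b = mat_form n B"
  have two: "(2 :: 'a) \<noteq> 0" using char_not_2[OF assms(1)] .
  have ab: "fv.alternating a" "fv.alternating b"
    unfolding a_def b_def using mat_form_alternating[OF A assms(4) two] mat_form_alternating[OF B assms(5) two] .
  interpret T: two_forms_closed fun_scale a b
    by (unfold_locales; rule ab two)
  let ?V = "coord_space {..<n} :: (nat \<Rightarrow> 'a) set"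
  obtain W ps where D: "T.decomposition ?V W ps" using T.decomposition_exists[OF coord_fd[OF finite_lessThan]] by blast
  note D' = D[unfolded T.decomposition_def]
  have "fv.fin_dim W" using fv.fin_dim_subset[OF coord_fd[OF finite_lessThan]] D' by blast
  then obtain qs where qs: "T.canonical_basis W qs" using T.nondeg_canonical_basis D' by blast
  define rs where "rs = qs @ ps"
  have "T.canonical_basis ?V rs"
    unfolding rs_def by (rule T.canonical_basis_append[OF _ qs]) (use D' T.chain_canonical in blast)+
  note E = this[unfolded T.canonical_basis_def]
  define xs where "xs = T.all_vecs rs"
  have "fv.dim ?V \<le> card (set xs)" using E by (intro fv.dim_le_card) (auto simp: xs_def)
  then have "n \<le> length xs" using card_length[of xs] by (simp add: coord_dim)
  then have len: "length xs = n" using E by (simp add: xs_def coord_dim)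
  define S where "S = mat n n (\<lambda>(i, j). (xs ! i) j)"
  have S: "S \<in> carrier_mat n n" by (simp add: S_def)
  have "\<exists>v. unit_fun i = (\<Sum>p<n. fun_scale (v p) (xs ! p))" if "i < n" for i
  proof -
    have "unit_fun i \<in> ?V" using that by (auto simp: unit_fun_def coord_space_def)
    then have "unit_fun i \<in> fv.span (set xs)" using E by (auto simp: xs_def)
    then show ?thesis using fv.span_nth_lincomb[of "unit_fun i" xs] len by simp
  qed
  then obtain v where v: "\<And>i. i < n \<Longrightarrow> unit_fun i = (\<Sum>p<n. fun_scale (v i p) (xs ! p))" by metis
  define R where "R = mat n n (\<lambda>(i, p). v i p)"
  have R: "R \<in> carrier_mat n n" by (simp add: R_def)
  have "R * S = 1\<^sub>m n"
  proof (rule eq_matI)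
    fix i j assume "i < dim_row (1\<^sub>m n)" "j < dim_col (1\<^sub>m n)"
    then have ij: "i < n" "j < n" by auto
    have "(R * S) $$ (i, j) = (\<Sum>p<n. v i p * (xs ! p) j)"
      using ij by (simp add: R_def S_def scalar_prod_def atLeast0LessThan)
    also have "\<dots> = unit_fun i j" unfolding v[OF ij(1)] sum_fun_apply by simp
    finally show "(R * S) $$ (i, j) = 1\<^sub>m n $$ (i, j)" using ij by (simp add: unit_fun_def)
  qed (auto simp: R_def S_def)
  then have inv: "invertible_mat S"
    using mat_mult_left_right_inverse[OF R S] R S unfolding invertible_mat_def inverts_mat_def by auto
  have SM: "S * M * transpose_mat S = gram (mat_form n M) xs" if M: "M \<in> carrier_mat n n" for M
  proof (rule eq_matI)
    fix i j assume "i < dim_row (gram (mat_form n M) xs)" "j < dim_col (gram (mat_form n M) xs)"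
    then have ij: "i < n" "j < n" by (auto simp: gram_def len)
    define P where "P = S * M"
    have P: "P \<in> carrier_mat n n" using S M by (simp add: P_def)
    have SMi: "P $$ (i, q) = (\<Sum>p<n. (xs ! i) p * M $$ (p, q))" if "q < n" for q
      using ij M that by (simp add: P_def S_def scalar_prod_def atLeast0LessThan)
    have "(P * transpose_mat S) $$ (i, j) = (\<Sum>q<n. P $$ (i, q) * S $$ (j, q))"
      using ij S P by (simp add: scalar_prod_def atLeast0LessThan)
    also have "\<dots> = (\<Sum>q<n. \<Sum>p<n. (xs ! i) p * M $$ (p, q) * (xs ! j) q)"
      using SMi ij by (intro sum.cong) (auto simp: S_def sum_distrib_right)
    also have "\<dots> = mat_form n M (xs ! i) (xs ! j)" unfolding mat_form_def by (rule sum.swap)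
    finally show "(S * M * transpose_mat S) $$ (i, j) = gram (mat_form n M) xs $$ (i, j)"
      using ij by (simp add: gram_def len P_def)
  qed (use S M in \<open>auto simp: gram_def len\<close>)
  have gr: "gram f xs = diag_block_mat (map (gram f) (map T.vecs rs))" if "f = a \<or> f = b" for f
    unfolding xs_def T.all_vecs_def
  proof (rule gram_concat)
    show "sorted_wrt (\<lambda>xs ys. \<forall>x\<in>set xs. \<forall>y\<in>set ys. f x y = 0 \<and> f y x = 0) (map T.vecs rs)"
      unfolding sorted_wrt_map
    proof (rule sorted_wrt_mono_rel[of _ T.ortho_chains])
      show "sorted_wrt T.ortho_chains rs" using E by blast
      fix p q assume "T.ortho_chains p q"
      then have "T.ortho (set (T.vecs p)) (set (T.vecs q))" "T.ortho (set (T.vecs q)) (set (T.vecs p))"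
        using T.ortho_sym unfolding T.ortho_chains_def by blast+
      then show "\<forall>x\<in>set (T.vecs p). \<forall>y\<in>set (T.vecs q). f x y = 0 \<and> f y x = 0"
        using that unfolding T.ortho_def by blast
    qed
  qed
  have ds: "direct_sum_pairs (map T.block_pair rs) = (gram a xs, gram b xs)"
    unfolding direct_sum_pairs_def using gr[of a] gr[of b] by (simp add: T.block_pair_def comp_def)
  have "congruent_pairs (A, B) (gram a xs, gram b xs)"
    unfolding congruent_pairs.simps
    by (rule exI[of _ n], rule exI[of _ S])
      (use A B S inv SM[OF A] SM[OF B] gram_carrier[of a xs] gram_carrier[of b xs] in \<open>simp add: a_def b_def len\<close>)
  then show ?thesis using E ds by (intro exI[of _ "map T.block_pair rs"]) auto
qed

section \<open>Solution spaces of pencils\<close>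

lemma dim_injective_image:
  fixes g :: "('i \<Rightarrow> 'a :: field) \<Rightarrow> ('j \<Rightarrow> 'a)"
  assumes add: "\<And>x y. g (x + y) = g x + g y" and scale: "\<And>c x. g (fun_scale c x) = fun_scale c (g x)"
    and X: "fv.fin_dim X" and inj: "\<And>x. x \<in> X \<Longrightarrow> g x = 0 \<Longrightarrow> x = 0"
  shows "fv.subspace (g ` X)" "fv.dim (g ` X) = fv.dim X"
proof -
  interpret L: Vector_Spaces.linear "fun_scale :: 'a \<Rightarrow> ('i \<Rightarrow> 'a) \<Rightarrow> 'i \<Rightarrow> 'a" "fun_scale :: 'a \<Rightarrow> ('j \<Rightarrow> 'a) \<Rightarrow> 'j \<Rightarrow> 'a" g
    by unfold_locales (use add scale in auto)
  have sX: "fv.subspace X" using fv.fin_dim_subspace[OF X] .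
  show "fv.subspace (g ` X)" using L.subspace_image[OF sX] .
  have injX: "inj_on g X"
    using L.inj_on_iff_eq_0[OF sX] inj by blast
  obtain B where B: "finite B" "B \<subseteq> X" "fv.independent B" "fv.span B = X" "card B = fv.dim X"
    using fv.fin_dim_basis[OF X] .
  have "fv.independent (g ` B)" using L.independent_injective_image[OF B(3)] injX B(4) by simp
  moreover have "fv.span (g ` B) = g ` X" using L.span_image[of B] B(4) by simp
  ultimately have "fv.dim (g ` X) = card (g ` B)" using fv.dim_span_eq_card_independent by metis
  also have "\<dots> = card B" using injX B(2) by (intro card_image) (rule inj_on_subset)
  finally show "fv.dim (g ` X) = fv.dim X" using B(5) by simp
qed

text \<open>The sequences \<open>z 0, \<dots>, z (k - 1)\<close> of vectors with coordinates in \<open>Q\<close> such that \<open>C (z 0) = 0\<close> and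
  \<open>C (z i) = D (z (i - 1))\<close> for \<open>0 < i < m\<close>, where \<open>R\<close> indexes the rows of \<open>C\<close> and \<open>D\<close> and \<open>z k\<close> is
  read as \<open>0\<close>. Only the values \<open>m = k\<close> and \<open>m = k + 1\<close> are used; in the second case there is the
  additional equation \<open>D (z (k - 1)) = 0\<close>. Finite index sets of rows and columns, rather than
  matrix dimensions, make block decompositions and permutations easy to express.\<close>

definition pencil_solutions ::
  "nat \<Rightarrow> nat \<Rightarrow> nat set \<Rightarrow> nat set \<Rightarrow> (nat \<Rightarrow> nat \<Rightarrow> 'a :: field) \<Rightarrow> (nat \<Rightarrow> nat \<Rightarrow> 'a) \<Rightarrow> (nat \<times> nat \<Rightarrow> 'a) set" where
  "pencil_solutions m k R Q C D = {z. z \<in> coord_space ({..<k} \<times> Q) \<and>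
    (\<forall>i<m. \<forall>r\<in>R. (\<Sum>j\<in>Q. C r j * z (i, j)) = (if i = 0 then 0 else \<Sum>j\<in>Q. D r j * z (i - 1, j)))}"

text \<open>The dimension of the space of solutions.\<close>

definition nullity where "nullity m k R Q C D = fv.dim (pencil_solutions m k R Q C D)"

lemma pencil_solutions_subspace:
  fixes C D :: "nat \<Rightarrow> nat \<Rightarrow> 'a :: field"
  shows "fv.subspace (pencil_solutions m k R Q C D)"
proof -
  have "(\<Sum>j\<in>Q. C r j * (x + y) (i, j)) = (\<Sum>j\<in>Q. C r j * x (i, j)) + (\<Sum>j\<in>Q. C r j * y (i, j))"
    "(\<Sum>j\<in>Q. C r j * (c * x (i, j))) = c * (\<Sum>j\<in>Q. C r j * x (i, j))" 
    for C :: "nat \<Rightarrow> nat \<Rightarrow> 'a" and x y :: "nat \<times> nat \<Rightarrow> 'a" and r i c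
    by (simp_all add: sum.distrib sum_distrib_left algebra_simps)
  note * = this
  show ?thesis
    unfolding fv.subspace_def pencil_solutions_def
    using coord_space_subspace[of "{..<k} \<times> Q", unfolded fv.subspace_def] by (auto simp: * simp del: plus_fun_apply)
qed

lemma pencil_solutions_fd: "finite Q \<Longrightarrow> fv.fin_dim (pencil_solutions m k R Q C D)"
  by (rule fv.fin_dim_subset[OF coord_fd[of "{..<k} \<times> Q"] pencil_solutions_subspace])
    (auto simp: pencil_solutions_def)

lemma pencil_solutions_cong:
  assumes "\<And>r j. r \<in> R \<Longrightarrow> j \<in> Q \<Longrightarrow> C r j = C' r j" "\<And>r j. r \<in> R \<Longrightarrow> j \<in> Q \<Longrightarrow> D r j = D' r j"
  shows "pencil_solutions m k R Q C D = pencil_solutions m k R Q C' D'"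
  unfolding pencil_solutions_def using assms by (auto cong: sum.cong)

lemma nullity_cong:
  assumes "\<And>r j. r \<in> R \<Longrightarrow> j \<in> Q \<Longrightarrow> C r j = C' r j" "\<And>r j. r \<in> R \<Longrightarrow> j \<in> Q \<Longrightarrow> D r j = D' r j"
  shows "nullity m k R Q C D = nullity m k R Q C' D'"
  unfolding nullity_def using pencil_solutions_cong[OF assms] by simp

lemma nullity_uminus:
  fixes C D :: "nat \<Rightarrow> nat \<Rightarrow> 'a :: field"
  shows "nullity m k R Q (\<lambda>r j. - C r j) (\<lambda>r j. - D r j) = nullity m k R Q C D"
proof -
  have "(- x = (if P then 0 else - y)) = (x = (if P then 0 else y))" for x y :: 'a and P by auto
  then have "pencil_solutions m k R Q (\<lambda>r j. - C r j) (\<lambda>r j. - D r j) = pencil_solutions m k R Q C D"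
    unfolding pencil_solutions_def by (simp add: sum_negf)
  then show ?thesis by (simp add: nullity_def)
qed

lemma nullity_split:
  fixes C D :: "nat \<Rightarrow> nat \<Rightarrow> 'a :: field"
  assumes "finite Q1" "finite Q2" "Q1 \<inter> Q2 = {}"
    and 12: "\<And>r j. r \<in> R1 \<Longrightarrow> j \<in> Q2 \<Longrightarrow> C r j = 0 \<and> D r j = 0"
    and 21: "\<And>r j. r \<in> R2 \<Longrightarrow> j \<in> Q1 \<Longrightarrow> C r j = 0 \<and> D r j = 0"
  shows "nullity m k (R1 \<union> R2) (Q1 \<union> Q2) C D = nullity m k R1 Q1 C D + nullity m k R2 Q2 C D"
proof -
  let ?Z = "pencil_solutions m k (R1 \<union> R2) (Q1 \<union> Q2) C D"
  let ?Z1 = "pencil_solutions m k R1 Q1 C D" and ?Z2 = "pencil_solutions m k R2 Q2 C D"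
  have su: "(\<Sum>j\<in>Q1 \<union> Q2. h j) = (\<Sum>j\<in>Q1. h j) + (\<Sum>j\<in>Q2. h j)" for h :: "nat \<Rightarrow> 'a"
    using assms(1-3) by (rule sum.union_disjoint)
  have z12: "(\<Sum>j\<in>Q2. C r j * z (i, j)) = 0" "(\<Sum>j\<in>Q2. D r j * z (i, j)) = 0" if "r \<in> R1" for r i and z :: "nat \<times> nat \<Rightarrow> 'a"
    using 12[OF that] by simp_all
  have z21: "(\<Sum>j\<in>Q1. C r j * z (i, j)) = 0" "(\<Sum>j\<in>Q1. D r j * z (i, j)) = 0" if "r \<in> R2" for r i and z :: "nat \<times> nat \<Rightarrow> 'a"
    using 21[OF that] by simp_all
  have Z: "z \<in> ?Z \<longleftrightarrow> z \<in> coord_space ({..<k} \<times> (Q1 \<union> Q2)) \<and>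
    (\<forall>i<m. \<forall>r\<in>R1. (\<Sum>j\<in>Q1. C r j * z (i, j)) = (if i = 0 then 0 else \<Sum>j\<in>Q1. D r j * z (i - 1, j))) \<and>
    (\<forall>i<m. \<forall>r\<in>R2. (\<Sum>j\<in>Q2. C r j * z (i, j)) = (if i = 0 then 0 else \<Sum>j\<in>Q2. D r j * z (i - 1, j)))" for z
    unfolding pencil_solutions_def su mem_Collect_eq ball_Un by (auto simp: z12 z21)
  have off1: "(\<Sum>j\<in>Q2. h j * z (i, j)) = 0" if "z \<in> ?Z1" for z i h
  proof (rule sum.neutral, rule ballI)
    fix j assume "j \<in> Q2"
    then have "z (i, j) = 0" using that assms(3) by (auto simp: pencil_solutions_def coord_space_def)
    then show "h j * z (i, j) = 0" by simp
  qed
  have off2: "(\<Sum>j\<in>Q1. h j * z (i, j)) = 0" if "z \<in> ?Z2" for z i h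
  proof (rule sum.neutral, rule ballI)
    fix j assume "j \<in> Q1"
    then have "z (i, j) = 0" using that assms(3) by (auto simp: pencil_solutions_def coord_space_def)
    then show "h j * z (i, j) = 0" by simp
  qed
  have sub1: "?Z1 \<subseteq> ?Z"
  proof
    fix z assume z: "z \<in> ?Z1"
    show "z \<in> ?Z" unfolding Z using z off1[OF z] by (auto simp: pencil_solutions_def coord_space_def)
  qed
  have sub2: "?Z2 \<subseteq> ?Z"
  proof
    fix z assume z: "z \<in> ?Z2"
    show "z \<in> ?Z" unfolding Z using z off2[OF z] by (auto simp: pencil_solutions_def coord_space_def)
  qed
  have fin: "finite (Q1 \<union> Q2)" using assms by simp
  have "fv.dim ?Z = fv.dim ?Z1 + fv.dim ?Z2"
  proof (rule fv.dim_direct_sum[OF pencil_solutions_fd[OF fin] pencil_solutions_subspace sub1 pencil_solutions_subspace sub2])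
    have "z = 0" if "z \<in> ?Z1" "z \<in> ?Z2" for z
    proof
      fix t :: "nat \<times> nat"
      obtain i j where t: "t = (i, j)" by (cases t)
      have "j \<notin> Q1 \<or> j \<notin> Q2" using assms(3) by blast
      then show "z t = 0 t" using that unfolding t by (auto simp: pencil_solutions_def coord_space_def)
    qed
    then show "?Z1 \<inter> ?Z2 = {0}"
      using fv.subspace_0[OF pencil_solutions_subspace[of m k R1 Q1 C D]]
        fv.subspace_0[OF pencil_solutions_subspace[of m k R2 Q2 C D]] by blast
    fix z assume z: "z \<in> ?Z"
    let ?u = "\<lambda>(i, j). if j \<in> Q1 then z (i, j) else 0"
    let ?v = "\<lambda>(i, j). if j \<in> Q2 then z (i, j) else 0"
    have "?u \<in> ?Z1" using z unfolding Z by (auto simp: pencil_solutions_def coord_space_def cong: sum.cong)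
    moreover have "?v \<in> ?Z2" using z unfolding Z by (auto simp: pencil_solutions_def coord_space_def cong: sum.cong)
    moreover have "z = ?u + ?v"
    proof
      fix t :: "nat \<times> nat"
      obtain i j where t: "t = (i, j)" by (cases t)
      show "z t = (?u + ?v) t" using z assms(3) unfolding t Z by (auto simp: coord_space_def)
    qed
    ultimately show "\<exists>w\<in>?Z1. \<exists>u\<in>?Z2. z = w + u" by blast
  qed
  then show ?thesis by (simp add: nullity_def)
qed

lemma nullity_reindex:
  fixes C D :: "nat \<Rightarrow> nat \<Rightarrow> 'a :: field"
  assumes h: "bij_betw h Q' Q" and g: "g ` R' = R" and fin: "finite Q"
  shows "nullity m k R Q C D = nullity m k R' Q' (\<lambda>r j. C (g r) (h j)) (\<lambda>r j. D (g r) (h j))"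
proof -
  let ?Z = "pencil_solutions m k R Q C D"
  let ?Z' = "pencil_solutions m k R' Q' (\<lambda>r j. C (g r) (h j)) (\<lambda>r j. D (g r) (h j))"
  define G where "G = (\<lambda>(z :: nat \<times> nat \<Rightarrow> 'a) (i, j). if j \<in> Q' then z (i, h j) else 0)"
  have hm: "h j \<in> Q" if "j \<in> Q'" for j using h that by (auto simp: bij_betw_def)
  have re: "(\<Sum>j\<in>Q. F j * z (i, j)) = (\<Sum>j\<in>Q'. F (h j) * G z (i, j))" for F and z :: "nat \<times> nat \<Rightarrow> 'a" and i
    using sum.reindex_bij_betw[OF h, of "\<lambda>j. F j * z (i, j)"] by (simp add: G_def cong: sum.cong)
  have mem: "G z \<in> ?Z'" if z: "z \<in> ?Z" for z
  proof -
    have "G z \<in> coord_space ({..<k} \<times> Q')" using z by (auto simp: G_def pencil_solutions_def coord_space_def)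
    then show ?thesis using z g unfolding pencil_solutions_def re by auto
  qed
  have surj: "z' \<in> G ` ?Z" if z': "z' \<in> ?Z'" for z'
  proof -
    define z where "z = (\<lambda>(i, j). if j \<in> Q then z' (i, inv_into Q' h j) else 0)"
    have inv: "inv_into Q' h (h j) = j" if "j \<in> Q'" for j using h that by (auto simp: bij_betw_def inv_into_f_f)
    have inv': "inv_into Q' h j \<in> Q'" if "j \<in> Q" for j using h that by (auto simp: bij_betw_def intro: inv_into_into)
    have Gz: "G z = z'"
    proof
      fix t :: "nat \<times> nat"
      obtain i j where t: "t = (i, j)" by (cases t)
      show "G z t = z' t" using z' unfolding t by (auto simp: G_def z_def hm inv pencil_solutions_def coord_space_def)
    qed
    have "z \<in> coord_space ({..<k} \<times> Q)" using z' inv' by (auto simp: z_def pencil_solutions_def coord_space_def)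
    then have "z \<in> ?Z" using z' g unfolding pencil_solutions_def mem_Collect_eq re Gz by auto
    then show ?thesis using Gz by blast
  qed
  have im: "G ` ?Z = ?Z'" using mem surj by blast
  have "fv.dim (G ` ?Z) = fv.dim ?Z"
  proof (rule dim_injective_image(2))
    show "fv.fin_dim ?Z" using pencil_solutions_fd[OF fin] .
    show "G (x + y) = G x + G y" for x y by (auto simp: G_def fun_eq_iff)
    show "G (fun_scale c x) = fun_scale c (G x)" for c x by (auto simp: G_def fun_eq_iff)
    fix x assume x: "x \<in> ?Z" "G x = 0"
    show "x = 0"
    proof
      fix t :: "nat \<times> nat"
      obtain i j where t: "t = (i, j)" by (cases t)
      show "x t = 0 t"
      proof (cases "j \<in> Q")
        case True
        then obtain j' where j': "j' \<in> Q'" "j = h j'" using h by (auto simp: bij_betw_def)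
        have "G x (i, j') = 0" using x(2) by simp
        then show ?thesis using j' t by (simp add: G_def)
      next
        case False then show ?thesis using x(1) t by (auto simp: pencil_solutions_def coord_space_def)
      qed
    qed
  qed
  then show ?thesis unfolding nullity_def im by simp
qed

text \<open>If \<open>T C' = C S\<close> and \<open>T D' = D S\<close> with \<open>S\<close> left invertible, then multiplication by \<open>S\<close> embeds the
  solutions for \<open>(C', D')\<close> into the solutions for \<open>(C, D)\<close>.\<close>

lemma nullity_le_of_equivalence:
  fixes C D C' D' S T S' :: "nat \<Rightarrow> nat \<Rightarrow> 'a :: field"
  assumes C: "\<And>p j. p < n \<Longrightarrow> j < n \<Longrightarrow> (\<Sum>r<n. T p r * C' r j) = (\<Sum>q<n. C p q * S q j)"
    and D: "\<And>p j. p < n \<Longrightarrow> j < n \<Longrightarrow> (\<Sum>r<n. T p r * D' r j) = (\<Sum>q<n. D p q * S q j)"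
    and S: "\<And>i j. i < n \<Longrightarrow> j < n \<Longrightarrow> (\<Sum>q<n. S' i q * S q j) = (if i = j then 1 else 0)"
  shows "nullity m k {..<n} {..<n} C' D' \<le> nullity m k {..<n} {..<n} C D"
proof -
  let ?Z = "pencil_solutions m k {..<n} {..<n} C D" and ?Z' = "pencil_solutions m k {..<n} {..<n} C' D'"
  define G where "G = (\<lambda>(z :: nat \<times> nat \<Rightarrow> 'a) (i, q). if q < n then \<Sum>j<n. S q j * z (i, j) else 0)"
  have key: "(\<Sum>q<n. E p q * G z (i, q)) = (\<Sum>r<n. T p r * (\<Sum>j<n. E' r j * z (i, j)))"
    if E: "\<And>j. j < n \<Longrightarrow> (\<Sum>r<n. T p r * E' r j) = (\<Sum>q<n. E p q * S q j)" for E E' :: "nat \<Rightarrow> nat \<Rightarrow> 'a" and p z i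
  proof -
    have "(\<Sum>q<n. E p q * G z (i, q)) = (\<Sum>q<n. \<Sum>j<n. E p q * S q j * z (i, j))"
      by (simp add: G_def sum_distrib_left mult.assoc)
    also have "\<dots> = (\<Sum>j<n. \<Sum>q<n. E p q * S q j * z (i, j))" by (rule sum.swap)
    also have "\<dots> = (\<Sum>j<n. (\<Sum>r<n. T p r * E' r j) * z (i, j))"
      using E by (intro sum.cong) (auto simp: sum_distrib_right)
    also have "\<dots> = (\<Sum>j<n. \<Sum>r<n. T p r * (E' r j * z (i, j)))"
      by (simp add: sum_distrib_right mult.assoc)
    also have "\<dots> = (\<Sum>r<n. \<Sum>j<n. T p r * (E' r j * z (i, j)))" by (rule sum.swap)
    finally show ?thesis by (simp add: sum_distrib_left)
  qed
  have sub: "G ` ?Z' \<subseteq> ?Z"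
  proof (rule image_subsetI)
    fix z assume z: "z \<in> ?Z'"
    have "G z \<in> coord_space ({..<k} \<times> {..<n})" using z by (auto simp: G_def pencil_solutions_def coord_space_def)
    moreover have "(\<Sum>j<n. C r j * G z (i, j)) = (if i = 0 then 0 else \<Sum>j<n. D r j * G z (i - 1, j))"
      if "i < m" "r < n" for i r
    proof -
      have "(\<Sum>j<n. C r j * G z (i, j)) = (\<Sum>s<n. T r s * (\<Sum>j<n. C' s j * z (i, j)))"
        using key[of r C' C] C that by blast
      also have "\<dots> = (\<Sum>s<n. T r s * (if i = 0 then 0 else \<Sum>j<n. D' s j * z (i - 1, j)))"
        using z that by (intro sum.cong) (auto simp: pencil_solutions_def)
      also have "\<dots> = (if i = 0 then 0 else \<Sum>j<n. D r j * G z (i - 1, j))"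
        using key[of r D' D] D that by simp
      finally show ?thesis .
    qed
    ultimately show "G z \<in> ?Z" by (simp add: pencil_solutions_def)
  qed
  have 1: "G (x + y) = G x + G y" for x y by (auto simp: G_def fun_eq_iff sum.distrib[symmetric] algebra_simps)
  have 2: "G (fun_scale c x) = fun_scale c (G x)" for c x by (auto simp: G_def fun_eq_iff sum_distrib_left algebra_simps)
  have 3: "x = 0" if x: "x \<in> ?Z'" "G x = 0" for x
  proof
    fix t :: "nat \<times> nat"
    obtain i j where t: "t = (i, j)" by (cases t)
    show "x t = 0 t"
    proof (cases "j < n")
      case True
      have "0 = (\<Sum>q<n. S' j q * G x (i, q))" using x(2) by simp
      also have "\<dots> = (\<Sum>q<n. \<Sum>l<n. S' j q * S q l * x (i, l))" by (simp add: G_def sum_distrib_left mult.assoc)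
      also have "\<dots> = (\<Sum>l<n. \<Sum>q<n. S' j q * S q l * x (i, l))" by (rule sum.swap)
      also have "\<dots> = (\<Sum>l<n. (if j = l then x (i, l) else 0))"
      proof (rule sum.cong[OF refl])
        fix l assume "l \<in> {..<n}"
        then have "(\<Sum>q<n. S' j q * S q l * x (i, l)) = (if j = l then 1 else 0) * x (i, l)"
          using S[OF True, of l] by (simp add: sum_distrib_right[symmetric])
        then show "(\<Sum>q<n. S' j q * S q l * x (i, l)) = (if j = l then x (i, l) else 0)" by simp
      qed
      also have "\<dots> = x (i, j)" using True by simp
      finally show ?thesis using t by simp
    next
      case False then show ?thesis using x(1) t by (auto simp: pencil_solutions_def coord_space_def)
    qed
  qed
  note im = dim_injective_image[of G ?Z', OF 1 2 pencil_solutions_fd[OF finite_lessThan] 3]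
  show ?thesis using fv.dim_le_of_subset[OF pencil_solutions_fd[OF finite_lessThan] sub im(1)] im(2)
    by (simp add: nullity_def)
qed

section \<open>Nullities of bidiagonal pencils\<close>

text \<open>If \<open>C\<close> is injective, the equations force \<open>z 0 = 0\<close>, \<open>z 1 = 0\<close> and so on.\<close>

lemma nullity_eq_0:
  fixes C D :: "nat \<Rightarrow> nat \<Rightarrow> 'a :: field"
  assumes inj: "\<And>x j. (\<And>r. r \<in> R \<Longrightarrow> (\<Sum>j<q. C r j * x j) = 0) \<Longrightarrow> j < q \<Longrightarrow> x j = 0"
    and "k \<le> m"
  shows "nullity m k R {..<q} C D = 0"
proof -
  let ?Z = "pencil_solutions m k R {..<q} C D"
  have "z = 0" if z: "z \<in> ?Z" for z
  proof -
    have *: "\<forall>j<q. z (i, j) = 0" if "i < k" for i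
      using that
    proof (induction i)
      case 0
      have "\<And>r. r \<in> R \<Longrightarrow> (\<Sum>j<q. C r j * z (0, j)) = 0"
        using z 0 \<open>k \<le> m\<close> by (auto simp: pencil_solutions_def)
      then show ?case using inj[of "\<lambda>j. z (0, j)"] by blast
    next
      case (Suc i)
      have "(\<Sum>j<q. C r j * z (Suc i, j)) = 0" if r: "r \<in> R" for r
      proof -
        have "(\<Sum>j<q. C r j * z (Suc i, j)) = (\<Sum>j<q. D r j * z (i, j))"
          using z Suc.prems \<open>k \<le> m\<close> r by (auto simp: pencil_solutions_def)
        also have "\<dots> = 0" using Suc by (intro sum.neutral) auto
        finally show ?thesis .
      qed
      then show ?case using inj[of "\<lambda>j. z (Suc i, j)"] by blast
    qed
    show "z = 0"
    proof
      fix t :: "nat \<times> nat"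
      obtain i j where t: "t = (i, j)" by (cases t)
      show "z t = 0 t"
      proof (cases "i < k \<and> j < q")
        case True then show ?thesis using * t by simp
      next
        case False then show ?thesis using z t by (auto simp: pencil_solutions_def coord_space_def)
      qed
    qed
  qed
  then have "?Z = {0}" using fv.subspace_0[OF pencil_solutions_subspace] by blast
  then show ?thesis unfolding nullity_def using fv.dim_eq_0_iff[OF pencil_solutions_fd[OF finite_lessThan]] by blast
qed

text \<open>If \<open>D\<close> is injective, the additional equation forces \<open>z (k - 1) = 0\<close>, \<open>z (k - 2) = 0\<close> and so on.\<close>

lemma nullity_eq_0':
  fixes C D :: "nat \<Rightarrow> nat \<Rightarrow> 'a :: field"
  assumes inj: "\<And>x j. (\<And>r. r \<in> R \<Longrightarrow> (\<Sum>j<q. D r j * x j) = 0) \<Longrightarrow> j < q \<Longrightarrow> x j = 0"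
  shows "nullity (Suc k) k R {..<q} C D = 0"
proof -
  let ?Z = "pencil_solutions (Suc k) k R {..<q} C D"
  have "z = 0" if z: "z \<in> ?Z" for z
  proof -
    have off: "z (i, j) = 0" if "\<not> (i < k \<and> j < q)" for i j
      using z that by (auto simp: pencil_solutions_def coord_space_def)
    have *: "\<forall>j<q. z (k - d, j) = 0" if "d \<le> k" for d
      using that
    proof (induction d)
      case 0 then show ?case using off by simp
    next
      case (Suc d)
      define i where "i = k - Suc d"
      have i: "k - d = Suc i" "Suc i < Suc k" using Suc.prems by (auto simp: i_def)
      have "(\<Sum>j<q. D r j * z (i, j)) = 0" if r: "r \<in> R" for r
      proof -
        have "(\<Sum>j<q. C r j * z (Suc i, j)) = (\<Sum>j<q. D r j * z (i, j))"
          using z i(2) r by (auto simp: pencil_solutions_def)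
        moreover have "(\<Sum>j<q. C r j * z (Suc i, j)) = 0" using Suc i(1) by (intro sum.neutral) auto
        ultimately show ?thesis by simp
      qed
      then show ?case using inj[of "\<lambda>j. z (i, j)"] unfolding i_def by blast
    qed
    show "z = 0"
    proof
      fix t :: "nat \<times> nat"
      obtain i j where t: "t = (i, j)" by (cases t)
      show "z t = 0 t"
      proof (cases "i < k \<and> j < q")
        case True
        then have "i = k - (k - i)" by simp
        then show ?thesis using *[of "k - i"] True t by simp
      next
        case False then show ?thesis using off t by simp
      qed
    qed
  qed
  then have "?Z = {0}" using fv.subspace_0[OF pencil_solutions_subspace] by blast
  then show ?thesis unfolding nullity_def using fv.dim_eq_0_iff[OF pencil_solutions_fd[OF finite_lessThan]] by blast
qed

text \<open>The solution of the recursion \<open>z i (j + 1) = l * z i j + z (i - 1) j\<close> with first column \<open>w\<close>, where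
  \<open>z i j\<close> is the coordinate \<open>j\<close> of \<open>z i\<close> and \<open>z (- 1)\<close> is read as \<open>0\<close>. For \<open>l = 0\<close> it is the lower triangular Toeplitz matrix of \<open>w\<close>.\<close>

fun cell_entry :: "'a :: field \<Rightarrow> (nat \<Rightarrow> 'a) \<Rightarrow> nat \<Rightarrow> nat \<Rightarrow> 'a" where
  "cell_entry l w i 0 = w i"
| "cell_entry l w i (Suc j) = l * cell_entry l w i j + (if i = 0 then 0 else cell_entry l w (i - 1) j)"

lemma cell_entry_0: "cell_entry 0 w i j = (if j \<le> i then w (i - j) else 0)"
  by (induction j arbitrary: i) (auto simp: Suc_diff_Suc)

text \<open>The restriction of that solution to \<open>k\<close> vectors with \<open>n\<close> coordinates.\<close>

definition cell :: "nat \<Rightarrow> nat \<Rightarrow> 'a :: field \<Rightarrow> (nat \<Rightarrow> 'a) \<Rightarrow> nat \<times> nat \<Rightarrow> 'a" where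
  "cell k n l w = (\<lambda>(i, j). if i < k \<and> j < n then cell_entry l w i j else 0)"

lemma cell_dim:
  fixes l :: "'a :: field"
  assumes "T \<subseteq> {..<k}" "0 < n"
  shows "fv.dim (cell k n l ` coord_space T) = card T"
proof -
  have add: "cell_entry l (x + y) i j = cell_entry l x i j + cell_entry l y i j" for x y :: "nat \<Rightarrow> 'a" and i j
    by (induction j arbitrary: i) (auto simp: algebra_simps)
  have scale: "cell_entry l (\<lambda>t. c * x t) i j = c * cell_entry l x i j" for c and x :: "nat \<Rightarrow> 'a" and i j
    by (induction j arbitrary: i) (auto simp: algebra_simps)
  have finT: "finite T" using assms(1) finite_subset by blast
  have "fv.dim (cell k n l ` coord_space T) = fv.dim (coord_space T :: (nat \<Rightarrow> 'a) set)"
  proof (rule dim_injective_image(2))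
    show "fv.fin_dim (coord_space T :: (nat \<Rightarrow> 'a) set)" using coord_fd[OF finT] .
    show "cell k n l (x + y) = cell k n l x + cell k n l y" for x y
      by (auto simp: cell_def fun_eq_iff add)
    show "cell k n l (fun_scale c x) = fun_scale c (cell k n l x)" for c x
      by (auto simp: cell_def fun_eq_iff scale)
    fix w assume w: "w \<in> coord_space T" "cell k n l w = 0"
    show "w = 0"
    proof
      fix t
      show "w t = 0 t"
      proof (cases "t \<in> T")
        case True
        then have "cell k n l w (t, 0) = w t" using assms by (auto simp: cell_def)
        then show ?thesis using w(2) by simp
      next
        case False then show ?thesis using w(1) by (simp add: coord_space_def)
      qed
    qed
  qed
  then show ?thesis using coord_dim[OF finT] by simp
qed

lemma cell_recursion:
  assumes "i < k" "Suc r < n"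
  shows "cell k n l w (i, Suc r) = l * cell k n l w (i, r) + (if i = 0 then 0 else cell k n l w (i - 1, r))"
  using assms by (auto simp: cell_def)

lemma cell_shape:
  assumes "z \<in> coord_space ({..<k} \<times> {..<n})"
    "\<And>i r. i < k \<Longrightarrow> Suc r < n \<Longrightarrow> z (i, Suc r) = l * z (i, r) + (if i = 0 then 0 else z (i - 1, r))"
  shows "z = cell k n l (\<lambda>i. z (i, 0))"
proof
  fix t :: "nat \<times> nat"
  obtain i j where t: "t = (i, j)" by (cases t)
  have "z (i, j) = cell_entry l (\<lambda>i. z (i, 0)) i j" if "i < k" "j < n" for i j
    using that
  proof (induction j arbitrary: i)
    case (Suc j) then show ?case using assms(2)[of i j] by auto
  qed simp
  then show "z t = cell k n l (\<lambda>i. z (i, 0)) t" using assms(1) t by (auto simp: cell_def coord_space_def)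
qed

text \<open>The matrix with \<open>x\<close> on the diagonal and \<open>y\<close> above it. In terms of it, the blocks of every pencil
  spanned by a canonical pair are, up to transposition and sign, bidiagonal.\<close>

definition bidiag :: "'a :: field \<Rightarrow> 'a \<Rightarrow> nat \<Rightarrow> nat \<Rightarrow> 'a" where
  "bidiag x y r j = (if j = r then x else 0) + (if j = Suc r then y else 0)"

lemma bidiag_sum:
  "(\<Sum>j<n. bidiag x y r j * v j) = (if r < n then x * v r else 0) + (if Suc r < n then y * v (Suc r) else 0)"
proof -
  have "(\<Sum>j<n. bidiag x y r j * v j) = (\<Sum>j<n. if j = r then x * v r else 0) + (\<Sum>j<n. if j = Suc r then y * v (Suc r) else 0)"
    by (subst sum.distrib[symmetric], intro sum.cong) (auto simp: bidiag_def)
  then show ?thesis by simp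
qed

lemma bidiag_sum':
  "(\<Sum>j<n. bidiag x y j r * v j) = (if r < n then x * v r else 0) + (if 0 < r \<and> r \<le> n then y * v (r - 1) else 0)"
proof -
  have "(\<Sum>j<n. bidiag x y j r * v j) = (\<Sum>j<n. if j = r then x * v r else 0) + (\<Sum>j<n. if 0 < r \<and> j = r - 1 then y * v (r - 1) else 0)"
    by (subst sum.distrib[symmetric], intro sum.cong) (auto simp: bidiag_def)
  moreover have "(\<Sum>j<n. if 0 < r \<and> j = r - 1 then y * v (r - 1) else 0) = (if 0 < r \<and> r \<le> n then y * v (r - 1) else 0)"
    by (cases "0 < r") auto
  ultimately show ?thesis by simp
qed

lemma descending_zero:
  fixes v :: "nat \<Rightarrow> 'a :: zero"
  assumes "\<And>j. j < q \<Longrightarrow> (\<And>i. j < i \<Longrightarrow> i < q \<Longrightarrow> v i = 0) \<Longrightarrow> v j = 0" "j < q"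
  shows "v j = 0"
  using assms(2)
proof (induction "q - j" arbitrary: j rule: less_induct)
  case less
  show ?case by (rule assms(1)[OF less.prems]) (rule less.hyps, use less.prems in auto)
qed

lemma bidiag_injective:
  assumes "x \<noteq> 0" "\<And>r. r \<in> {..<n} \<Longrightarrow> (\<Sum>j<n. bidiag x y r j * v j) = 0" "j < n"
  shows "v j = 0"
proof (rule descending_zero[of n v, OF _ assms(3)])
  fix j assume j: "j < n" "\<And>i. j < i \<Longrightarrow> i < n \<Longrightarrow> v i = 0"
  show "v j = 0" using assms(2)[of j] assms(1) j(1) j(2)[of "Suc j"] by (auto simp: bidiag_sum split: if_splits)
qed

lemma nullity_bidiag_unit: "x \<noteq> 0 \<Longrightarrow> k \<le> m \<Longrightarrow> nullity m k {..<n} {..<n} (bidiag x y) D = 0"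
  by (rule nullity_eq_0) (rule bidiag_injective)

lemma nullity_bidiag_unit': "x \<noteq> 0 \<Longrightarrow> nullity (Suc k) k {..<n} {..<n} C (bidiag x y) = 0"
  by (rule nullity_eq_0') (rule bidiag_injective)

lemma nullity_bidiag_transposed:
  "k \<le> m \<Longrightarrow> nullity m k {..<Suc q} {..<q} (\<lambda>r j. bidiag 1 0 j r) D = 0"
  "k \<le> m \<Longrightarrow> nullity m k {..<Suc q} {..<q} (\<lambda>r j. bidiag x 1 j r) D = 0"
proof -
  show "nullity m k {..<Suc q} {..<q} (\<lambda>r j. bidiag 1 0 j r) D = 0" if "k \<le> m"
  proof (rule nullity_eq_0[OF _ that])
    fix v :: "nat \<Rightarrow> 'a" and j
    assume "\<And>r. r \<in> {..<Suc q} \<Longrightarrow> (\<Sum>j<q. bidiag 1 0 j r * v j) = 0" "j < q"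
    from this(1)[of j] this(2) show "v j = 0" by (auto simp: bidiag_sum' split: if_splits)
  qed
  show "nullity m k {..<Suc q} {..<q} (\<lambda>r j. bidiag x 1 j r) D = 0" if "k \<le> m"
  proof (rule nullity_eq_0[OF _ that])
    fix v :: "nat \<Rightarrow> 'a" and j
    assume v: "\<And>r. r \<in> {..<Suc q} \<Longrightarrow> (\<Sum>j<q. bidiag x 1 j r * v j) = 0" and j: "j < q"
    show "v j = 0"
    proof (rule descending_zero[of q v, OF _ j])
      fix j assume j: "j < q" "\<And>i. j < i \<Longrightarrow> i < q \<Longrightarrow> v i = 0"
      show "v j = 0" using v[of "Suc j"] j(1) j(2)[of "Suc j"] by (auto simp: bidiag_sum' split: if_splits)
    qed
  qed
qed

lemma nullity_nilpotent: "nullity k k {..<n} {..<n} (bidiag 0 1) (bidiag 1 0 :: nat \<Rightarrow> nat \<Rightarrow> 'a :: field) = min n k"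
proof (cases "n = 0")
  case True
  have "nullity k k {..<n} {..<n} (bidiag 0 1) (bidiag 1 0 :: nat \<Rightarrow> nat \<Rightarrow> 'a) = 0"
    by (rule nullity_eq_0) (use True in auto)
  then show ?thesis using True by simp
next
  case False
  let ?Z = "pencil_solutions k k {..<n} {..<n} (bidiag 0 1) (bidiag 1 0 :: nat \<Rightarrow> nat \<Rightarrow> 'a)"
  define T where "T = {k - min n k..<k}"
  have Z: "z \<in> ?Z \<longleftrightarrow> z \<in> coord_space ({..<k} \<times> {..<n}) \<and>
    (\<forall>i<k. \<forall>r<n. (if Suc r < n then z (i, Suc r) else 0) = (if i = 0 then 0 else z (i - 1, r)))" for z
    by (auto simp: pencil_solutions_def bidiag_sum)
  have Zeq: "(if Suc r < n then z (i, Suc r) else 0) = (if i = 0 then 0 else z (i - 1, r))"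
    if "z \<in> ?Z" "i < k" "r < n" for z i r
    using that Z by blast
  have "?Z = cell k n 0 ` coord_space T"
  proof
    show "?Z \<subseteq> cell k n 0 ` coord_space T"
    proof
      fix z assume z: "z \<in> ?Z"
      have step: "z (i, Suc r) = 0 * z (i, r) + (if i = 0 then 0 else z (i - 1, r))" if "i < k" "Suc r < n" for i r
        using Zeq[OF z that(1), of r] that by simp
      have eq: "z = cell k n 0 (\<lambda>i. z (i, 0))"
        by (rule cell_shape) (use z step in \<open>auto simp: Z\<close>)
      have "z (t, 0) = 0" if t: "t \<notin> T" for t
      proof (cases "t < k")
        case True
        then have tn: "t + n < k" using t by (auto simp: T_def)
        let ?i = "t + n - 1"
        have "z (?i, n - 1) = z (t, 0)"
          by (subst eq) (use tn False in \<open>auto simp: cell_def cell_entry_0\<close>)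
        moreover have "z (?i, n - 1) = 0"
        proof -
          have "(if Suc (n - 1) < n then z (t + n, Suc (n - 1)) else 0) = (if t + n = 0 then 0 else z (t + n - 1, n - 1))"
            by (rule Zeq[OF z]) (use tn False in auto)
          then show ?thesis using False by simp
        qed
        ultimately show ?thesis by simp
      next
        case False then show ?thesis using z unfolding Z by (auto simp: coord_space_def)
      qed
      then show "z \<in> cell k n 0 ` coord_space T" using eq by (auto simp: coord_space_def)
    qed
    show "cell k n 0 ` coord_space T \<subseteq> ?Z"
    proof (rule image_subsetI)
      fix w :: "nat \<Rightarrow> 'a" assume w: "w \<in> coord_space T"
      have "(if Suc r < n then cell k n 0 w (i, Suc r) else 0) = (if i = 0 then 0 else cell k n 0 w (i - 1, r))"
        if "i < k" "r < n" for i r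
      proof (cases "Suc r < n")
        case True then show ?thesis using cell_recursion[OF that(1) True, of 0 w] by simp
      next
        case False
        then have r: "r = n - 1" using that by simp
        have "cell k n 0 w (i - 1, r) = 0" if "i \<noteq> 0"
        proof (cases "r \<le> i - 1")
          case True
          have "i - 1 - r \<notin> T" using True r \<open>i < k\<close> \<open>n \<noteq> 0\<close> that by (auto simp: T_def min_def split: if_splits)
          then show ?thesis using w by (auto simp: cell_def cell_entry_0 coord_space_def)
        next
          case False then show ?thesis by (auto simp: cell_def cell_entry_0)
        qed
        then show ?thesis using False by simp
      qed
      then show "cell k n 0 w \<in> ?Z" unfolding Z by (auto simp: coord_space_def cell_def)
    qed
  qed
  moreover have "T \<subseteq> {..<k}" "card T = min n k" by (auto simp: T_def)
  ultimately show ?thesis unfolding nullity_def using cell_dim[of T k n 0] False by simp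
qed

lemma nullity_rectangular:
  "nullity k k {..<q} {..<Suc q} (bidiag (- l) 1) (bidiag 1 0 :: nat \<Rightarrow> nat \<Rightarrow> 'a :: field) = k"
proof -
  let ?Z = "pencil_solutions k k {..<q} {..<Suc q} (bidiag (- l) 1) (bidiag 1 0 :: nat \<Rightarrow> nat \<Rightarrow> 'a)"
  have Z: "z \<in> ?Z \<longleftrightarrow> z \<in> coord_space ({..<k} \<times> {..<Suc q}) \<and>
    (\<forall>i<k. \<forall>r<q. z (i, Suc r) - l * z (i, r) = (if i = 0 then 0 else z (i - 1, r)))" for z
    by (auto simp: pencil_solutions_def bidiag_sum)
  have "?Z = cell k (Suc q) l ` coord_space {..<k}"
  proof
    show "?Z \<subseteq> cell k (Suc q) l ` coord_space {..<k}"
    proof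
      fix z assume z: "z \<in> ?Z"
      have "z = cell k (Suc q) l (\<lambda>i. z (i, 0))"
      proof (rule cell_shape)
        show "z \<in> coord_space ({..<k} \<times> {..<Suc q})" using z Z by blast
        fix i r assume "i < k" "Suc r < Suc q"
        then have "z (i, Suc r) - l * z (i, r) = (if i = 0 then 0 else z (i - 1, r))" using z Z by auto
        then show "z (i, Suc r) = l * z (i, r) + (if i = 0 then 0 else z (i - 1, r))" by (simp add: algebra_simps)
      qed
      moreover have "(\<lambda>i. z (i, 0)) \<in> coord_space {..<k}" using z Z by (auto simp: coord_space_def)
      ultimately show "z \<in> cell k (Suc q) l ` coord_space {..<k}" by blast
    qed
    show "cell k (Suc q) l ` coord_space {..<k} \<subseteq> ?Z"
    proof (rule image_subsetI)
      fix w :: "nat \<Rightarrow> 'a"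
      have "cell k (Suc q) l w \<in> coord_space ({..<k} \<times> {..<Suc q})" by (auto simp: coord_space_def cell_def)
      then show "cell k (Suc q) l w \<in> ?Z" unfolding Z using cell_recursion[of _ k _ "Suc q" l w] by auto
    qed
  qed
  then show ?thesis unfolding nullity_def using cell_dim[of "{..<k}" k "Suc q" l] by simp
qed

lemma nullity_rectangular_closed:
  "nullity (Suc k) k {..<q} {..<Suc q} (bidiag 0 1) (bidiag 1 0 :: nat \<Rightarrow> nat \<Rightarrow> 'a :: field) = k - q"
proof -
  let ?Z = "pencil_solutions (Suc k) k {..<q} {..<Suc q} (bidiag 0 1) (bidiag 1 0 :: nat \<Rightarrow> nat \<Rightarrow> 'a)"
  define T where "T = {..<k - q}"
  have Z: "z \<in> ?Z \<longleftrightarrow> z \<in> coord_space ({..<k} \<times> {..<Suc q}) \<and>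
    (\<forall>i<Suc k. \<forall>r<q. z (i, Suc r) = (if i = 0 then 0 else z (i - 1, r)))" for z
    by (auto simp: pencil_solutions_def bidiag_sum)
  have "?Z = cell k (Suc q) 0 ` coord_space T"
  proof
    show "?Z \<subseteq> cell k (Suc q) 0 ` coord_space T"
    proof
      fix z assume z: "z \<in> ?Z"
      have step: "z (i, Suc r) = (if i = 0 then 0 else z (i - 1, r))" if "i < Suc k" "r < q" for i r
        using z Z that by blast
      have off: "z (i, r) = 0" if "\<not> (i < k \<and> r < Suc q)" for i r
        using z that unfolding Z by (auto simp: coord_space_def)
      have eq: "z = cell k (Suc q) 0 (\<lambda>i. z (i, 0))"
        by (rule cell_shape) (use z step in \<open>auto simp: Z\<close>)
      have "z (t, 0) = 0" if t: "t \<notin> T" for t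
      proof (cases "t < k")
        case True
        define r where "r = k - 1 - t"
        have r: "r < q" "r \<le> k - 1" "k - 1 - r = t" using True t by (auto simp: T_def r_def)
        have "z (k - 1, r) = z (t, 0)"
          by (subst eq) (use True r in \<open>auto simp: cell_def cell_entry_0\<close>)
        moreover have "z (k - 1, r) = 0" using step[of k r] off[of k "Suc r"] r(1) True by simp
        ultimately show ?thesis by simp
      next
        case False then show ?thesis using off by simp
      qed
      then show "z \<in> cell k (Suc q) 0 ` coord_space T" using eq by (auto simp: coord_space_def)
    qed
    show "cell k (Suc q) 0 ` coord_space T \<subseteq> ?Z"
    proof (rule image_subsetI)
      fix w :: "nat \<Rightarrow> 'a" assume w: "w \<in> coord_space T"
      have "cell k (Suc q) 0 w (i, Suc r) = (if i = 0 then 0 else cell k (Suc q) 0 w (i - 1, r))"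
        if "i < Suc k" "r < q" for i r
      proof (cases "i < k")
        case True then show ?thesis using cell_recursion[of i k r "Suc q" 0 w] that by simp
      next
        case False
        then have i: "i = k" using that by simp
        have "cell k (Suc q) 0 w (k - 1, r) = 0"
        proof -
          have "w (k - 1 - r) = 0" if "k \<noteq> 0" "r \<le> k - 1" using w that \<open>r < q\<close> by (auto simp: coord_space_def T_def)
          then show ?thesis by (auto simp: cell_def cell_entry_0)
        qed
        moreover have "cell k (Suc q) 0 w (k, Suc r) = 0" by (simp add: cell_def)
        ultimately show ?thesis using i by simp
      qed
      then show "cell k (Suc q) 0 w \<in> ?Z" unfolding Z by (auto simp: coord_space_def cell_def)
    qed
  qed
  moreover have "T \<subseteq> {..<k}" "card T = k - q" by (auto simp: T_def)
  ultimately show ?thesis unfolding nullity_def using cell_dim[of T k "Suc q" 0] by simp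
qed

lemma bij_betw_reverse: "bij_betw (\<lambda>j. n - 1 - j) {..<n} {..<(n :: nat)}"
  by (rule bij_betw_byWitness[where f' = "\<lambda>j. n - 1 - j"]) auto

text \<open>Reversing the order of rows and columns transposes a square matrix \<^const>\<open>bidiag\<close>.\<close>

lemma nullity_lower:
  fixes x y u v :: "'a :: field"
  shows "nullity m k {..<n} {..<n} (\<lambda>r j. bidiag x y j r) (\<lambda>r j. bidiag u v j r) = nullity m k {..<n} {..<n} (bidiag x y) (bidiag u v)"
proof -
  have img: "(\<lambda>j. n - 1 - j) ` {..<n} = {..<n}" using bij_betw_reverse by (rule bij_betw_imp_surj_on)
  have e: "bidiag x y (n - 1 - j) (n - 1 - r) = bidiag x y r j" if "r < n" "j < n" for x y :: 'a and r j
  proof -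
    have "n - 1 - r = n - 1 - j \<longleftrightarrow> j = r" "n - 1 - r = Suc (n - 1 - j) \<longleftrightarrow> j = Suc r" using that by auto
    then show ?thesis by (simp add: bidiag_def)
  qed
  have "nullity m k {..<n} {..<n} (\<lambda>r j. bidiag x y j r) (\<lambda>r j. bidiag u v j r) =
      nullity m k {..<n} {..<n} (\<lambda>r j. bidiag x y (n - 1 - j) (n - 1 - r)) (\<lambda>r j. bidiag u v (n - 1 - j) (n - 1 - r))"
    by (rule nullity_reindex[OF bij_betw_reverse img finite_lessThan])
  also have "\<dots> = nullity m k {..<n} {..<n} (bidiag x y) (bidiag u v)"
    by (rule nullity_cong; rule e; simp)
  finally show ?thesis .
qed

lemma nullity_rectangular_reverse:
  "nullity m k {..<q} {..<Suc q} (bidiag 1 0) (bidiag 0 1 :: nat \<Rightarrow> nat \<Rightarrow> 'a :: field) =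
    nullity m k {..<q} {..<Suc q} (bidiag 0 1) (bidiag 1 0 :: nat \<Rightarrow> nat \<Rightarrow> 'a)"
proof -
  have img: "(\<lambda>j. q - 1 - j) ` {..<q} = {..<q}" using bij_betw_reverse by (rule bij_betw_imp_surj_on)
  have e: "bidiag 1 0 (q - 1 - r) (Suc q - 1 - j) = (bidiag 0 1 r j :: 'a)"
    "bidiag 0 1 (q - 1 - r) (Suc q - 1 - j) = (bidiag 1 0 r j :: 'a)" if "r < q" "j < Suc q" for r j
  proof -
    have "Suc q - 1 - j = q - 1 - r \<longleftrightarrow> j = Suc r" "Suc q - 1 - j = Suc (q - 1 - r) \<longleftrightarrow> j = r" using that by auto
    then show "bidiag 1 0 (q - 1 - r) (Suc q - 1 - j) = (bidiag 0 1 r j :: 'a)"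
      "bidiag 0 1 (q - 1 - r) (Suc q - 1 - j) = (bidiag 1 0 r j :: 'a)"
      by (simp_all add: bidiag_def)
  qed
  have "nullity m k {..<q} {..<Suc q} (bidiag 1 0) (bidiag 0 1 :: nat \<Rightarrow> nat \<Rightarrow> 'a) =
      nullity m k {..<q} {..<Suc q} (\<lambda>r j. bidiag 1 0 (q - 1 - r) (Suc q - 1 - j))
        (\<lambda>r j. bidiag 0 1 (q - 1 - r) (Suc q - 1 - j) :: 'a)"
    by (rule nullity_reindex[OF bij_betw_reverse[of "Suc q"] img finite_lessThan])
  also have "\<dots> = nullity m k {..<q} {..<Suc q} (bidiag 0 1) (bidiag 1 0 :: nat \<Rightarrow> nat \<Rightarrow> 'a)"
    by (rule nullity_cong; rule e; simp)
  finally show ?thesis .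
qed

section \<open>Uniqueness of the canonical form\<close>

text \<open>The entries of the matrix \<open>x A + y B\<close>, where \<open>P = (A, B)\<close>.\<close>

definition pencil_entry :: "'a :: field \<Rightarrow> 'a \<Rightarrow> 'a mat \<times> 'a mat \<Rightarrow> nat \<Rightarrow> nat \<Rightarrow> 'a" where
  "pencil_entry x y P r j = x * fst P $$ (r, j) + y * snd P $$ (r, j)"

text \<open>The dimension of the space of solutions for \<open>C = x A + y B\<close> and \<open>D = u A + v B\<close>.\<close>

definition pencil_nullity :: "nat \<Rightarrow> nat \<Rightarrow> 'a :: field \<Rightarrow> 'a \<Rightarrow> 'a \<Rightarrow> 'a \<Rightarrow> 'a mat \<times> 'a mat \<Rightarrow> nat" where
  "pencil_nullity m k x y u v P =
    nullity m k {..<dim_row (fst P)} {..<dim_row (fst P)} (pencil_entry x y P) (pencil_entry u v P)"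

lemma congruent_pairs_obtain:
  assumes "congruent_pairs P Q"
  obtains n S T where "fst P \<in> carrier_mat n n" "snd P \<in> carrier_mat n n" "fst Q \<in> carrier_mat n n" "snd Q \<in> carrier_mat n n"
    "S \<in> carrier_mat n n" "T \<in> carrier_mat n n" "S * T = 1\<^sub>m n" "T * S = 1\<^sub>m n"
    "S * fst P * transpose_mat S = fst Q" "S * snd P * transpose_mat S = snd Q"
proof -
  obtain A B A' B' where PQ: "P = (A, B)" "Q = (A', B')" by (cases P, cases Q)
  obtain n S where S: "{A, B, A', B', S} \<subseteq> carrier_mat n n" "invertible_mat S"
    "S * A * transpose_mat S = A'" "S * B * transpose_mat S = B'"
    using assms unfolding PQ congruent_pairs.simps by blast
  obtain T where T: "inverts_mat S T" "inverts_mat T S" using S(2) by (auto simp: invertible_mat_def)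
  have SC: "S \<in> carrier_mat n n" using S(1) by blast
  have 1: "S * T = 1\<^sub>m n" using T(1) SC by (simp add: inverts_mat_def)
  have "dim_col T = n" using arg_cong[OF 1, of dim_col] by simp
  moreover have "dim_row T = n"
    using T(2) SC unfolding inverts_mat_def by (metis carrier_matD(2) index_mult_mat(3) index_one_mat(3))
  ultimately have TC: "T \<in> carrier_mat n n" by (intro carrier_matI)
  have "T * S = 1\<^sub>m n" using T(2) TC by (simp add: inverts_mat_def)
  then show ?thesis using that[of n S T] S SC TC 1 PQ by auto
qed

lemma congruent_pairs_sym:
  assumes "congruent_pairs P Q" shows "congruent_pairs Q P"
proof -
  obtain n S T where c: "fst P \<in> carrier_mat n n" "snd P \<in> carrier_mat n n" "fst Q \<in> carrier_mat n n" "snd Q \<in> carrier_mat n n"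
    and ST: "S \<in> carrier_mat n n" "T \<in> carrier_mat n n" "S * T = 1\<^sub>m n" "T * S = 1\<^sub>m n"
    and eq: "S * fst P * transpose_mat S = fst Q" "S * snd P * transpose_mat S = snd Q"
    using congruent_pairs_obtain[OF assms] by metis
  have undo: "T * (S * X * transpose_mat S) * transpose_mat T = X" if X: "X \<in> carrier_mat n n" for X
  proof -
    have tr: "transpose_mat S * transpose_mat T = 1\<^sub>m n"
      using transpose_mult[OF ST(2,1)] ST(4) by simp
    have "T * (S * X * transpose_mat S) * transpose_mat T = (T * S) * X * (transpose_mat S * transpose_mat T)"
      using ST(1,2) X by (simp add: assoc_mult_mat[of _ n n _ n _ n])
    then show ?thesis unfolding tr ST(4) using X by simp
  qed
  have "invertible_mat T" using ST unfolding invertible_mat_def inverts_mat_def by auto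
  then show ?thesis
    using c ST eq undo[OF c(1)] undo[OF c(2)] by (cases P, cases Q) (auto intro!: exI[of _ n] exI[of _ T])
qed

lemma pencil_nullity_le:
  assumes "congruent_pairs P Q"
  shows "pencil_nullity m k x y u v Q \<le> pencil_nullity m k x y u v P"
proof -
  obtain n S T where c: "fst P \<in> carrier_mat n n" "snd P \<in> carrier_mat n n" "fst Q \<in> carrier_mat n n" "snd Q \<in> carrier_mat n n"
    and ST: "S \<in> carrier_mat n n" "T \<in> carrier_mat n n" "S * T = 1\<^sub>m n" "T * S = 1\<^sub>m n"
    and eq: "S * fst P * transpose_mat S = fst Q" "S * snd P * transpose_mat S = snd Q"
    using congruent_pairs_obtain[OF assms] by metis
  have ent: "(\<Sum>r<n. T $$ (p, r) * Y $$ (r, j)) = (\<Sum>q<n. X $$ (p, q) * S $$ (j, q))"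
    if XY: "X \<in> carrier_mat n n" "Y \<in> carrier_mat n n" "S * X * transpose_mat S = Y" and pj: "p < n" "j < n" for X Y p j
  proof -
    have "T * Y = (T * S) * (X * transpose_mat S)"
      using ST(1,2) XY(1) unfolding XY(3)[symmetric] by (simp add: assoc_mult_mat[of _ n n _ n _ n])
    also have "\<dots> = X * transpose_mat S" unfolding ST(4) using XY(1) ST(1) by simp
    finally have "(T * Y) $$ (p, j) = (X * transpose_mat S) $$ (p, j)" by simp
    then show ?thesis using ST(1,2) XY(1,2) pj by (simp add: scalar_prod_def atLeast0LessThan)
  qed
  have comb: "(\<Sum>r<n. T $$ (p, r) * pencil_entry x y Q r j) = (\<Sum>q<n. pencil_entry x y P p q * S $$ (j, q))"
    if "p < n" "j < n" for p j x y
  proof -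
    have "(\<Sum>r<n. T $$ (p, r) * pencil_entry x y Q r j)
        = x * (\<Sum>r<n. T $$ (p, r) * fst Q $$ (r, j)) + y * (\<Sum>r<n. T $$ (p, r) * snd Q $$ (r, j))"
      unfolding sum_distrib_left sum.distrib[symmetric] by (intro sum.cong) (auto simp: pencil_entry_def algebra_simps)
    also have "\<dots> = x * (\<Sum>q<n. fst P $$ (p, q) * S $$ (j, q)) + y * (\<Sum>q<n. snd P $$ (p, q) * S $$ (j, q))"
      using ent[OF c(1,3) eq(1) that] ent[OF c(2,4) eq(2) that] by simp
    also have "\<dots> = (\<Sum>q<n. pencil_entry x y P p q * S $$ (j, q))"
      unfolding sum_distrib_left sum.distrib[symmetric] by (intro sum.cong) (auto simp: pencil_entry_def algebra_simps)
    finally show ?thesis .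
  qed
  have inv: "(\<Sum>q<n. T $$ (q, i) * S $$ (j, q)) = (if i = j then 1 else 0)" if "i < n" "j < n" for i j
  proof -
    have "(S * T) $$ (j, i) = (\<Sum>q<n. S $$ (j, q) * T $$ (q, i))"
      using ST(1,2) that by (simp add: scalar_prod_def atLeast0LessThan)
    then show ?thesis using ST(3) that by (auto simp: mult.commute)
  qed
  have d: "dim_row (fst P) = n" "dim_row (fst Q) = n" using c by auto
  show ?thesis
    unfolding pencil_nullity_def d
    by (rule nullity_le_of_equivalence[where T = "\<lambda>p r. T $$ (p, r)" and S = "\<lambda>q j. S $$ (j, q)" and S' = "\<lambda>i q. T $$ (q, i)"])
      (use comb inv in auto)
qed

lemma pencil_nullity_congruent:
  "congruent_pairs P Q \<Longrightarrow> pencil_nullity m k x y u v P = pencil_nullity m k x y u v Q"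
  using pencil_nullity_le[OF congruent_pairs_sym] pencil_nullity_le by (metis le_antisym)

text \<open>A pair of square matrices of size \<open>n\<close>.\<close>

definition square_pair :: "nat \<Rightarrow> 'a :: field mat \<times> 'a mat \<Rightarrow> bool" where
  "square_pair n P \<longleftrightarrow> fst P \<in> carrier_mat n n \<and> snd P \<in> carrier_mat n n"

lemma lessThan_add_split: "{..<p + q} = {..<p} \<union> {p..<p + q :: nat}" by auto

lemma shift_bij: "bij_betw (\<lambda>j. j + p) {..<q} {p..<p + q :: nat}"
  by (rule bij_betw_byWitness[where f' = "\<lambda>j. j - p"]) auto

lemma pencil_nullity_four_block:
  assumes P: "square_pair p P" and Q: "square_pair q Q"
    and R: "fst R = four_block_mat (fst P) (0\<^sub>m p q) (0\<^sub>m q p) (fst Q)"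
      "snd R = four_block_mat (snd P) (0\<^sub>m p q) (0\<^sub>m q p) (snd Q)"
  shows "pencil_nullity m k x y u v R = pencil_nullity m k x y u v P + pencil_nullity m k x y u v Q"
proof -
  have d: "fst P \<in> carrier_mat p p" "snd P \<in> carrier_mat p p" "fst Q \<in> carrier_mat q q" "snd Q \<in> carrier_mat q q"
    using P Q by (auto simp: square_pair_def)
  have dR: "dim_row (fst R) = p + q" using d by (simp add: R)
  have ind: "pencil_entry x y R r j = 
      (if r < p then (if j < p then pencil_entry x y P r j else 0) else (if j < p then 0 else pencil_entry x y Q (r - p) (j - p)))"
    if "r < p + q" "j < p + q" for r j x y
    using that d by (auto simp: pencil_entry_def R)
  have img: "(\<lambda>j. j + p) ` {..<q} = {p..<p + q}" using shift_bij by (rule bij_betw_imp_surj_on)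
  have "pencil_nullity m k x y u v R = nullity m k ({..<p} \<union> {p..<p + q}) ({..<p} \<union> {p..<p + q}) (pencil_entry x y R) (pencil_entry u v R)"
    by (simp add: pencil_nullity_def dR lessThan_add_split)
  also have "\<dots> = nullity m k {..<p} {..<p} (pencil_entry x y R) (pencil_entry u v R) +
      nullity m k {p..<p + q} {p..<p + q} (pencil_entry x y R) (pencil_entry u v R)"
    by (rule nullity_split) (auto simp: ind)
  also have "nullity m k {..<p} {..<p} (pencil_entry x y R) (pencil_entry u v R) = pencil_nullity m k x y u v P"
    unfolding pencil_nullity_def using d by (simp, intro nullity_cong) (auto simp: ind)
  also have "nullity m k {p..<p + q} {p..<p + q} (pencil_entry x y R) (pencil_entry u v R) =
      nullity m k {..<q} {..<q} (\<lambda>r j. pencil_entry x y R (r + p) (j + p)) (\<lambda>r j. pencil_entry u v R (r + p) (j + p))"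
    by (rule nullity_reindex[OF shift_bij img]) simp
  also have "\<dots> = pencil_nullity m k x y u v Q"
    unfolding pencil_nullity_def using d by (simp, intro nullity_cong) (auto simp: ind)
  finally show ?thesis .
qed

lemma pencil_nullity_direct_sum:
  assumes "\<forall>p\<in>set ps. \<exists>n. square_pair n p"
  shows "(\<exists>n. square_pair n (direct_sum_pairs ps)) \<and>
    pencil_nullity m k x y u v (direct_sum_pairs ps) = (\<Sum>p\<leftarrow>ps. pencil_nullity m k x y u v p)"
  using assms
proof (induction ps)
  case Nil
  have "nullity m k {..<0} {..<0} (pencil_entry x y (direct_sum_pairs [])) (pencil_entry u v (direct_sum_pairs [])) = 0"
  proof -
    have Z: "pencil_solutions m k {..<0} {..<0} C D = {0}" for C D :: "nat \<Rightarrow> nat \<Rightarrow> 'a"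
    proof -
      have "pencil_solutions m k {..<0} {..<0} C D \<subseteq> {0}"
        by (auto simp: pencil_solutions_def coord_space_def fun_eq_iff)
      then show ?thesis using fv.subspace_0[OF pencil_solutions_subspace[of m k "{..<0}" "{..<0}" C D]] by blast
    qed
    show ?thesis unfolding nullity_def using fv.dim_eq_0_iff[OF pencil_solutions_fd[OF finite_lessThan]] Z by blast
  qed
  then show ?case by (auto simp: pencil_nullity_def direct_sum_pairs_def square_pair_def intro!: exI[of _ 0])
next
  case (Cons p ps)
  obtain n where n: "square_pair n p" using Cons.prems by auto
  obtain q where q: "square_pair q (direct_sum_pairs ps)" using Cons by auto
  have R: "fst (direct_sum_pairs (p # ps)) = four_block_mat (fst p) (0\<^sub>m n q) (0\<^sub>m q n) (fst (direct_sum_pairs ps))"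
    "snd (direct_sum_pairs (p # ps)) = four_block_mat (snd p) (0\<^sub>m n q) (0\<^sub>m q n) (snd (direct_sum_pairs ps))"
    using n q by (auto simp: direct_sum_pairs_def square_pair_def Let_def)
  have "square_pair (n + q) (direct_sum_pairs (p # ps))"
    unfolding square_pair_def R using n q by (auto simp: square_pair_def)
  then show ?case using pencil_nullity_four_block[OF n q R] Cons by auto
qed

lemma skew_block_carrier: "M \<in> carrier_mat p q \<Longrightarrow> skew_block M \<in> carrier_mat (p + q) (p + q)"
  by (auto simp: skew_block_def)

lemma pencil_nullity_skew:
  fixes M N :: "'a :: field mat"
  assumes M: "M \<in> carrier_mat p q" and N: "N \<in> carrier_mat p q"
  shows "pencil_nullity m k x y u v (skew_block M, skew_block N) =
    nullity m k {..<p} {..<q} (pencil_entry x y (M, N)) (pencil_entry u v (M, N)) +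
    nullity m k {..<q} {..<p} (\<lambda>r j. pencil_entry x y (M, N) j r) (\<lambda>r j. pencil_entry u v (M, N) j r)"
proof -
  let ?R = "(skew_block M, skew_block N)"
  have dR: "dim_row (fst ?R) = p + q" using M by (simp add: skew_block_def)
  have ind: "pencil_entry x y ?R r j =
      (if r < p then (if j < p then 0 else pencil_entry x y (M, N) r (j - p)) else (if j < p then - pencil_entry x y (M, N) j (r - p) else 0))"
    if "r < p + q" "j < p + q" for r j x y
    using that M N by (auto simp: pencil_entry_def skew_block_def)
  have img: "(\<lambda>j. j + p) ` {..<q} = {p..<p + q}" using shift_bij by (rule bij_betw_imp_surj_on)
  have "pencil_nullity m k x y u v ?R = nullity m k ({..<p} \<union> {p..<p + q}) ({p..<p + q} \<union> {..<p}) (pencil_entry x y ?R) (pencil_entry u v ?R)"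
    unfolding pencil_nullity_def dR lessThan_add_split by (simp add: Un_commute)
  also have "\<dots> = nullity m k {..<p} {p..<p + q} (pencil_entry x y ?R) (pencil_entry u v ?R) +
      nullity m k {p..<p + q} {..<p} (pencil_entry x y ?R) (pencil_entry u v ?R)"
    by (rule nullity_split) (auto simp: ind)
  also have "nullity m k {..<p} {p..<p + q} (pencil_entry x y ?R) (pencil_entry u v ?R) =
      nullity m k {..<p} {..<q} (\<lambda>r j. pencil_entry x y ?R r (j + p)) (\<lambda>r j. pencil_entry u v ?R r (j + p))"
    by (rule nullity_reindex[OF shift_bij, where g = "\<lambda>r. r"]) auto
  also have "\<dots> = nullity m k {..<p} {..<q} (pencil_entry x y (M, N)) (pencil_entry u v (M, N))"
    by (rule nullity_cong) (auto simp: ind)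
  also have "nullity m k {p..<p + q} {..<p} (pencil_entry x y ?R) (pencil_entry u v ?R) =
      nullity m k {..<q} {..<p} (\<lambda>r j. pencil_entry x y ?R (r + p) j) (\<lambda>r j. pencil_entry u v ?R (r + p) j)"
    by (rule nullity_reindex[where h = "\<lambda>j. j", OF _ img]) (auto simp: bij_betw_def)
  also have "\<dots> = nullity m k {..<q} {..<p} (\<lambda>r j. - pencil_entry x y (M, N) j r) (\<lambda>r j. - pencil_entry u v (M, N) j r)"
    by (rule nullity_cong) (auto simp: ind)
  also have "\<dots> = nullity m k {..<q} {..<p} (\<lambda>r j. pencil_entry x y (M, N) j r) (\<lambda>r j. pencil_entry u v (M, N) j r)"
    by (rule nullity_uminus)
  finally show ?thesis .
qed

lemma pencil_nullity_J_pair: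
  "pencil_nullity m k x y u v (J_pair n c) =
    2 * nullity m k {..<n} {..<n} (bidiag (x + y * c) y) (bidiag (u + v * c) v)"
proof -
  have c: "1\<^sub>m n \<in> carrier_mat n n" "lower_jordan_block n c \<in> carrier_mat n n" by (auto simp: lower_jordan_block_mat)
  have e: "pencil_entry x y (1\<^sub>m n, lower_jordan_block n c) r j = bidiag (x + y * c) y j r" if "r < n" "j < n" for r j x y
    using that by (auto simp: pencil_entry_def lower_jordan_block_mat bidiag_def)
  have 1: "nullity m k {..<n} {..<n} (pencil_entry x y (1\<^sub>m n, lower_jordan_block n c)) (pencil_entry u v (1\<^sub>m n, lower_jordan_block n c))
    = nullity m k {..<n} {..<n} (\<lambda>r j. bidiag (x + y * c) y j r) (\<lambda>r j. bidiag (u + v * c) v j r)"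
    by (rule nullity_cong) (auto simp: e)
  have 2: "nullity m k {..<n} {..<n} (\<lambda>r j. pencil_entry x y (1\<^sub>m n, lower_jordan_block n c) j r) (\<lambda>r j. pencil_entry u v (1\<^sub>m n, lower_jordan_block n c) j r)
    = nullity m k {..<n} {..<n} (bidiag (x + y * c) y) (bidiag (u + v * c) v)"
    by (rule nullity_cong) (auto simp: e)
  show ?thesis unfolding J_pair_def pencil_nullity_skew[OF c] 1 2 nullity_lower by simp
qed

lemma pencil_nullity_K_pair:
  "pencil_nullity m k x y u v (K_pair n) = 2 * nullity m k {..<n} {..<n} (bidiag y x) (bidiag v u)"
proof -
  have c: "lower_jordan_block n 0 \<in> carrier_mat n n" "1\<^sub>m n \<in> carrier_mat n n" by (auto simp: lower_jordan_block_mat)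
  have e: "pencil_entry x y (lower_jordan_block n 0, 1\<^sub>m n) r j = bidiag y x j r" if "r < n" "j < n" for r j x y
    using that by (auto simp: pencil_entry_def lower_jordan_block_mat bidiag_def)
  have 1: "nullity m k {..<n} {..<n} (pencil_entry x y (lower_jordan_block n 0, 1\<^sub>m n)) (pencil_entry u v (lower_jordan_block n 0, 1\<^sub>m n))
    = nullity m k {..<n} {..<n} (\<lambda>r j. bidiag y x j r) (\<lambda>r j. bidiag v u j r)"
    by (rule nullity_cong) (auto simp: e)
  have 2: "nullity m k {..<n} {..<n} (\<lambda>r j. pencil_entry x y (lower_jordan_block n 0, 1\<^sub>m n) j r) (\<lambda>r j. pencil_entry u v (lower_jordan_block n 0, 1\<^sub>m n) j r)
    = nullity m k {..<n} {..<n} (bidiag y x) (bidiag v u)"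
    by (rule nullity_cong) (auto simp: e)
  show ?thesis unfolding K_pair_def pencil_nullity_skew[OF c] 1 2 nullity_lower by simp
qed

lemma pencil_nullity_L_pair:
  "pencil_nullity m k x y u v (L_pair (Suc q)) =
    nullity m k {..<q} {..<Suc q} (bidiag x y) (bidiag u v) +
    nullity m k {..<Suc q} {..<q} (\<lambda>r j. bidiag x y j r) (\<lambda>r j. bidiag u v j r)"
proof -
  have c: "L_mat (Suc q) \<in> carrier_mat q (Suc q)" "R_mat (Suc q) \<in> carrier_mat q (Suc q)" by (auto simp: L_mat_def R_mat_def)
  have e: "pencil_entry x y (L_mat (Suc q), R_mat (Suc q)) r j = bidiag x y r j" if "r < q" "j < Suc q" for r j and x y :: 'a
    using that by (auto simp: pencil_entry_def L_mat_def R_mat_def bidiag_def)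
  have 1: "nullity m k {..<q} {..<Suc q} (pencil_entry x y (L_mat (Suc q), R_mat (Suc q))) (pencil_entry u v (L_mat (Suc q), R_mat (Suc q)))
    = nullity m k {..<q} {..<Suc q} (bidiag x y) (bidiag u v)"
    by (rule nullity_cong) (auto simp: e)
  have 2: "nullity m k {..<Suc q} {..<q} (\<lambda>r j. pencil_entry x y (L_mat (Suc q), R_mat (Suc q)) j r) (\<lambda>r j. pencil_entry u v (L_mat (Suc q), R_mat (Suc q)) j r)
    = nullity m k {..<Suc q} {..<q} (\<lambda>r j. bidiag x y j r) (\<lambda>r j. bidiag u v j r)"
    by (rule nullity_cong) (auto simp: e)
  show ?thesis unfolding L_pair_def pencil_nullity_skew[OF c] 1 2 by simp
qed

text \<open>Three families of invariants of a pair \<open>(A, B)\<close>, with \<open>(C, D) = (A, B)\<close> for the first two and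
  \<open>(C, D) = (B - l A, A)\<close> for the third one. The second family has the additional equation
  \<open>D (z (k - 1)) = 0\<close>.\<close>

definition nullity_inf :: "nat \<Rightarrow> 'a :: field mat \<times> 'a mat \<Rightarrow> nat" where
  "nullity_inf k = pencil_nullity k k 1 0 0 1"

definition nullity_closed :: "nat \<Rightarrow> 'a :: field mat \<times> 'a mat \<Rightarrow> nat" where
  "nullity_closed k = pencil_nullity (Suc k) k 1 0 0 1"

definition nullity_at :: "'a :: field \<Rightarrow> nat \<Rightarrow> 'a mat \<times> 'a mat \<Rightarrow> nat" where
  "nullity_at l k = pencil_nullity k k (- l) 1 1 0"

lemma nullity_inf_values:
  "nullity_inf k (J_pair n c) = 0" "nullity_inf k (K_pair n) = 2 * min n k" "nullity_inf k (L_pair (Suc q)) = k"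
  using nullity_rectangular[of k q 0]
  by (simp_all add: nullity_inf_def pencil_nullity_J_pair pencil_nullity_K_pair pencil_nullity_L_pair
      nullity_bidiag_unit nullity_nilpotent nullity_rectangular_reverse nullity_bidiag_transposed)

lemma nullity_closed_values:
  "nullity_closed k (J_pair n c) = 0" "nullity_closed k (K_pair n) = 0" "nullity_closed k (L_pair (Suc q)) = k - q"
  by (simp_all add: nullity_closed_def pencil_nullity_J_pair pencil_nullity_K_pair pencil_nullity_L_pair
      nullity_bidiag_unit nullity_bidiag_unit' nullity_rectangular_reverse nullity_rectangular_closed nullity_bidiag_transposed)

lemma nullity_at_values:
  "nullity_at l k (J_pair n c) = (if c = l then 2 * min n k else 0)" "nullity_at l k (K_pair n) = 0"
  "nullity_at l k (L_pair (Suc q)) = k"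
  by (simp_all add: nullity_at_def pencil_nullity_J_pair pencil_nullity_K_pair pencil_nullity_L_pair
      nullity_bidiag_unit nullity_nilpotent nullity_rectangular nullity_bidiag_transposed)

lemma canonical_cases:
  assumes "p \<in> canonical_pairs"
  obtains n c where "p = J_pair (Suc n) c" | n where "p = K_pair (Suc n)" | n where "p = L_pair (Suc n)"
  using assms unfolding canonical_pairs_def by (auto simp: Suc_le_eq gr0_conv_Suc)

lemma canonical_square: "p \<in> canonical_pairs \<Longrightarrow> \<exists>n. square_pair n p"
proof (erule canonical_cases)
  fix n c assume "p = J_pair (Suc n) c"
  then have "square_pair (Suc n + Suc n) p"
    by (auto simp: square_pair_def J_pair_def lower_jordan_block_mat intro!: skew_block_carrier simp del: add_Suc add_Suc_right)
  then show ?thesis by blast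
next
  fix n assume "p = K_pair (Suc n)"
  then have "square_pair (Suc n + Suc n) p"
    by (auto simp: square_pair_def K_pair_def lower_jordan_block_mat intro!: skew_block_carrier simp del: add_Suc add_Suc_right)
  then show ?thesis by blast
next
  fix n assume "p = L_pair (Suc n)"
  then have "square_pair (n + Suc n) p"
    by (auto simp: square_pair_def L_pair_def L_mat_def R_mat_def intro!: skew_block_carrier simp del: add_Suc add_Suc_right)
  then show ?thesis by blast
qed

lemma J_pair_eq: "J_pair (Suc n) c = J_pair (Suc n') c' \<longleftrightarrow> n = n' \<and> c = c'"
proof
  assume eq: "J_pair (Suc n) c = J_pair (Suc n') c'"
  have "nullity_at c 1 (J_pair (Suc n) c) = nullity_at c 1 (J_pair (Suc n') c')" using eq by simp
  then have c: "c = c'" by (auto simp: nullity_at_values split: if_splits)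
  have "nullity_at c (Suc n + Suc n') (J_pair (Suc n) c) = nullity_at c (Suc n + Suc n') (J_pair (Suc n') c')" using eq by simp
  then show "n = n' \<and> c = c'" using c by (simp add: nullity_at_values)
qed auto

lemma K_pair_eq: "K_pair (Suc n) = (K_pair (Suc n') :: 'a :: field mat \<times> 'a mat) \<longleftrightarrow> n = n'"
proof
  assume eq: "K_pair (Suc n) = (K_pair (Suc n') :: 'a mat \<times> 'a mat)"
  have "nullity_inf (Suc n + Suc n') (K_pair (Suc n) :: 'a mat \<times> 'a mat) = nullity_inf (Suc n + Suc n') (K_pair (Suc n') :: 'a mat \<times> 'a mat)"
    using eq by simp
  then show "n = n'" by (simp add: nullity_inf_values)
qed auto

lemma L_pair_eq: "L_pair (Suc n) = (L_pair (Suc n') :: 'a :: field mat \<times> 'a mat) \<longleftrightarrow> n = n'"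
proof
  assume eq: "L_pair (Suc n) = (L_pair (Suc n') :: 'a mat \<times> 'a mat)"
  have "nullity_closed (n + n') (L_pair (Suc n) :: 'a mat \<times> 'a mat) = nullity_closed (n + n') (L_pair (Suc n') :: 'a mat \<times> 'a mat)"
    using eq by simp
  then show "n = n'" by (simp add: nullity_closed_values)
qed auto

lemma canonical_distinct:
  "J_pair (Suc n) c \<noteq> K_pair (Suc n')" "K_pair (Suc n') \<noteq> J_pair (Suc n) c"
  "J_pair (Suc n) c \<noteq> L_pair (Suc n')" "L_pair (Suc n') \<noteq> J_pair (Suc n) c"
  "K_pair (Suc n) \<noteq> (L_pair (Suc n') :: 'a :: field mat \<times> 'a mat)" "L_pair (Suc n') \<noteq> (K_pair (Suc n) :: 'a mat \<times> 'a mat)"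
proof -
  show 1: "J_pair (Suc n) c \<noteq> K_pair (Suc n')"
    using nullity_at_values(1)[of c 1 "Suc n" c] nullity_at_values(2)[of c 1 "Suc n'"] by auto
  then show "K_pair (Suc n') \<noteq> J_pair (Suc n) c" by metis
  show 2: "J_pair (Suc n) c \<noteq> L_pair (Suc n')"
    using nullity_at_values(1)[of c 1 "Suc n" c] nullity_at_values(3)[of c 1 "n'"] by auto
  then show "L_pair (Suc n') \<noteq> J_pair (Suc n) c" by metis
  show 3: "K_pair (Suc n) \<noteq> (L_pair (Suc n') :: 'a mat \<times> 'a mat)"
  proof
    assume "K_pair (Suc n) = (L_pair (Suc n') :: 'a mat \<times> 'a mat)"
    then have "nullity_inf 1 (K_pair (Suc n) :: 'a mat \<times> 'a mat) = nullity_inf 1 (L_pair (Suc n') :: 'a mat \<times> 'a mat)"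
      by simp
    then show False by (simp add: nullity_inf_values)
  qed
  then show "L_pair (Suc n') \<noteq> (K_pair (Suc n) :: 'a mat \<times> 'a mat)" by metis
qed

text \<open>The multiplicities are second differences: \<open>2 min n k\<close>, as a function of \<open>k\<close>, has second difference \<open>- 2\<close>
  at \<open>k = n\<close> and \<open>0\<close> elsewhere, and the contributions \<open>k\<close> of the pairs \<open>L_pair\<close> cancel. For the
  truncated difference \<open>k - q\<close> in \<open>nullity_closed\<close> the second difference is \<open>1\<close> at \<open>k = q\<close>; there, for
  \<open>n = 0\<close>, the truncation \<open>n - 1 = 0\<close> is harmless since the invariant vanishes at \<open>k = 0\<close>.\<close>

lemma multiplicity_J:
  assumes "p \<in> canonical_pairs"
  shows "nullity_at l n p + nullity_at l (Suc (Suc n)) p + 2 * (if p = J_pair (Suc n) l then 1 else 0) = 2 * nullity_at l (Suc n) p"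
  using assms by (cases rule: canonical_cases) (auto simp: nullity_at_values J_pair_eq canonical_distinct min_def)

lemma multiplicity_K:
  assumes "p \<in> canonical_pairs"
  shows "nullity_inf n p + nullity_inf (Suc (Suc n)) p + 2 * (if p = K_pair (Suc n) then 1 else 0) = 2 * nullity_inf (Suc n) p"
  using assms by (cases rule: canonical_cases) (auto simp: nullity_inf_values K_pair_eq canonical_distinct min_def)

lemma multiplicity_L:
  assumes "p \<in> canonical_pairs"
  shows "nullity_closed (Suc n) p + nullity_closed (n - 1) p = 2 * nullity_closed n p + (if p = L_pair (Suc n) then 1 else 0)"
  using assms by (cases rule: canonical_cases) (auto simp: nullity_closed_values L_pair_eq canonical_distinct)

lemma canonical_form_unique:
  assumes ps: "set ps \<subseteq> canonical_pairs" "congruent_pairs P (direct_sum_pairs ps)"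
    and qs: "set qs \<subseteq> canonical_pairs" "congruent_pairs P (direct_sum_pairs qs)"
  shows "mset ps = mset qs"
proof (rule multiset_eqI)
  fix p
  have inv: "(\<Sum>p\<leftarrow>ps. pencil_nullity m k x y u v p) = (\<Sum>p\<leftarrow>qs. pencil_nullity m k x y u v p)" for m k x y u v
    using pencil_nullity_direct_sum[of ps m k x y u v] pencil_nullity_direct_sum[of qs m k x y u v]
      canonical_square ps(1) qs(1) pencil_nullity_congruent[OF ps(2), of m k x y u v]
      pencil_nullity_congruent[OF qs(2), of m k x y u v] by (metis subsetD)
  have second: "(\<Sum>p\<leftarrow>rs. f p) + (\<Sum>p\<leftarrow>rs. g p) + 2 * count (mset rs) x = 2 * (\<Sum>p\<leftarrow>rs. h p)"
    if "set rs \<subseteq> canonical_pairs" "\<And>p. p \<in> canonical_pairs \<Longrightarrow> f p + g p + 2 * (if p = x then 1 else 0) = 2 * h p"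
    for rs :: "('a mat \<times> 'a mat) list" and f g h :: "'a mat \<times> 'a mat \<Rightarrow> nat" and x
    using that(1)
  proof (induction rs)
    case (Cons r rs) then show ?case using that(2)[of r] by (auto split: if_splits)
  qed simp
  have second': "(\<Sum>p\<leftarrow>rs. f p) + (\<Sum>p\<leftarrow>rs. g p) = 2 * (\<Sum>p\<leftarrow>rs. h p) + count (mset rs) x"
    if "set rs \<subseteq> canonical_pairs" "\<And>p. p \<in> canonical_pairs \<Longrightarrow> f p + g p = 2 * h p + (if p = x then 1 else 0)"
    for rs :: "('a mat \<times> 'a mat) list" and f g h :: "'a mat \<times> 'a mat \<Rightarrow> nat" and x
    using that(1)
  proof (induction rs)
    case (Cons r rs) then show ?case using that(2)[of r] by (auto split: if_splits)
  qed simp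
  show "count (mset ps) p = count (mset qs) p"
  proof (cases "p \<in> canonical_pairs")
    case True
    then show ?thesis
    proof (cases rule: canonical_cases)
      case (1 n c)
      show ?thesis
        using second[OF ps(1) multiplicity_J[where n = n and l = c]] second[OF qs(1) multiplicity_J[where n = n and l = c]] inv 1
        by (simp add: nullity_at_def)
    next
      case (2 n)
      show ?thesis
        using second[OF ps(1) multiplicity_K[where n = n]] second[OF qs(1) multiplicity_K[where n = n]] inv 2
        by (simp add: nullity_inf_def)
    next
      case (3 n)
      show ?thesis
        using second'[OF ps(1) multiplicity_L[where n = n]] second'[OF qs(1) multiplicity_L[where n = n]] inv 3
        by (simp add: nullity_closed_def)
    qed
  next
    case False
    then show ?thesis using ps(1) qs(1) by (metis count_mset_0_iff subsetD)
  qed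
qed

theorem theorem1:
  fixes A B :: "'a :: alg_closed_field mat" and n :: nat
  assumes "CHAR('a) \<noteq> 2"
    and "A \<in> carrier_mat n n" and "B \<in> carrier_mat n n"
    and "skew_symmetric_mat A" and "skew_symmetric_mat B"
  shows "(\<exists>ps. set ps \<subseteq> canonical_pairs \<and> congruent_pairs (A, B) (direct_sum_pairs ps)) \<and>
    (\<forall>ps qs. set ps \<subseteq> canonical_pairs \<and> congruent_pairs (A, B) (direct_sum_pairs ps) \<and>
             set qs \<subseteq> canonical_pairs \<and> congruent_pairs (A, B) (direct_sum_pairs qs) \<longrightarrow>
             mset ps = mset qs)"
  using canonical_form_exists[OF assms] canonical_form_unique[where P = "(A, B)"] by blast

end
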